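(* For every $p\in[1,\infty)$, $$\alpha_p^*(\mathbb Z\wr\mathbb Z)=\max\left\{\frac{p}{2p-1},\ \frac23\right\}.$$
   Context: For a group $G$ generated by a finite symmetric set $S$, $d_G$ denotes the left-invariant word metric induced by $S$. $L_p$ denotes $L_p([0,1])$. The $L_p$ compression exponent $\alpha_p^*(G)$ is the supremum of those $\alpha\ge 0$ for which there exist a Lipschitz function $f:(G,d_G)\to L_p$ and a constant $c>0$ with $\|f(x)-f(y)\|_p\ge c\,d_G(x,y)^\alpha$ for all $x,y\in G$; it does not depend on the choice of finite symmetric generating set. The (restricted) wreath product $\mathbb Z\wr\mathbb Z$ is the group of all pairs $(f,x)$ where $x\in\mathbb Z$ and $f:\mathbb Z\to\mathbb Z$ has finite support, with product $(f,x)(g,y)=\left(z\mapsto f(z)+g(z-x),\,x+y\right)$. It is finitely generated. *)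

theory Defs
  imports "HOL-Analysis.Analysis" "HOL-Algebra.Generated_Groups"
begin

definition sym_generating_set :: "('a, 'b) monoid_scheme \<Rightarrow> 'a set \<Rightarrow> bool" where
  "sym_generating_set G S \<longleftrightarrow>
     finite S \<and> S \<subseteq> carrier G \<and> (\<forall>s\<in>S. inv\<^bsub>G\<^esub> s \<in> S) \<and> generate G S = carrier G"

definition word_length :: "('a, 'b) monoid_scheme \<Rightarrow> 'a set \<Rightarrow> 'a \<Rightarrow> nat" where
  "word_length G S g =
     (LEAST n. \<exists>w. set w \<subseteq> S \<and> length w = n \<and> foldr (mult G) w \<one>\<^bsub>G\<^esub> = g)"

definition word_dist :: "('a, 'b) monoid_scheme \<Rightarrow> 'a set \<Rightarrow> 'a \<Rightarrow> 'a \<Rightarrow> nat" where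
  "word_dist G S x y = word_length G S (inv\<^bsub>G\<^esub> x \<otimes>\<^bsub>G\<^esub> y)"

(* Elements of L_p([0,1]) are handled through representatives: Lp_fun p is the set of
   p-integrable real functions, Lp_norm p the usual seminorm on it (zero exactly on the
   functions vanishing almost everywhere on [0,1]). *)
definition Lp_fun :: "real \<Rightarrow> (real \<Rightarrow> real) set" where
  "Lp_fun p = {u. u \<in> borel_measurable (lebesgue_on {0..1}) \<and>
                  integrable (lebesgue_on {0..1}) (\<lambda>t. \<bar>u t\<bar> powr p)}"

definition Lp_norm :: "real \<Rightarrow> (real \<Rightarrow> real) \<Rightarrow> real" where
  "Lp_norm p u = (LINT t|lebesgue_on {0..1}. \<bar>u t\<bar> powr p) powr (1 / p)"

definition Lp_Lipschitz ::
    "('a, 'b) monoid_scheme \<Rightarrow> 'a set \<Rightarrow> real \<Rightarrow> ('a \<Rightarrow> real \<Rightarrow> real) \<Rightarrow> bool" where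
  "Lp_Lipschitz G S p f \<longleftrightarrow>
     (\<forall>x\<in>carrier G. f x \<in> Lp_fun p) \<and>
     (\<exists>L. \<forall>x\<in>carrier G. \<forall>y\<in>carrier G.
        Lp_norm p (\<lambda>t. f x t - f y t) \<le> L * real (word_dist G S x y))"

(* The supremum is taken in the extended reals, so that it is a genuine supremum without
   any a priori boundedness. Note that 0 powr a = 0 also for a = 0: the lower bound is
   vacuous on the diagonal for every exponent. *)
definition Lp_compression_exponent ::
    "real \<Rightarrow> ('a, 'b) monoid_scheme \<Rightarrow> 'a set \<Rightarrow> ereal" where
  "Lp_compression_exponent p G S =
     Sup {ereal \<alpha> | \<alpha>. \<alpha> \<ge> 0 \<and>
       (\<exists>f c. Lp_Lipschitz G S p f \<and> c > 0 \<and>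
          (\<forall>x\<in>carrier G. \<forall>y\<in>carrier G.
             Lp_norm p (\<lambda>t. f x t - f y t) \<ge> c * real (word_dist G S x y) powr \<alpha>))}"

definition Z_wr_Z :: "((int \<Rightarrow> int) \<times> int) monoid" where
  "Z_wr_Z = \<lparr>carrier = {f. finite {z. f z \<noteq> 0}} \<times> UNIV,
             mult = (\<lambda>(f, x) (g, y). (\<lambda>z. f z + g (z - x), x + y)),
             one = (\<lambda>z. 0, 0)\<rparr>"

lemma finite_support_shift:
  fixes f :: "int \<Rightarrow> int"
  assumes "finite {z. f z \<noteq> 0}"
  shows "finite {z. f (z + a) \<noteq> 0}"
proof -
  have "{z. f (z + a) \<noteq> 0} = (\<lambda>z. z - a) ` {z. f z \<noteq> 0}"
    by (force simp: image_iff algebra_simps)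
  then show ?thesis using assms by simp
qed

lemma finite_support_add:
  fixes f g :: "int \<Rightarrow> int"
  assumes "finite {z. f z \<noteq> 0}" "finite {z. g z \<noteq> 0}"
  shows "finite {z. f z + g z \<noteq> 0}"
  by (rule finite_subset[of _ "{z. f z \<noteq> 0} \<union> {z. g z \<noteq> 0}"]) (use assms in auto)

lemma Z_wr_Z_l_inv:
  assumes "a \<in> carrier Z_wr_Z"
  shows "\<exists>b\<in>carrier Z_wr_Z. b \<otimes>\<^bsub>Z_wr_Z\<^esub> a = \<one>\<^bsub>Z_wr_Z\<^esub>"
proof -
  obtain f x where a: "a = (f, x)" and f: "finite {z. f z \<noteq> 0}"
    using assms by (auto simp: Z_wr_Z_def)
  show ?thesis
    by (rule bexI[of _ "(\<lambda>z. - f (z + x), - x)"])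
       (use finite_support_shift[OF f, of x] in \<open>auto simp: Z_wr_Z_def a\<close>)
qed

lemma group_Z_wr_Z: "group Z_wr_Z"
proof (rule groupI)
  show "a \<otimes>\<^bsub>Z_wr_Z\<^esub> b \<in> carrier Z_wr_Z"
    if "a \<in> carrier Z_wr_Z" "b \<in> carrier Z_wr_Z" for a b
  proof -
    obtain f x g y where ab: "a = (f, x)" "b = (g, y)" by fastforce
    have f: "finite {z. f z \<noteq> 0}" "finite {z. g z \<noteq> 0}"
      using that by (auto simp: Z_wr_Z_def ab)
    show ?thesis
      using finite_support_add[OF f(1) finite_support_shift[OF f(2), of "- x"]]
      by (simp add: Z_wr_Z_def ab)
  qed
qed (use Z_wr_Z_l_inv in \<open>auto simp: Z_wr_Z_def algebra_simps\<close>)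

definition Z_wr_Z_gens :: "((int \<Rightarrow> int) \<times> int) set" where
  "Z_wr_Z_gens = {(\<lambda>z. 0, 1), (\<lambda>z. 0, - 1),
                  (\<lambda>z. if z = 0 then 1 else 0, 0), (\<lambda>z. if z = 0 then - 1 else 0, 0)}"

lemma Z_wr_Z_gens_closed:
  assumes "s \<in> Z_wr_Z_gens"
  shows "s \<in> carrier Z_wr_Z" "inv\<^bsub>Z_wr_Z\<^esub> s \<in> Z_wr_Z_gens"
proof -
  interpret group Z_wr_Z by (rule group_Z_wr_Z)
  have C: "Z_wr_Z_gens \<subseteq> carrier Z_wr_Z"
    by (auto simp: Z_wr_Z_gens_def Z_wr_Z_def)
  then show "s \<in> carrier Z_wr_Z" using assms by blast
  have "\<exists>t\<in>Z_wr_Z_gens. t \<otimes>\<^bsub>Z_wr_Z\<^esub> s = \<one>\<^bsub>Z_wr_Z\<^esub>"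
    using assms by (auto simp: Z_wr_Z_gens_def Z_wr_Z_def fun_eq_iff)
  then obtain t where t: "t \<in> Z_wr_Z_gens" "t \<otimes>\<^bsub>Z_wr_Z\<^esub> s = \<one>\<^bsub>Z_wr_Z\<^esub>" by blast
  then have "inv\<^bsub>Z_wr_Z\<^esub> s = t"
    using C assms by (intro inv_equality) auto
  then show "inv\<^bsub>Z_wr_Z\<^esub> s \<in> Z_wr_Z_gens" using t by simp
qed

lemma Z_wr_Z_generate_shift: "(\<lambda>z. 0, n) \<in> generate Z_wr_Z Z_wr_Z_gens"
proof -
  let ?H = "generate Z_wr_Z Z_wr_Z_gens"
  have 1: "(\<lambda>z. 0, 1) \<in> ?H" "(\<lambda>z. 0, - 1) \<in> ?H"
    by (auto intro!: generate.incl simp: Z_wr_Z_gens_def)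
  show ?thesis
  proof (induction n rule: int_induct[where k = 0])
    case base
    show ?case using generate.one[of Z_wr_Z] by (simp add: Z_wr_Z_def)
  next
    case (step1 i)
    show ?case using generate.eng[OF step1.IH 1(1)] by (simp add: Z_wr_Z_def)
  next
    case (step2 i)
    show ?case using generate.eng[OF step2.IH 1(2)] by (simp add: Z_wr_Z_def)
  qed
qed

lemma Z_wr_Z_generate_point0:
  "(\<lambda>z. if z = 0 then k else 0, 0) \<in> generate Z_wr_Z Z_wr_Z_gens"
proof -
  let ?H = "generate Z_wr_Z Z_wr_Z_gens"
  have 1: "(\<lambda>z. if z = 0 then 1 else 0, 0) \<in> ?H" "(\<lambda>z. if z = 0 then - 1 else 0, 0) \<in> ?H"
    by (auto intro!: generate.incl simp: Z_wr_Z_gens_def)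
  show ?thesis
  proof (induction k rule: int_induct[where k = 0])
    case base
    show ?case using generate.one[of Z_wr_Z] by (simp add: Z_wr_Z_def)
  next
    case (step1 i)
    show ?case using generate.eng[OF step1.IH 1(1)]
      by (simp add: Z_wr_Z_def if_distrib cong: if_cong)
  next
    case (step2 i)
    show ?case using generate.eng[OF step2.IH 1(2)]
      by (simp add: Z_wr_Z_def if_distrib cong: if_cong)
  qed
qed

lemma Z_wr_Z_generate_point:
  "(\<lambda>z. if z = n then k else 0, 0) \<in> generate Z_wr_Z Z_wr_Z_gens"
  using generate.eng[OF generate.eng[OF Z_wr_Z_generate_shift[of n]
      Z_wr_Z_generate_point0[of k]] Z_wr_Z_generate_shift[of "- n"]]
  by (simp add: Z_wr_Z_def)

lemma Z_wr_Z_generate_lamps: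
  assumes "finite A" "{z. f z \<noteq> 0} \<subseteq> A"
  shows "(f, 0) \<in> generate Z_wr_Z Z_wr_Z_gens"
  using assms
proof (induction A arbitrary: f rule: finite_induct)
  case empty
  then have "f = (\<lambda>z. 0)" by auto
  then show ?case using generate.one[of Z_wr_Z] by (simp add: Z_wr_Z_def)
next
  case (insert a A)
  have "(f(a := 0), 0) \<in> generate Z_wr_Z Z_wr_Z_gens"
    by (rule insert.IH) (use insert.prems in \<open>auto split: if_splits\<close>)
  from generate.eng[OF this Z_wr_Z_generate_point[of a "f a"]]
  have "(\<lambda>z. (f(a := 0)) z + (if z = a then f a else 0), 0) \<in> generate Z_wr_Z Z_wr_Z_gens"
    by (simp add: Z_wr_Z_def)
  moreover have "(\<lambda>z. (f(a := 0)) z + (if z = a then f a else 0)) = f" by auto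
  ultimately show ?case by simp
qed

lemma sym_generating_set_Z_wr_Z_gens: "sym_generating_set Z_wr_Z Z_wr_Z_gens"
  unfolding sym_generating_set_def
proof (intro conjI)
  interpret group Z_wr_Z by (rule group_Z_wr_Z)
  show "finite Z_wr_Z_gens" by (simp add: Z_wr_Z_gens_def)
  show C: "Z_wr_Z_gens \<subseteq> carrier Z_wr_Z" using Z_wr_Z_gens_closed by blast
  show "\<forall>s\<in>Z_wr_Z_gens. inv\<^bsub>Z_wr_Z\<^esub> s \<in> Z_wr_Z_gens" using Z_wr_Z_gens_closed by blast
  show "generate Z_wr_Z Z_wr_Z_gens = carrier Z_wr_Z"
  proof
    show "generate Z_wr_Z Z_wr_Z_gens \<subseteq> carrier Z_wr_Z" by (rule generate_incl[OF C])
    show "carrier Z_wr_Z \<subseteq> generate Z_wr_Z Z_wr_Z_gens"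
    proof
      fix a assume "a \<in> carrier Z_wr_Z"
      then obtain f n where a: "a = (f, n)" and f: "finite {z. f z \<noteq> 0}"
        by (auto simp: Z_wr_Z_def)
      show "a \<in> generate Z_wr_Z Z_wr_Z_gens"
        using generate.eng[OF Z_wr_Z_generate_lamps[OF f order_refl] Z_wr_Z_generate_shift[of n]]
        by (simp add: Z_wr_Z_def a)
    qed
  qed
qed

end

theory Submission
  imports Defs "HOL-Real_Asymp.Real_Asymp"
begin

text \<open>
  Put \<open>r = min p 2\<close>; the claimed value is \<open>r / (2 * r - 1)\<close>.

  Upper bound. A Lipschitz map into \<open>L\<^sub>p\<close> cannot follow a fast random walk. For a stationary reversible
  chain \<open>Z\<close> whose steps have bounded \<open>r\<close>-th moment, \<open>F (Z\<^sub>n)\<close> and \<open>F (Z\<^sub>0)\<close> are typically at distance at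
  most of order \<open>n powr (1 / r)\<close>: this is Markov type \<open>r\<close> of \<open>L\<^sub>p\<close>. It is proved for real-valued
  functions in \<open>real_markov_type\<close>, by writing a displacement as a difference of two martingales, one
  forward and one backward in time, and is then integrated over the unit interval
  (\<open>Lp_markov_type\<close>). The chain it is applied to lives in a finite subset of the group. Its lamps are at
  the sites \<open>{0..<m}\<close>, with \<open>m = 2 ^ J\<close>, and take only the values \<open>0\<close> and \<open>K\<close>, where \<open>K\<close> is about
  \<open>m powr ((r - 1) / r)\<close>. The cursor jumps inside its dyadic block of length \<open>2 ^ j\<close> at a rate
  proportional to \<open>2 powr (- j * r)\<close>, a discrete stable walk, and the lamp under the cursor is
  resampled at a rate proportional to \<open>K powr (- r)\<close>. Up to powers of \<open>J\<close>, after \<open>m powr r\<close>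
  steps each site has been visited \<open>m powr (r - 1)\<close> times, so that a fixed proportion of the lamps has
  been resampled and the chain is at distance of order \<open>m * K\<close>, that is
  \<open>m powr ((2 * r - 1) / r)\<close>, from its start (\<open>sum_displacement_ge\<close>). Its image, however, has moved by
  \<open>m\<close> only. Comparing the two as \<open>J\<close> grows gives \<open>\<alpha> * (2 * r - 1) / r \<le> 1\<close> (\<open>compression_upper\<close>).

  Lower bound. The distance of \<open>(f, x)\<close> and \<open>(g, y)\<close> is comparable to the sum of \<open>\<bar>x - y\<bar>\<close>, of the distance
  from the cursors to the farthest lamp on which \<open>f\<close> and \<open>g\<close> differ, and of the \<open>l\<^sub>1\<close> norm of \<open>f - g\<close>. The
  first two terms embed with an exponent arbitrarily close to \<open>1\<close> (\<open>realizes_base\<close>, \<open>realizes_right\<close>,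
  \<open>realizes_left\<close>), and the map \<open>f\<close> itself controls the \<open>l\<^sub>r\<close> norm of \<open>f - g\<close> (\<open>realizes_lamps\<close>). If all
  these quantities are at most \<open>X\<close>, then \<open>f - g\<close> is supported on about \<open>X\<close> sites, and Hoelder's inequality
  bounds its \<open>l\<^sub>1\<close> norm by \<open>X powr (1 - 1 / r) * X\<close>, which is \<open>X powr ((2 * r - 1) / r)\<close>
  (\<open>compression_lower\<close>).
\<close>

section \<open>Inequalities for powers\<close>

lemma one_plus_powr_le_second_order:
  fixes p t :: real
  assumes "1 \<le> p" "\<bar>t\<bar> \<le> 1/2"
  shows "(1 + t) powr p \<le> 1 + p * t + p * (p - 1) * 2 powr p * 4 * t\<^sup>2"
proof (cases "t = 0")
  case False
  define D :: "nat \<Rightarrow> real \<Rightarrow> real" where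
    "D = (\<lambda>m x. if m = 0 then x powr p else if m = 1 then p * x powr (p - 1)
                else p * (p - 1) * x powr (p - 2))"
  have "\<exists>\<xi>. (if 1 + t < 1 then 1 + t < \<xi> \<and> \<xi> < 1 else 1 < \<xi> \<and> \<xi> < 1 + t) \<and>
     (1 + t) powr p = (\<Sum>m<2. D m 1 / fact m * ((1 + t) - 1)^m) + D 2 \<xi> / fact 2 * ((1 + t) - 1)^2"
  proof (rule Taylor[where a = "1/2" and b = "3/2"])
    show "\<forall>m x. m < 2 \<and> 1 / 2 \<le> x \<and> x \<le> 3 / 2 \<longrightarrow> DERIV (D m) x :> D (Suc m) x"
    proof (intro allI impI)
      fix m :: nat and x :: real
      assume a: "m < 2 \<and> 1 / 2 \<le> x \<and> x \<le> 3 / 2"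
      then consider "m = 0" | "m = 1" by linarith
      then show "DERIV (D m) x :> D (Suc m) x"
        using a by cases (auto simp: D_def intro!: derivative_eq_intros)
    qed
  qed (use assms False in \<open>auto simp: D_def abs_le_iff\<close>)
  then obtain \<xi> where \<xi>: "if 1 + t < 1 then 1 + t < \<xi> \<and> \<xi> < 1 else 1 < \<xi> \<and> \<xi> < 1 + t"
    and eq: "(1 + t) powr p = (\<Sum>m<2. D m 1 / fact m * ((1 + t) - 1)^m) + D 2 \<xi> / fact 2 * ((1 + t) - 1)^2"
    by blast
  have \<xi>b: "1/2 \<le> \<xi>" "\<xi> \<le> 2" using \<xi> assms by (auto split: if_splits)
  have "\<xi> powr (p - 2) = \<xi> powr p / \<xi>\<^sup>2"
    using \<xi>b by (simp add: powr_diff)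
  also have "\<dots> \<le> 2 powr p / (1/2)\<^sup>2"
    using \<xi>b assms by (intro frac_le powr_mono2 power_mono) auto
  finally have "\<xi> powr (p - 2) \<le> 2 powr p * 4" by (simp add: power2_eq_square)
  then have "p * (p - 1) * \<xi> powr (p - 2) \<le> p * (p - 1) * (2 powr p * 4)"
    using assms by (intro mult_left_mono) auto
  moreover have "0 \<le> p * (p - 1) * (2 powr p * 4)" using assms by auto
  ultimately have "p * (p - 1) * \<xi> powr (p - 2) / 2 * t\<^sup>2 \<le> p * (p - 1) * (2 powr p * 4) * t\<^sup>2"
    by (intro mult_right_mono zero_le_power2) linarith
  moreover have "(1 + t) powr p = 1 + p * t + p * (p - 1) * \<xi> powr (p - 2) / 2 * t\<^sup>2"
    using eq by (simp add: D_def eval_nat_numeral)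
  ultimately show ?thesis by (simp add: mult.assoc)
qed auto

text \<open>
  Taylor's formula serves for small \<open>t\<close>; for \<open>t\<close> bounded away from \<open>0\<close> everything is dominated by
  \<open>\<bar>t\<bar> powr p\<close>. When \<open>p \<le> 2\<close> the quadratic term is absorbed as well.
\<close>
lemma abs_one_plus_powr_le:
  fixes p :: real
  assumes p: "1 \<le> p"
  obtains C where "1 \<le> C" "\<And>t. \<bar>1 + t\<bar> powr p \<le> 1 + p * t + C * ((if 2 < p then t\<^sup>2 else 0) + \<bar>t\<bar> powr p)"
proof -
  define C where "C = p * (p - 1) * 2 powr p * 4 + (3 powr p + p * 2 powr p)"
  have C1: "0 \<le> p * (p - 1) * 2 powr p * 4" using p by auto
  have C2: "1 \<le> 3 powr p" using p by (simp add: ge_one_powr_ge_zero)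
  have C3: "0 \<le> p * 2 powr p" using p by auto
  have main: "\<bar>1 + t\<bar> powr p \<le> 1 + p * t + C * ((if 2 < p then t\<^sup>2 else 0) + \<bar>t\<bar> powr p)" for t
  proof (cases "\<bar>t\<bar> \<le> 1/2")
    case True
    have t2: "t\<^sup>2 \<le> (if 2 < p then t\<^sup>2 else 0) + \<bar>t\<bar> powr p"
    proof (cases "2 < p \<or> t = 0")
      case False
      then have "\<bar>t\<bar> powr 2 \<le> \<bar>t\<bar> powr p" using True by (intro powr_mono') auto
      then show ?thesis using False by (simp add: powr_numeral)
    qed auto
    have "\<bar>1 + t\<bar> powr p \<le> 1 + p * t + p * (p - 1) * 2 powr p * 4 * t\<^sup>2"
      using one_plus_powr_le_second_order[OF p True] True by auto
    also have "p * (p - 1) * 2 powr p * 4 * t\<^sup>2 \<le> C * t\<^sup>2"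
      unfolding C_def using C2 C3 by (intro mult_right_mono) auto
    also have "C * t\<^sup>2 \<le> C * ((if 2 < p then t\<^sup>2 else 0) + \<bar>t\<bar> powr p)"
      using t2 C1 C2 C3 by (intro mult_left_mono) (auto simp: C_def)
    finally show ?thesis by simp
  next
    case False
    have "\<bar>1 + t\<bar> powr p \<le> (3 * \<bar>t\<bar>) powr p"
      using p False by (intro powr_mono2) auto
    then have 1: "\<bar>1 + t\<bar> powr p \<le> 3 powr p * \<bar>t\<bar> powr p" by (simp add: powr_mult)
    have "\<bar>t\<bar> \<le> (2 * \<bar>t\<bar>) powr 1" using False by simp
    also have "\<dots> \<le> (2 * \<bar>t\<bar>) powr p" using p False by (intro powr_mono) auto
    finally have "p * \<bar>t\<bar> \<le> p * (2 powr p * \<bar>t\<bar> powr p)"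
      using p by (intro mult_left_mono) (auto simp: powr_mult)
    moreover have "- (p * t) \<le> p * \<bar>t\<bar>" using p by (simp add: abs_if)
    ultimately have "\<bar>1 + t\<bar> powr p \<le> 1 + p * t + (3 powr p + p * 2 powr p) * \<bar>t\<bar> powr p"
      using 1 by (simp add: algebra_simps)
    also have "(3 powr p + p * 2 powr p) * \<bar>t\<bar> powr p \<le> C * ((if 2 < p then t\<^sup>2 else 0) + \<bar>t\<bar> powr p)"
      unfolding C_def using C1 C2 C3 by (intro mult_mono) auto
    finally show ?thesis by simp
  qed
  show ?thesis by (rule that[of C]) (use main C1 C2 C3 in \<open>auto simp: C_def\<close>)
qed

lemma abs_add_powr_le:
  fixes p :: real
  assumes p: "1 \<le> p"
  obtains C where "1 \<le> C"
    "\<And>a b. \<bar>a + b\<bar> powr p \<le> \<bar>a\<bar> powr p + p * (sgn a * \<bar>a\<bar> powr (p - 1)) * b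
       + C * ((if 2 < p then \<bar>a\<bar> powr (p - 2) * b\<^sup>2 else 0) + \<bar>b\<bar> powr p)"
proof -
  obtain C where C: "1 \<le> C" "\<And>t. \<bar>1 + t\<bar> powr p \<le> 1 + p * t + C * ((if 2 < p then t\<^sup>2 else 0) + \<bar>t\<bar> powr p)"
    using abs_one_plus_powr_le[OF p] by blast
  have "\<bar>a + b\<bar> powr p \<le> \<bar>a\<bar> powr p + p * (sgn a * \<bar>a\<bar> powr (p - 1)) * b
       + C * ((if 2 < p then \<bar>a\<bar> powr (p - 2) * b\<^sup>2 else 0) + \<bar>b\<bar> powr p)" for a b
  proof (cases "a = 0")
    case True
    have "1 * \<bar>b\<bar> powr p \<le> C * \<bar>b\<bar> powr p" using C(1) by (intro mult_right_mono) auto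
    then show ?thesis using True by simp
  next
    case False
    define t where "t = b / a"
    have b: "b = a * t" using False by (simp add: t_def)
    have e1: "\<bar>a\<bar> powr (p - 1) = \<bar>a\<bar> powr p / \<bar>a\<bar>" using False by (simp add: powr_diff)
    have e2: "\<bar>a\<bar> powr (p - 2) = \<bar>a\<bar> powr p / a\<^sup>2" using False by (simp add: powr_diff powr_numeral)
    have "\<bar>a + b\<bar> powr p = \<bar>a\<bar> powr p * \<bar>1 + t\<bar> powr p"
      unfolding b by (subst powr_mult[symmetric]) (auto simp: algebra_simps simp flip: abs_mult)
    also have "\<dots> \<le> \<bar>a\<bar> powr p * (1 + p * t + C * ((if 2 < p then t\<^sup>2 else 0) + \<bar>t\<bar> powr p))"
      using C(2)[of t] by (intro mult_left_mono) auto
    also have "\<dots> = \<bar>a\<bar> powr p + p * (sgn a * \<bar>a\<bar> powr (p - 1)) * b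
       + C * ((if 2 < p then \<bar>a\<bar> powr (p - 2) * b\<^sup>2 else 0) + \<bar>b\<bar> powr p)"
    proof -
      have 1: "p * (sgn a * (X / \<bar>a\<bar>)) * (a * t) = p * X * t" for X
        using False by (simp add: sgn_real_def abs_real_def)
      have 2: "X / a\<^sup>2 * (a * t)\<^sup>2 = X * t\<^sup>2" for X
        using False by (simp add: power_mult_distrib)
      have 3: "\<bar>a * t\<bar> powr p = \<bar>a\<bar> powr p * \<bar>t\<bar> powr p"
        by (simp add: abs_mult powr_mult)
      show ?thesis unfolding e1 e2 b by (simp only: 1 2 3) (simp add: algebra_simps)
    qed
    finally show ?thesis .
  qed
  then show ?thesis using C(1) that by blast
qed

lemma powr_above_tangent:
  fixes q x c :: real
  assumes q: "1 \<le> q" and "0 \<le> x" "0 \<le> c"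
  shows "c powr q + q * c powr (q - 1) * (x - c) \<le> x powr q"
proof -
  consider "c = 0" | "0 < c" "x = 0" | "0 < c" "0 < x" using assms by fastforce
  then show ?thesis
  proof cases
    case 2
    have "c powr (q - 1) * c = c powr q" using 2 by (simp add: powr_diff)
    then have "c powr q + q * c powr (q - 1) * (x - c) = (1 - q) * c powr q"
      using 2 by (simp add: algebra_simps)
    also have "\<dots> \<le> 0" using q by (simp add: mult_nonpos_nonneg)
    finally show ?thesis using 2 by simp
  next
    case 3
    have "q * c powr (q - 1) * (x - c) \<le> x powr q - c powr q"
      by (rule convex_on_imp_above_tangent[where A = "{0<..}"])
        (use 3 powr_convex[OF q] in \<open>auto intro!: derivative_eq_intros simp: interior_open\<close>)
    then show ?thesis by simp
  qed auto
qed

text \<open>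
  Jensen's inequality for a finite probability vector: average the tangent inequality at the mean.
\<close>
lemma powr_sum_le:
  fixes q :: real and \<kappa> u :: "'a \<Rightarrow> real"
  assumes q: "1 \<le> q" and "\<And>y. y \<in> A \<Longrightarrow> 0 \<le> \<kappa> y" "sum \<kappa> A = 1" "\<And>y. y \<in> A \<Longrightarrow> 0 \<le> u y"
  shows "(\<Sum>y\<in>A. \<kappa> y * u y) powr q \<le> (\<Sum>y\<in>A. \<kappa> y * u y powr q)"
proof -
  define c where "c = (\<Sum>y\<in>A. \<kappa> y * u y)"
  have c: "0 \<le> c" unfolding c_def using assms by (intro sum_nonneg) auto
  have "c powr q = (\<Sum>y\<in>A. \<kappa> y * (c powr q + q * c powr (q - 1) * (u y - c)))"
  proof -
    have "(\<Sum>y\<in>A. \<kappa> y * (c powr q + q * c powr (q - 1) * (u y - c)))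
      = sum \<kappa> A * c powr q + q * c powr (q - 1) * ((\<Sum>y\<in>A. \<kappa> y * u y) - c * sum \<kappa> A)"
      by (simp add: algebra_simps sum.distrib sum_distrib_left sum_distrib_right sum_subtractf)
    then show ?thesis using assms by (simp add: c_def)
  qed
  also have "\<dots> \<le> (\<Sum>y\<in>A. \<kappa> y * u y powr q)"
    using assms c by (intro sum_mono mult_left_mono powr_above_tangent) auto
  finally show ?thesis unfolding c_def .
qed

lemma abs_add_powr_le_2:
  fixes a b p :: real
  assumes "0 \<le> p"
  shows "\<bar>a + b\<bar> powr p \<le> 2 powr p * (\<bar>a\<bar> powr p + \<bar>b\<bar> powr p)"
proof -
  have "\<bar>a + b\<bar> powr p \<le> (2 * max \<bar>a\<bar> \<bar>b\<bar>) powr p"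
    using assms by (intro powr_mono2) auto
  also have "\<dots> = 2 powr p * max \<bar>a\<bar> \<bar>b\<bar> powr p" by (simp add: powr_mult)
  also have "max \<bar>a\<bar> \<bar>b\<bar> powr p \<le> \<bar>a\<bar> powr p + \<bar>b\<bar> powr p" by (simp add: max_def)
  finally show ?thesis by simp
qed

lemma abs_diff_powr_le_2:
  fixes a b p :: real
  assumes "0 \<le> p"
  shows "\<bar>a - b\<bar> powr p \<le> 2 powr p * (\<bar>a\<bar> powr p + \<bar>b\<bar> powr p)"
  using abs_add_powr_le_2[OF assms, of a "- b"] by simp

text \<open>
  The weight \<open>v\<close> is free. It will essentially be proportional to the squared length of the step that
  causes \<open>b\<close>, so that the long but rare jumps are charged to \<open>\<bar>a\<bar> powr p\<close>.
\<close>
lemma young_inequality: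
  fixes a b p v :: real
  assumes "2 < p" "0 < v"
  shows "\<bar>a\<bar> powr (p - 2) * b\<^sup>2 \<le> v * \<bar>a\<bar> powr p + v powr (1 - p / 2) * \<bar>b\<bar> powr p"
proof (cases "a = 0 \<or> b = 0")
  case False
  show ?thesis
  proof (cases "b\<^sup>2 \<le> v * a\<^sup>2")
    case True
    have "\<bar>a\<bar> powr (p - 2) * b\<^sup>2 \<le> \<bar>a\<bar> powr (p - 2) * (v * a\<^sup>2)"
      using True by (intro mult_left_mono) auto
    also have "\<dots> = v * \<bar>a\<bar> powr p" using False by (simp add: powr_diff powr_numeral)
    finally show ?thesis by (simp add: add_increasing2)
  next
    case c: False
    have "\<bar>a\<bar> powr (p - 2) = (v * a\<^sup>2) powr ((p - 2) / 2) * v powr (1 - p / 2)"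
    proof -
      have "(v * a\<^sup>2) powr ((p - 2) / 2) = v powr ((p - 2) / 2) * (\<bar>a\<bar> powr 2) powr ((p - 2) / 2)"
        using assms by (simp add: powr_mult powr_numeral)
      also have "(\<bar>a\<bar> powr 2) powr ((p - 2) / 2) = \<bar>a\<bar> powr (p - 2)"
        by (metis powr_powr mult.commute nonzero_eq_divide_eq zero_neq_numeral)
      finally have "(v * a\<^sup>2) powr ((p - 2) / 2) * v powr (1 - p / 2)
          = \<bar>a\<bar> powr (p - 2) * v powr ((p - 2) / 2 + (1 - p / 2))"
        by (simp add: powr_add)
      then show ?thesis using assms by (simp add: field_simps)
    qed
    also have "\<dots> \<le> (b\<^sup>2) powr ((p - 2) / 2) * v powr (1 - p / 2)"
      using c assms by (intro mult_right_mono powr_mono2) auto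
    also have "(b\<^sup>2) powr ((p - 2) / 2) = \<bar>b\<bar> powr (p - 2)"
    proof -
      have "(b\<^sup>2) powr ((p - 2) / 2) = (\<bar>b\<bar> powr 2) powr ((p - 2) / 2)"
        by (simp add: powr_numeral)
      also have "\<dots> = \<bar>b\<bar> powr (p - 2)" by (metis powr_powr mult.commute nonzero_eq_divide_eq zero_neq_numeral)
      finally show ?thesis .
    qed
    finally have "\<bar>a\<bar> powr (p - 2) * b\<^sup>2 \<le> \<bar>b\<bar> powr (p - 2) * v powr (1 - p / 2) * b\<^sup>2"
      by (intro mult_right_mono) auto
    also have "\<dots> = v powr (1 - p / 2) * \<bar>b\<bar> powr p"
      using False by (simp add: powr_diff powr_numeral)
    finally show ?thesis using assms by (simp add: add_increasing)
  qed
qed (use assms in auto)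

text \<open>
  The increments \<open>\<Delta> y\<close>, once centred, are added to \<open>a\<close>: the linear term of the expansion averages to
  \<open>0\<close>. The exponent \<open>1 - max p 2 / 2\<close> vanishes for \<open>p \<le> 2\<close>, so that one statement covers both ranges.
\<close>
lemma one_step_moment:
  fixes p :: real
  assumes p: "1 \<le> p"
  obtains C where "1 \<le> C"
    "\<And>(A :: 'a set) \<kappa> v \<Delta> a. finite A \<Longrightarrow> (\<And>y. y \<in> A \<Longrightarrow> 0 \<le> \<kappa> y) \<Longrightarrow> sum \<kappa> A = 1 \<Longrightarrow> (\<And>y. y \<in> A \<Longrightarrow> 0 < v y) \<Longrightarrow>
      (\<Sum>y\<in>A. \<kappa> y * \<bar>\<Delta> y - (\<Sum>z\<in>A. \<kappa> z * \<Delta> z) + a\<bar> powr p)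
      \<le> (1 + C * (\<Sum>y\<in>A. \<kappa> y * v y)) * \<bar>a\<bar> powr p
        + C * (\<Sum>y\<in>A. \<kappa> y * ((1 + v y powr (1 - max p 2 / 2)) * \<bar>\<Delta> y\<bar> powr p))"
proof -
  obtain C where C: "1 \<le> C" and
    tay: "\<And>a b. \<bar>a + b\<bar> powr p \<le> \<bar>a\<bar> powr p + p * (sgn a * \<bar>a\<bar> powr (p - 1)) * b
       + C * ((if 2 < p then \<bar>a\<bar> powr (p - 2) * b\<^sup>2 else 0) + \<bar>b\<bar> powr p)"
    using abs_add_powr_le[OF p] by blast
  define C' where "C' = 2 * 2 powr p * C"
  have p1: "1 \<le> 2 powr p" using p by (simp add: ge_one_powr_ge_zero)
  have C': "C \<le> C'" using C p1 mult_mono[of 1 "2 * 2 powr p" C C] by (simp add: C'_def)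
  have main: "(\<Sum>y\<in>A. \<kappa> y * \<bar>\<Delta> y - (\<Sum>z\<in>A. \<kappa> z * \<Delta> z) + a\<bar> powr p)
      \<le> (1 + C' * (\<Sum>y\<in>A. \<kappa> y * v y)) * \<bar>a\<bar> powr p
        + C' * (\<Sum>y\<in>A. \<kappa> y * ((1 + v y powr (1 - max p 2 / 2)) * \<bar>\<Delta> y\<bar> powr p))"
    if A: "finite A" and \<kappa>: "\<And>y. y \<in> A \<Longrightarrow> 0 \<le> \<kappa> y" and \<kappa>1: "sum \<kappa> A = 1" and v: "\<And>y. y \<in> A \<Longrightarrow> 0 < v y"
    for A :: "'a set" and \<kappa> v \<Delta> a
  proof -
    define L where "L = (\<Sum>z\<in>A. \<kappa> z * \<Delta> z)"
    define S where "S = (\<Sum>y\<in>A. \<kappa> y * \<bar>\<Delta> y\<bar> powr p)"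
    have mean: "(\<Sum>y\<in>A. \<kappa> y * (\<Delta> y - L)) = 0"
      using \<kappa>1 by (simp add: L_def right_diff_distrib sum_subtractf flip: sum_distrib_right)
    have L: "\<bar>L\<bar> powr p \<le> S"
    proof -
      have "\<bar>L\<bar> \<le> (\<Sum>y\<in>A. \<kappa> y * \<bar>\<Delta> y\<bar>)"
        unfolding L_def by (rule order.trans[OF sum_abs]) (auto simp: abs_mult \<kappa> intro!: sum_mono)
      then have "\<bar>L\<bar> powr p \<le> (\<Sum>y\<in>A. \<kappa> y * \<bar>\<Delta> y\<bar>) powr p"
        using p by (intro powr_mono2) auto
      also have "\<dots> \<le> S" unfolding S_def by (rule powr_sum_le) (use p \<kappa> \<kappa>1 in auto)
      finally show ?thesis .
    qed
    have gp: "(\<Sum>y\<in>A. \<kappa> y * \<bar>\<Delta> y - L\<bar> powr p) \<le> 2 * 2 powr p * S"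
    proof -
      have "(\<Sum>y\<in>A. \<kappa> y * \<bar>\<Delta> y - L\<bar> powr p) \<le> (\<Sum>y\<in>A. \<kappa> y * (2 powr p * (\<bar>\<Delta> y\<bar> powr p + \<bar>L\<bar> powr p)))"
        using \<kappa> p by (intro sum_mono mult_left_mono abs_diff_powr_le_2) auto
      also have "\<dots> = 2 powr p * (S + \<bar>L\<bar> powr p * sum \<kappa> A)"
        by (simp add: S_def algebra_simps sum.distrib sum_distrib_left sum_distrib_right)
      also have "\<dots> \<le> 2 powr p * (S + S)" using L \<kappa>1 by (intro mult_left_mono) auto
      finally show ?thesis by simp
    qed
    have g2: "(\<Sum>y\<in>A. \<kappa> y * (\<Delta> y - L)\<^sup>2) \<le> (\<Sum>y\<in>A. \<kappa> y * (\<Delta> y)\<^sup>2)"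
    proof -
      have "(\<Sum>y\<in>A. \<kappa> y * (\<Delta> y - L)\<^sup>2) = (\<Sum>y\<in>A. \<kappa> y * (\<Delta> y)\<^sup>2) - 2 * L * (\<Sum>y\<in>A. \<kappa> y * \<Delta> y) + L\<^sup>2 * sum \<kappa> A"
        by (simp add: power2_diff algebra_simps sum.distrib sum_subtractf sum_distrib_left sum_distrib_right)
      also have "\<dots> = (\<Sum>y\<in>A. \<kappa> y * (\<Delta> y)\<^sup>2) - L\<^sup>2"
        using \<kappa>1 by (simp add: power2_eq_square flip: L_def)
      finally show ?thesis by simp
    qed
    define W where "W = (\<Sum>y\<in>A. \<kappa> y * (v y powr (1 - max p 2 / 2) * \<bar>\<Delta> y\<bar> powr p))"
    have W: "0 \<le> W" unfolding W_def using \<kappa> by (intro sum_nonneg) auto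
    define Q where "Q = (\<Sum>y\<in>A. \<kappa> y * (if 2 < p then \<bar>a\<bar> powr (p - 2) * (\<Delta> y - L)\<^sup>2 else 0))"
    have Q: "Q \<le> (\<Sum>y\<in>A. \<kappa> y * v y) * \<bar>a\<bar> powr p + W"
    proof (cases "2 < p")
      case True
      have "Q = \<bar>a\<bar> powr (p - 2) * (\<Sum>y\<in>A. \<kappa> y * (\<Delta> y - L)\<^sup>2)"
        using True by (simp add: Q_def sum_distrib_left algebra_simps)
      also have "\<dots> \<le> \<bar>a\<bar> powr (p - 2) * (\<Sum>y\<in>A. \<kappa> y * (\<Delta> y)\<^sup>2)"
        using g2 by (intro mult_left_mono) auto
      also have "\<dots> = (\<Sum>y\<in>A. \<kappa> y * (\<bar>a\<bar> powr (p - 2) * (\<Delta> y)\<^sup>2))"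
        by (simp add: sum_distrib_left algebra_simps)
      also have "\<dots> \<le> (\<Sum>y\<in>A. \<kappa> y * (v y * \<bar>a\<bar> powr p + v y powr (1 - p / 2) * \<bar>\<Delta> y\<bar> powr p))"
        using True v \<kappa> by (intro sum_mono mult_left_mono young_inequality) auto
      also have "\<dots> = (\<Sum>y\<in>A. \<kappa> y * v y) * \<bar>a\<bar> powr p + W"
        using True by (simp add: W_def max_def algebra_simps sum.distrib sum_distrib_left)
      finally show ?thesis .
    next
      case False
      have "0 \<le> (\<Sum>y\<in>A. \<kappa> y * v y)" using \<kappa> v by (intro sum_nonneg) (auto simp: less_imp_le)
      then show ?thesis using False W by (simp add: Q_def)
    qed
    have "(\<Sum>y\<in>A. \<kappa> y * \<bar>\<Delta> y - L + a\<bar> powr p)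
      \<le> (\<Sum>y\<in>A. \<kappa> y * (\<bar>a\<bar> powr p + p * (sgn a * \<bar>a\<bar> powr (p - 1)) * (\<Delta> y - L)
       + C * ((if 2 < p then \<bar>a\<bar> powr (p - 2) * (\<Delta> y - L)\<^sup>2 else 0) + \<bar>\<Delta> y - L\<bar> powr p)))"
      using tay[of a] \<kappa> by (intro sum_mono mult_left_mono) (simp_all only: add.commute[of _ a])
    also have "\<dots> = sum \<kappa> A * \<bar>a\<bar> powr p + p * (sgn a * \<bar>a\<bar> powr (p - 1)) * (\<Sum>y\<in>A. \<kappa> y * (\<Delta> y - L))
       + C * (Q + (\<Sum>y\<in>A. \<kappa> y * \<bar>\<Delta> y - L\<bar> powr p))"
      unfolding Q_def by (simp only: distrib_left sum.distrib sum_distrib_left sum_distrib_right mult_ac)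
    also have "\<dots> = \<bar>a\<bar> powr p + C * (Q + (\<Sum>y\<in>A. \<kappa> y * \<bar>\<Delta> y - L\<bar> powr p))"
      using mean \<kappa>1 by simp
    also have "\<dots> \<le> \<bar>a\<bar> powr p + C * ((\<Sum>y\<in>A. \<kappa> y * v y) * \<bar>a\<bar> powr p + W + 2 * 2 powr p * S)"
      using Q gp C by (intro add_left_mono mult_left_mono add_mono) auto
    also have "\<dots> = \<bar>a\<bar> powr p + C * ((\<Sum>y\<in>A. \<kappa> y * v y) * \<bar>a\<bar> powr p) + C * W + C' * S"
      by (simp add: C'_def algebra_simps)
    also have "\<dots> \<le> \<bar>a\<bar> powr p + C' * ((\<Sum>y\<in>A. \<kappa> y * v y) * \<bar>a\<bar> powr p) + C' * W + C' * S"
      using C' W \<kappa> v by (intro add_mono mult_right_mono order.refl mult_nonneg_nonneg sum_nonneg) (auto simp: less_imp_le)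
    also have "\<dots> = (1 + C' * (\<Sum>y\<in>A. \<kappa> y * v y)) * \<bar>a\<bar> powr p
        + C' * (\<Sum>y\<in>A. \<kappa> y * ((1 + v y powr (1 - max p 2 / 2)) * \<bar>\<Delta> y\<bar> powr p))"
      by (simp add: W_def S_def algebra_simps sum.distrib)
    finally show ?thesis unfolding L_def .
  qed
  show ?thesis using C C' by (intro that[of C'] main) auto
qed

section \<open>Markov type for symmetric chains\<close>

definition paths :: "'v set \<Rightarrow> nat \<Rightarrow> 'v list set" where
  "paths V n = {l. set l \<subseteq> V \<and> length l = n}"

fun path_weight :: "('v \<Rightarrow> 'v \<Rightarrow> real) \<Rightarrow> 'v list \<Rightarrow> real" where
  "path_weight k (x # y # l) = k x y * path_weight k (y # l)"
| "path_weight k l = 1"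

lemma path_weight_Cons: "l \<noteq> [] \<Longrightarrow> path_weight k (x # l) = k x (hd l) * path_weight k l"
  by (cases l) auto

lemma path_weight_snoc: "l \<noteq> [] \<Longrightarrow> path_weight k (l @ [y]) = path_weight k l * k (last l) y"
  by (induction k l rule: path_weight.induct) auto

lemma sum_paths_Suc:
  "(\<Sum>l\<in>paths V (Suc n). \<phi> l) = (\<Sum>x\<in>V. \<Sum>l\<in>paths V n. \<phi> (x # l))"
proof -
  have "paths V (Suc n) = (\<lambda>(x, l). x # l) ` (V \<times> paths V n)"
    by (auto simp: paths_def length_Suc_conv image_iff)
  moreover have "inj_on (\<lambda>(x, l). x # l) (V \<times> paths V n)" by (auto simp: inj_on_def)
  ultimately show ?thesis
    by (simp add: sum.reindex sum.cartesian_product case_prod_unfold o_def)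
qed

lemma paths_0: "paths V 0 = {[]}" by (auto simp: paths_def)

lemma hd_paths: "l \<in> paths V (Suc n) \<Longrightarrow> hd l \<in> V" "l \<in> paths V (Suc n) \<Longrightarrow> l \<noteq> []"
  by (auto simp: paths_def length_Suc_conv)

text \<open>
  A symmetric stochastic kernel is reversible with respect to counting measure. Paths are counted without
  normalization, so that the total weight of all paths is the number of states.
\<close>
locale sym_chain =
  fixes V :: "'v set" and k :: "'v \<Rightarrow> 'v \<Rightarrow> real"
  assumes finV: "finite V"
    and k_nonneg: "\<And>x y. x \<in> V \<Longrightarrow> y \<in> V \<Longrightarrow> 0 \<le> k x y"
    and k_sym: "\<And>x y. x \<in> V \<Longrightarrow> y \<in> V \<Longrightarrow> k x y = k y x"
    and k_row: "\<And>x. x \<in> V \<Longrightarrow> (\<Sum>y\<in>V. k x y) = 1"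
begin

lemma weight_nonneg: "l \<in> paths V n \<Longrightarrow> 0 \<le> path_weight k l"
proof (induction n arbitrary: l)
  case (Suc n)
  then obtain x l' where l: "l = x # l'" "l' \<in> paths V n" "x \<in> V"
    by (auto simp: paths_def length_Suc_conv)
  show ?case
    using Suc.IH[OF l(2)] l by (cases l') (auto simp: paths_def k_nonneg)
qed (simp add: paths_0)

lemma weight_rev: "l \<in> paths V n \<Longrightarrow> path_weight k (rev l) = path_weight k l"
proof (induction n arbitrary: l)
  case (Suc n)
  then obtain x l' where l: "l = x # l'" "l' \<in> paths V n" "x \<in> V"
    by (auto simp: paths_def length_Suc_conv)
  show ?case
  proof (cases "l' = []")
    case False
    then have "hd l' \<in> V" using l by (auto simp: paths_def)
    then show ?thesis
      using Suc.IH[OF l(2)] l False k_sym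
      by (simp add: path_weight_snoc path_weight_Cons last_rev mult.commute)
  qed (simp add: l)
qed (simp add: paths_0)

lemma sum_paths_rev:
  "(\<Sum>l\<in>paths V n. path_weight k l * \<phi> (rev l)) = (\<Sum>l\<in>paths V n. path_weight k l * \<phi> l)"
  by (rule sum.reindex_bij_witness[of _ rev rev]) (auto simp: paths_def weight_rev[of _ n, unfolded paths_def])

lemma sum_paths_hd:
  "(\<Sum>l\<in>paths V (Suc n). path_weight k l * \<phi> (hd l)) = (\<Sum>x\<in>V. \<phi> x)"
proof (induction n arbitrary: \<phi>)
  case 0
  show ?case by (simp add: sum_paths_Suc paths_0)
next
  case (Suc n)
  have "(\<Sum>l\<in>paths V (Suc (Suc n)). path_weight k l * \<phi> (hd l))
     = (\<Sum>x\<in>V. \<Sum>l\<in>paths V (Suc n). path_weight k l * (k x (hd l) * \<phi> x))"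
    unfolding sum_paths_Suc[of _ _ "Suc n"]
    by (intro sum.cong refl) (simp add: path_weight_Cons hd_paths mult_ac)
  also have "\<dots> = (\<Sum>x\<in>V. \<Sum>y\<in>V. k x y * \<phi> x)" by (rule sum.cong[OF refl], rule Suc.IH[of "\<lambda>y. k _ y * \<phi> _"])
  also have "\<dots> = (\<Sum>x\<in>V. \<phi> x)"
    by (simp add: k_row flip: sum_distrib_right)
  finally show ?case .
qed

definition drift :: "('v \<Rightarrow> real) \<Rightarrow> 'v \<Rightarrow> real" where
  "drift f x = (\<Sum>y\<in>V. k x y * (f y - f x))"

text \<open>
  For odd \<open>s\<close>, the difference of \<open>f\<close> at the times \<open>s + 1\<close> and \<open>s - 1\<close> equals the centred increment of the step
  from \<open>s\<close> to \<open>s + 1\<close> minus that of the step from \<open>s\<close> back to \<open>s - 1\<close>, because the two drifts are taken at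
  the same state. Here the backward increments are added up; the forward ones are those of the reversed
  path.
\<close>
fun back_sum :: "('v \<Rightarrow> real) \<Rightarrow> 'v list \<Rightarrow> real" where
  "back_sum f (x # y # l) = (f x - f y - drift f y) + back_sum f l"
| "back_sum f _ = 0"

lemma back_sum_append:
  "length l = 2 * n + 1 \<Longrightarrow> back_sum f (l @ [a, b]) = back_sum f l + (f (last l) - f a - drift f a)"
proof (induction n arbitrary: l)
  case 0
  then obtain x where "l = [x]" by (auto simp: length_Suc_conv)
  then show ?case by simp
next
  case (Suc n)
  then obtain x y l' where l: "l = x # y # l'" "length l' = 2 * n + 1"
    by (auto simp: length_Suc_conv)
  then show ?case using Suc.IH[OF l(2)] by auto
qed

lemma last_minus_hd:
  "length l = 2 * n + 1 \<Longrightarrow> f (last l) - f (hd l) = back_sum f (rev l) - back_sum f l"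
proof (induction n arbitrary: l)
  case 0
  then obtain x where "l = [x]" by (auto simp: length_Suc_conv)
  then show ?case by simp
next
  case (Suc n)
  then obtain x y l' where l: "l = x # y # l'" "length l' = 2 * n + 1"
    by (auto simp: length_Suc_conv)
  have ne: "l' \<noteq> []" using l by auto
  have "back_sum f (rev l) = back_sum f (rev l') + (f (hd l') - f y - drift f y)"
    using back_sum_append[of "rev l'" n f y x] l ne by (simp add: last_rev)
  then show ?case using Suc.IH[OF l(2)] l ne by simp
qed

text \<open>
  Given the second state of a path, the first one is distributed as a step of the chain, by symmetry of
  the kernel. Peeling off two states thus adds one centred increment.
\<close>
lemma back_sum_moment_step:
  assumes step: "\<And>y a. y \<in> V \<Longrightarrow> (\<Sum>x\<in>V. k y x * \<bar>f x - f y - drift f y + a\<bar> powr p) \<le> q * \<bar>a\<bar> powr p + C * e y"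
  shows "(\<Sum>l\<in>paths V (Suc (Suc (Suc n))). path_weight k l * \<bar>back_sum f l\<bar> powr p)
     \<le> q * (\<Sum>l\<in>paths V (Suc n). path_weight k l * \<bar>back_sum f l\<bar> powr p) + C * (\<Sum>x\<in>V. e x)"
proof -
  have "(\<Sum>l\<in>paths V (Suc (Suc (Suc n))). path_weight k l * \<bar>back_sum f l\<bar> powr p)
      = (\<Sum>y\<in>V. \<Sum>l\<in>paths V (Suc n). \<Sum>x\<in>V. k y (hd l) * path_weight k l *
           (k y x * \<bar>f x - f y - drift f y + back_sum f l\<bar> powr p))"
    unfolding sum_paths_Suc[of _ _ "Suc (Suc n)"] sum_paths_Suc[of _ _ "Suc n"]
    by (subst sum.swap, intro sum.cong refl, subst sum.swap, intro sum.cong refl)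
      (simp add: path_weight_Cons hd_paths mult_ac k_sym)
  also have "\<dots> = (\<Sum>y\<in>V. \<Sum>l\<in>paths V (Suc n). k y (hd l) * path_weight k l *
           (\<Sum>x\<in>V. k y x * \<bar>f x - f y - drift f y + back_sum f l\<bar> powr p))"
    by (simp add: sum_distrib_left)
  also have "\<dots> \<le> (\<Sum>y\<in>V. \<Sum>l\<in>paths V (Suc n). k y (hd l) * path_weight k l *
           (q * \<bar>back_sum f l\<bar> powr p + C * e y))"
    using hd_paths(1) weight_nonneg k_nonneg
    by (intro sum_mono mult_left_mono step mult_nonneg_nonneg) blast+
  also have "\<dots> = (\<Sum>l\<in>paths V (Suc n). path_weight k l *
      (\<Sum>y\<in>V. q * \<bar>back_sum f l\<bar> powr p * k (hd l) y + C * (k (hd l) y * e y)))"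
    by (subst sum.swap) (simp add: sum_distrib_left algebra_simps k_sym hd_paths cong: sum.cong)
  also have "\<dots> = (\<Sum>l\<in>paths V (Suc n). q * (path_weight k l * \<bar>back_sum f l\<bar> powr p)
      + C * (path_weight k l * (\<Sum>y\<in>V. k (hd l) y * e y)))"
  proof (intro sum.cong refl)
    fix l assume "l \<in> paths V (Suc n)"
    then have "(\<Sum>y\<in>V. q * \<bar>back_sum f l\<bar> powr p * k (hd l) y) = q * \<bar>back_sum f l\<bar> powr p"
      by (simp add: k_row hd_paths flip: sum_distrib_left)
    then show "path_weight k l * (\<Sum>y\<in>V. q * \<bar>back_sum f l\<bar> powr p * k (hd l) y + C * (k (hd l) y * e y))
      = q * (path_weight k l * \<bar>back_sum f l\<bar> powr p) + C * (path_weight k l * (\<Sum>y\<in>V. k (hd l) y * e y))"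
      by (simp only: sum.distrib sum_distrib_left[symmetric]) (simp only: distrib_left mult_ac)
  qed
  also have "\<dots> = q * (\<Sum>l\<in>paths V (Suc n). path_weight k l * \<bar>back_sum f l\<bar> powr p)
      + C * (\<Sum>x\<in>V. \<Sum>y\<in>V. k x y * e y)"
    using sum_paths_hd[of "\<lambda>x. \<Sum>y\<in>V. k x y * e y" n]
    by (simp add: sum.distrib flip: sum_distrib_left)
  also have "(\<Sum>x\<in>V. \<Sum>y\<in>V. k x y * e y) = (\<Sum>x\<in>V. e x)"
  proof -
    have "(\<Sum>x\<in>V. \<Sum>y\<in>V. k x y * e y) = (\<Sum>y\<in>V. \<Sum>x\<in>V. k y x * e y)"
      by (subst sum.swap) (simp add: k_sym cong: sum.cong)
    then show ?thesis by (simp add: k_row flip: sum_distrib_right)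
  qed
  finally show ?thesis .
qed

end

text \<open>
  A Young weight whose expected cost over \<open>n\<close> steps is bounded, from wherever the steps start.
\<close>
definition admissible :: "nat \<Rightarrow> 'v set \<Rightarrow> ('v \<Rightarrow> 'v \<Rightarrow> real) \<Rightarrow> ('v \<Rightarrow> 'v \<Rightarrow> real) \<Rightarrow> bool" where
  "admissible n V k v \<longleftrightarrow> sym_chain V k \<and> (\<forall>x\<in>V. \<forall>y\<in>V. 0 < v x y) \<and>
     (\<forall>x\<in>V. real n * (\<Sum>y\<in>V. k x y * v x y) \<le> 1)"

text \<open>
  Over \<open>n\<close> steps the factors of \<open>one_step_moment\<close> multiply to at most \<open>exp C\<close>, by admissibility. The
  constant depends on \<open>p\<close> only.
\<close>
theorem real_markov_type:
  fixes p :: real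
  assumes p: "1 \<le> p"
  shows "\<exists>C\<ge>0. \<forall>(V :: 'v set) k n f v. admissible n V k v \<longrightarrow>
      (\<Sum>l\<in>paths V (2 * n + 1). path_weight k l * \<bar>f (last l) - f (hd l)\<bar> powr p)
       \<le> C * real n * (\<Sum>x\<in>V. \<Sum>y\<in>V. k x y * ((1 + v x y powr (1 - max p 2 / 2)) * \<bar>f x - f y\<bar> powr p))"
proof -
  obtain C where C: "1 \<le> C" and
    step: "\<And>(A :: 'v set) \<kappa> v \<Delta> a. finite A \<Longrightarrow> (\<And>y. y \<in> A \<Longrightarrow> 0 \<le> \<kappa> y) \<Longrightarrow> sum \<kappa> A = 1 \<Longrightarrow> (\<And>y. y \<in> A \<Longrightarrow> 0 < v y) \<Longrightarrow>
      (\<Sum>y\<in>A. \<kappa> y * \<bar>\<Delta> y - (\<Sum>z\<in>A. \<kappa> z * \<Delta> z) + a\<bar> powr p)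
      \<le> (1 + C * (\<Sum>y\<in>A. \<kappa> y * v y)) * \<bar>a\<bar> powr p
        + C * (\<Sum>y\<in>A. \<kappa> y * ((1 + v y powr (1 - max p 2 / 2)) * \<bar>\<Delta> y\<bar> powr p))"
    using one_step_moment[OF p, where 'a = 'v] by (auto simp only:)
  have main: "(\<Sum>l\<in>paths V (2 * n + 1). path_weight k l * \<bar>f (last l) - f (hd l)\<bar> powr p)
       \<le> (2 powr p * 2 * C * exp C) * real n * (\<Sum>x\<in>V. \<Sum>y\<in>V. k x y * ((1 + v x y powr (1 - max p 2 / 2)) * \<bar>f x - f y\<bar> powr p))"
    if ch: "sym_chain V k" and v: "\<And>x y. x \<in> V \<Longrightarrow> y \<in> V \<Longrightarrow> 0 < v x y"
      and n: "\<And>x. x \<in> V \<Longrightarrow> real n * (\<Sum>y\<in>V. k x y * v x y) \<le> 1"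
    for V :: "'v set" and k n f v
  proof -
    interpret sym_chain V k by (rule ch)
    define q where "q = 1 + C / real n"
    define e where "e x = (\<Sum>y\<in>V. k x y * ((1 + v x y powr (1 - max p 2 / 2)) * \<bar>f x - f y\<bar> powr p))" for x
    define S where "S m = (\<Sum>l\<in>paths V (2 * m + 1). path_weight k l * \<bar>back_sum f l\<bar> powr p)" for m
    have e: "0 \<le> e x" if "x \<in> V" for x
      unfolding e_def using that k_nonneg by (intro sum_nonneg) auto
    have E: "0 \<le> (\<Sum>x\<in>V. e x)" using e by (rule sum_nonneg)
    have q1: "1 \<le> q" using C by (simp add: q_def)
    have Sn: "S n \<le> C * exp C * real n * (\<Sum>x\<in>V. e x)"
    proof (cases "n = 0")
      case True
      have "S 0 = 0" unfolding S_def by (simp add: sum_paths_Suc paths_0)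
      then show ?thesis using True by simp
    next
      case False
      have "S m \<le> real m * C * q ^ m * (\<Sum>x\<in>V. e x)" for m
      proof (induction m)
        case 0
        show ?case unfolding S_def by (simp add: sum_paths_Suc paths_0)
      next
        case (Suc m)
        have "S (Suc m) \<le> q * S m + C * (\<Sum>x\<in>V. e x)"
        proof -
          have "(\<Sum>x\<in>V. k y x * \<bar>f x - f y - drift f y + a\<bar> powr p) \<le> q * \<bar>a\<bar> powr p + C * e y"
            if "y \<in> V" for y a
          proof -
            have "(\<Sum>x\<in>V. k y x * \<bar>f x - f y - drift f y + a\<bar> powr p)
              \<le> (1 + C * (\<Sum>x\<in>V. k y x * v y x)) * \<bar>a\<bar> powr p
              + C * (\<Sum>x\<in>V. k y x * ((1 + v y x powr (1 - max p 2 / 2)) * \<bar>f x - f y\<bar> powr p))"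
              unfolding drift_def by (rule step) (use that finV k_nonneg k_row v in auto)
            also have "1 + C * (\<Sum>x\<in>V. k y x * v y x) \<le> q"
            proof -
              have "C * (\<Sum>x\<in>V. k y x * v y x) \<le> C * (1 / real n)"
                using n[OF that] False C by (intro mult_left_mono) (auto simp: field_simps)
              then show ?thesis by (simp add: q_def)
            qed
            finally show ?thesis
              by (simp add: e_def mult_right_mono abs_minus_commute)
          qed
          from back_sum_moment_step[OF this, of "2 * m"] show ?thesis
            by (simp add: S_def)
        qed
        also have "\<dots> \<le> q * (real m * C * q ^ m * (\<Sum>x\<in>V. e x)) + C * q ^ Suc m * (\<Sum>x\<in>V. e x)"
        proof -
          have "C * 1 * (\<Sum>x\<in>V. e x) \<le> C * q ^ Suc m * (\<Sum>x\<in>V. e x)"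
            using C E q1 by (intro mult_right_mono mult_left_mono one_le_power) auto
          then show ?thesis using Suc.IH q1 by (intro add_mono mult_left_mono) auto
        qed
        also have "\<dots> = real (Suc m) * C * q ^ Suc m * (\<Sum>x\<in>V. e x)"
          by (simp add: algebra_simps)
        finally show ?case .
      qed
      from this[of n] have "S n \<le> real n * C * q ^ n * (\<Sum>x\<in>V. e x)" .
      also have "\<dots> \<le> real n * C * exp C * (\<Sum>x\<in>V. e x)"
      proof -
        have "q ^ n \<le> exp (C / real n) ^ n"
          unfolding q_def using C by (intro power_mono exp_ge_add_one_self) auto
        also have "\<dots> = exp C" using False by (simp flip: exp_of_nat_mult)
        finally show ?thesis using C E by (intro mult_right_mono mult_left_mono) auto
      qed
      finally show ?thesis by (simp add: mult_ac)
    qed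
    have "(\<Sum>l\<in>paths V (2 * n + 1). path_weight k l * \<bar>f (last l) - f (hd l)\<bar> powr p)
       \<le> (\<Sum>l\<in>paths V (2 * n + 1). path_weight k l *
            (2 powr p * (\<bar>back_sum f (rev l)\<bar> powr p + \<bar>back_sum f l\<bar> powr p)))"
    proof (intro sum_mono mult_left_mono)
      fix l assume l: "l \<in> paths V (2 * n + 1)"
      then have "length l = 2 * n + 1" by (simp add: paths_def)
      then have "f (last l) - f (hd l) = back_sum f (rev l) - back_sum f l" by (rule last_minus_hd)
      then show "\<bar>f (last l) - f (hd l)\<bar> powr p \<le> 2 powr p * (\<bar>back_sum f (rev l)\<bar> powr p + \<bar>back_sum f l\<bar> powr p)"
        using abs_diff_powr_le_2 p by simp
      show "0 \<le> path_weight k l" using l by (rule weight_nonneg)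
    qed
    also have "\<dots> = 2 powr p * ((\<Sum>l\<in>paths V (2 * n + 1). path_weight k l * \<bar>back_sum f (rev l)\<bar> powr p) + S n)"
      unfolding S_def by (simp add: algebra_simps sum.distrib sum_distrib_left)
    also have "\<dots> = 2 powr p * 2 * S n"
      using sum_paths_rev[of "\<lambda>l. \<bar>back_sum f l\<bar> powr p" "2 * n + 1"] by (simp add: S_def)
    also have "\<dots> \<le> 2 powr p * 2 * (C * exp C * real n * (\<Sum>x\<in>V. e x))"
      using Sn by (intro mult_left_mono) auto
    finally show ?thesis by (simp add: e_def mult_ac)
  qed
  have "0 \<le> 2 powr p * 2 * C * exp C" using C by simp
  then show ?thesis
  proof (intro exI[of _ "2 powr p * 2 * C * exp C"] conjI allI impI, goal_cases)
    case (2 V k n f v)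
    then show ?case by (intro main) (auto simp: admissible_def)
  qed
qed

section \<open>A hierarchical walk on dyadic blocks\<close>

definition block :: "nat \<Rightarrow> nat \<Rightarrow> nat set" where
  "block j x = {y. y div 2 ^ j = x div 2 ^ j}"

lemma block_eq: "block j x = {(x div 2 ^ j) * 2 ^ j ..< (x div 2 ^ j) * 2 ^ j + 2 ^ j}"
proof -
  have "y div 2 ^ j = c \<longleftrightarrow> c * 2 ^ j \<le> y \<and> y < c * 2 ^ j + 2 ^ j" for y c :: nat
  proof
    assume "y div 2 ^ j = c"
    then have "c * 2 ^ j + y mod 2 ^ j = y" by (metis div_mult_mod_eq)
    moreover have "y mod 2 ^ j < 2 ^ j" by simp
    ultimately show "c * 2 ^ j \<le> y \<and> y < c * 2 ^ j + 2 ^ j" by linarith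
  next
    assume "c * 2 ^ j \<le> y \<and> y < c * 2 ^ j + 2 ^ j"
    then show "y div 2 ^ j = c" by (intro div_nat_eqI) (auto simp: mult.commute)
  qed
  then show ?thesis by (auto simp: block_def)
qed

lemma finite_block [simp]: "finite (block j x)"
  and card_block [simp]: "card (block j x) = 2 ^ j"
  by (simp_all add: block_eq)

lemma block_sym: "y \<in> block j x \<longleftrightarrow> x \<in> block j y" by (auto simp: block_def)

lemma block_cong: "y \<in> block j x \<Longrightarrow> block j y = block j x" by (auto simp: block_def)

lemma block_mono: "i \<le> j \<Longrightarrow> block i x \<subseteq> block j x"
proof -
  assume "i \<le> j"
  then have "y div 2 ^ j = y div 2 ^ i div 2 ^ (j - i)" for y :: nat
    by (simp flip: div_mult2_eq power_add)
  then show ?thesis unfolding block_def by (metis (mono_tags, lifting) mem_Collect_eq subsetI)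
qed

lemma block_full: "x < 2 ^ J \<Longrightarrow> block J x = {..<2 ^ J}"
  by (simp add: block_eq atLeast0LessThan)

lemma block_dist: "y \<in> block j x \<Longrightarrow> \<bar>real x - real y\<bar> \<le> 2 ^ j"
proof -
  assume "y \<in> block j x"
  moreover have "x \<in> block j x" by (simp add: block_def)
  ultimately have "x \<le> y + 2 ^ j" "y \<le> x + 2 ^ j"
    unfolding block_eq atLeastLessThan_iff by linarith+
  then have "real x \<le> real (y + 2 ^ j)" "real y \<le> real (x + 2 ^ j)" by (simp_all only: of_nat_le_iff)
  then have "real x \<le> real y + 2 ^ j" "real y \<le> real x + 2 ^ j" by simp_all
  then show ?thesis by linarith
qed

text \<open>
  The uniform density on the block of length \<open>2 ^ j\<close> around \<open>z\<close>. Averaging over blocks of length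
  \<open>2 ^ i\<close> turns it into the density of the larger of the two blocks.
\<close>
definition bump :: "nat \<Rightarrow> nat \<Rightarrow> nat \<Rightarrow> real" where
  "bump z j y = of_bool (y \<in> block j z) / 2 ^ j"

lemma block_avg_bump: "(\<Sum>y\<in>block i x. bump z j y) / 2 ^ i = bump z (max i j) x"
proof (cases "i \<le> j")
  case True
  have "bump z j y = bump z j x" if "y \<in> block i x" for y
    using block_mono[OF True, of x] that unfolding bump_def block_def by auto
  then show ?thesis using True by (simp add: max_def)
next
  case False
  have "(\<Sum>y\<in>block i x. bump z j y) = real (card (block i x \<inter> block j z)) / 2 ^ j"
    by (simp add: bump_def flip: sum_divide_distrib)
  also have "block i x \<inter> block j z = (if x \<in> block i z then block j z else {})"
  proof (cases "x \<in> block i z")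
    case True
    then have "block i x = block i z" by (rule block_cong)
    then show ?thesis using block_mono[of j i z] True False by auto
  next
    case c: False
    have "y \<notin> block i x" if "y \<in> block j z" for y
      using block_mono[of j i z] False that c by (auto simp: block_def)
    then show ?thesis using c by auto
  qed
  finally show ?thesis using False by (simp add: bump_def max_def)
qed

text \<open>
  At rate \<open>a j\<close> the cursor is moved to a uniform point of its block of length \<open>2 ^ j\<close>, and at rate \<open>b\<close> the
  lamp under the cursor is resampled. The cursor rests during the remaining time, also while a lamp is
  resampled.
\<close>
locale dyadic_chain =
  fixes J :: nat and a :: "nat \<Rightarrow> real" and b :: real
  assumes a_pos: "\<And>j. 0 < a j" and b_pos: "0 < b" and total: "(\<Sum>j=1..J. a j) + b \<le> 1"
begin

definition base_step :: "(nat \<Rightarrow> real) \<Rightarrow> nat \<Rightarrow> real" where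
  "base_step u x = (\<Sum>j=1..J. a j * ((\<Sum>y\<in>block j x. u y) / 2 ^ j)) + (1 - (\<Sum>j=1..J. a j)) * u x"

lemma base_step_add: "base_step (\<lambda>x. u x + w x) x = base_step u x + base_step w x"
  by (simp add: base_step_def sum.distrib algebra_simps add_divide_distrib)

lemma base_step_cmult: "base_step (\<lambda>x. c * u x) x = c * base_step u x"
  unfolding base_step_def by (simp add: distrib_left sum_distrib_left[symmetric]) (simp add: sum_distrib_left mult_ac)

lemma base_step_const: "base_step (\<lambda>x. c) x = c"
  by (simp add: base_step_def algebra_simps flip: sum_distrib_left)

lemma base_step_sum: "base_step (\<lambda>x. \<Sum>i\<in>I. u i x) x = (\<Sum>i\<in>I. base_step (u i) x)"
proof (induction I rule: infinite_finite_induct)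
  case (insert i I)
  then show ?case using base_step_add[of "u i" "\<lambda>x. \<Sum>i\<in>I. u i x"] by simp
qed (use base_step_const[of 0] in auto)

lemma base_step_diff: "base_step (\<lambda>x. u x - w x) x = base_step u x - base_step w x"
  using base_step_add[of u "\<lambda>x. (-1) * w x"] base_step_cmult[of "-1" w] by simp

text \<open>
  Positivity of the walk killed at rate \<open>b\<close> in the site \<open>z\<close>: the killing is paid for by the time that the
  cursor rests.
\<close>
lemma base_step_killed_nonneg:
  assumes "\<And>x. 0 \<le> u x"
  shows "0 \<le> base_step u x - b * of_bool (x = z) * u z"
proof -
  have "0 \<le> (\<Sum>j=1..J. a j * ((\<Sum>y\<in>block j x. u y) / 2 ^ j))"
    using a_pos assms by (intro sum_nonneg mult_nonneg_nonneg divide_nonneg_nonneg) (auto simp: less_imp_le)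
  moreover have "b * of_bool (x = z) * u z \<le> (1 - (\<Sum>j=1..J. a j)) * u x"
    using total b_pos assms mult_right_mono[of b "1 - (\<Sum>j=1..J. a j)" "u z"] by (cases "x = z") auto
  ultimately show ?thesis by (simp add: base_step_def)
qed

lemma base_step_mono: "(\<And>x. u x \<le> w x) \<Longrightarrow> base_step u x \<le> base_step w x"
  using base_step_killed_nonneg[of "\<lambda>x. w x - u x" x "Suc x"] by (simp add: base_step_diff)

lemma sum_block:
  fixes u :: "nat \<Rightarrow> real"
  assumes "j \<le> J"
  shows "(\<Sum>x<2 ^ J. \<Sum>y\<in>block j x. u y) = 2 ^ j * (\<Sum>x<2 ^ J. u x)"
proof -
  have sub: "block j x \<subseteq> {..<2 ^ J}" if "x < 2 ^ J" for x
    using block_mono[OF assms, of x] block_full[OF that] by simp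
  have "(\<Sum>x<2 ^ J. \<Sum>y\<in>block j x. u y) = (\<Sum>x<2 ^ J. \<Sum>y<2 ^ J. of_bool (y \<in> block j x) * u y)"
    using sub by (intro sum.cong refl sum.mono_neutral_cong_left) auto
  also have "\<dots> = (\<Sum>y<2 ^ J. \<Sum>x<2 ^ J. of_bool (x \<in> block j y) * u y)"
    by (subst sum.swap) (simp add: block_sym)
  also have "\<dots> = (\<Sum>y<2 ^ J. \<Sum>x\<in>block j y. u y)"
    using sub by (intro sum.cong refl sum.mono_neutral_cong_right) auto
  finally show ?thesis by (simp add: sum_distrib_left)
qed

lemma sum_base_step: "(\<Sum>x<2 ^ J. base_step u x) = (\<Sum>x<2 ^ J. u x)"
proof -
  have "(\<Sum>x<2 ^ J. base_step u x) = (\<Sum>j=1..J. a j * ((\<Sum>x<2 ^ J. \<Sum>y\<in>block j x. u y) / 2 ^ j))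
    + (1 - (\<Sum>j=1..J. a j)) * (\<Sum>x<2 ^ J. u x)"
    unfolding base_step_def sum.distrib
    by (subst sum.swap) (simp add: sum_distrib_left sum_divide_distrib)
  also have "(\<Sum>j=1..J. a j * ((\<Sum>x<2 ^ J. \<Sum>y\<in>block j x. u y) / 2 ^ j)) = (\<Sum>j=1..J. a j) * (\<Sum>x<2 ^ J. u x)"
    unfolding sum_distrib_right by (intro sum.cong refl) (simp add: sum_block)
  finally show ?thesis by (simp add: algebra_simps)
qed

definition coarse_rate :: "nat \<Rightarrow> real" where "coarse_rate j = (\<Sum>i\<in>{Suc j..J}. a i)"

lemma coarse_rate_pos: "j < J \<Longrightarrow> 0 < coarse_rate j"
  unfolding coarse_rate_def using a_pos by (intro sum_pos) auto

lemma base_step_bump: "base_step (bump z j) x = (\<Sum>i=1..J. a i * bump z (max i j) x) + (1 - (\<Sum>i=1..J. a i)) * bump z j x"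
  by (simp add: base_step_def block_avg_bump)

text \<open>
  Differences of consecutive bumps are eigenfunctions: moves on coarser scales annihilate them, and moves
  on finer scales fix them.
\<close>
lemma base_step_bump_diff:
  assumes "j < J"
  shows "base_step (\<lambda>x. bump z j x - bump z (Suc j) x) x = (1 - coarse_rate j) * (bump z j x - bump z (Suc j) x)"
proof -
  let ?d = "bump z j x - bump z (Suc j) x"
  have "base_step (\<lambda>x. bump z j x - bump z (Suc j) x) x
     = (\<Sum>i=1..J. a i * (bump z (max i j) x - bump z (max i (Suc j)) x)) + (1 - (\<Sum>i=1..J. a i)) * ?d"
    unfolding base_step_diff base_step_bump by (simp add: algebra_simps sum_subtractf)
  also have "(\<Sum>i=1..J. a i * (bump z (max i j) x - bump z (max i (Suc j)) x)) = (\<Sum>i=1..j. a i * ?d)"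
  proof (rule sum.mono_neutral_cong_right)
    show "\<forall>i\<in>{1..J} - {1..j}. a i * (bump z (max i j) x - bump z (max i (Suc j)) x) = 0"
    proof
      fix i assume "i \<in> {1..J} - {1..j}"
      then have "max i j = i" "max i (Suc j) = i" by auto
      then show "a i * (bump z (max i j) x - bump z (max i (Suc j)) x) = 0" by simp
    qed
  qed (use assms in \<open>auto simp: max_def\<close>)
  also have "(\<Sum>i=1..j. a i * ?d) = ((\<Sum>i=1..J. a i) - coarse_rate j) * ?d"
  proof -
    have "(\<Sum>i=1..J. a i) = (\<Sum>i=1..j. a i) + coarse_rate j"
      using sum.ub_add_nat[of 1 j a "J - j"] less_imp_le[OF assms]
      unfolding coarse_rate_def by (simp only: le_add_diff_inverse) simp
    then show ?thesis by (simp add: sum_distrib_right)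
  qed
  finally show ?thesis by (simp add: algebra_simps)
qed

definition green_bound :: real where "green_bound = (\<Sum>j<J. 1 / (2 ^ j * coarse_rate j))"

text \<open>
  The solution of the Poisson equation with a unit mass at \<open>z\<close> against the uniform density, assembled from
  the eigenfunctions.
\<close>
definition potential :: "nat \<Rightarrow> nat \<Rightarrow> real" where
  "potential z x = (\<Sum>j<J. 1 / coarse_rate j * (bump z j x - bump z (Suc j) x))"

lemma abs_potential: "\<bar>potential z x\<bar> \<le> green_bound"
  unfolding potential_def green_bound_def
proof (rule order.trans[OF sum_abs sum_mono])
  fix j assume j: "j \<in> {..<J}"
  have "\<bar>bump z j x - bump z (Suc j) x\<bar> \<le> 1 / 2 ^ j"
    using block_mono[of j "Suc j" z] by (auto simp: bump_def field_simps abs_if)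
  then have "1 / coarse_rate j * \<bar>bump z j x - bump z (Suc j) x\<bar> \<le> 1 / coarse_rate j * (1 / 2 ^ j)"
    using coarse_rate_pos j by (intro mult_left_mono) (auto simp: less_imp_le)
  then show "\<bar>1 / coarse_rate j * (bump z j x - bump z (Suc j) x)\<bar> \<le> 1 / (2 ^ j * coarse_rate j)"
    using coarse_rate_pos[of j] j by (simp add: abs_mult mult_ac abs_of_pos)
qed

lemma base_step_potential: "base_step (potential z) x = potential z x - bump z 0 x + bump z J x"
proof -
  have "base_step (potential z) x = (\<Sum>j<J. 1 / coarse_rate j * ((1 - coarse_rate j) * (bump z j x - bump z (Suc j) x)))"
    unfolding potential_def base_step_sum by (intro sum.cong refl) (simp only: base_step_cmult base_step_bump_diff lessThan_iff)
  also have "\<dots> = (\<Sum>j<J. 1 / coarse_rate j * (bump z j x - bump z (Suc j) x) - (bump z j x - bump z (Suc j) x))"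
  proof (intro sum.cong refl)
    fix j assume "j \<in> {..<J}"
    then have "coarse_rate j \<noteq> 0" using coarse_rate_pos[of j] by auto
    then show "1 / coarse_rate j * ((1 - coarse_rate j) * (bump z j x - bump z (Suc j) x))
      = 1 / coarse_rate j * (bump z j x - bump z (Suc j) x) - (bump z j x - bump z (Suc j) x)"
      by (simp add: field_simps)
  qed
  also have "\<dots> = potential z x - (bump z 0 x - bump z J x)"
    by (simp only: sum_subtractf sum_lessThan_telescope'[of "\<lambda>j. bump z j x", unfolded sum_subtractf] potential_def)
  finally show ?thesis by simp
qed

text \<open>
  The expected number of times that the lamp at \<open>z\<close> is resampled during \<open>N\<close> steps of a walk from \<open>x\<close>, and,
  as \<open>hit\<close>, the probability that it is resampled at all.
\<close>
fun occupation :: "nat \<Rightarrow> nat \<Rightarrow> nat \<Rightarrow> real" where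
  "occupation z 0 x = 0"
| "occupation z (Suc N) x = base_step (occupation z N) x + b * of_bool (x = z)"

fun hit :: "nat \<Rightarrow> nat \<Rightarrow> nat \<Rightarrow> real" where
  "hit z 0 x = 0"
| "hit z (Suc N) x = base_step (hit z N) x - b * of_bool (x = z) * hit z N z + b * of_bool (x = z)"

lemma bump_0: "bump z 0 x = of_bool (x = z)" by (simp add: bump_def block_def)

lemma occupation_le: "occupation z N x \<le> b * (real N * bump z J x + (potential z x + green_bound))"
proof (induction N arbitrary: x)
  case 0
  have "0 \<le> potential z x + green_bound" using abs_potential[of z x] by linarith
  then show ?case using b_pos by simp
next
  case (Suc N)
  have "(\<Sum>i=1..J. a i * bump z (max i J) x) = (\<Sum>i=1..J. a i) * bump z J x"
    unfolding sum_distrib_right by (intro sum.cong refl) (simp add: max_def)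
  then have "base_step (bump z J) x = bump z J x" unfolding base_step_bump by (simp add: algebra_simps)
  then have "base_step (\<lambda>x. b * (real N * bump z J x + (potential z x + green_bound))) x
     = b * (real N * bump z J x + (potential z x - bump z 0 x + bump z J x + green_bound))"
    unfolding base_step_cmult using base_step_add[of "\<lambda>x. real N * bump z J x" "\<lambda>x. potential z x + green_bound" x]
      base_step_add[of "potential z" "\<lambda>x. green_bound" x] base_step_cmult[of "real N" "bump z J" x] base_step_const[of green_bound x] base_step_potential[of z x]
    by simp
  then show ?case
    using base_step_mono[of "occupation z N", OF Suc.IH, of x] by (simp add: algebra_simps bump_0)
qed

lemma occupation_self_le:
  assumes "z < 2 ^ J"
  shows "occupation z N z \<le> b * (real N / 2 ^ J + 2 * green_bound)"
proof -
  have "bump z J z = 1 / 2 ^ J" by (simp add: bump_def block_def)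
  moreover have "potential z z \<le> green_bound" using abs_potential[of z z] by linarith
  ultimately have "b * (real N * bump z J z + (potential z z + green_bound)) \<le> b * (real N / 2 ^ J + 2 * green_bound)"
    using b_pos by (intro mult_left_mono) auto
  then show ?thesis using occupation_le[of z N z] by linarith
qed

lemma occupation_mono: "occupation z N x \<le> occupation z (Suc N) x"
proof (induction N arbitrary: x)
  case 0
  have "occupation z 0 = (\<lambda>x. 0)" by auto
  then show ?case using base_step_const[of 0] b_pos by simp
next
  case (Suc N)
  have "base_step (occupation z N) x \<le> base_step (occupation z (Suc N)) x" by (rule base_step_mono) (rule Suc.IH)
  then show ?case by (simp only: occupation.simps)
qed

lemma occupation_mono': "n \<le> N \<Longrightarrow> occupation z n x \<le> occupation z N x"
  using lift_Suc_mono_le[of "\<lambda>n. occupation z n x"] occupation_mono by blast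

lemma sum_occupation: "z < 2 ^ J \<Longrightarrow> (\<Sum>x<2 ^ J. occupation z N x) = real N * b"
proof (induction N)
  case (Suc N)
  then show ?case by (simp add: sum.distrib sum_base_step distrib_right flip: sum_distrib_left)
qed simp

text \<open>
  The first-passage decomposition: once the lamp at \<open>z\<close> has been resampled, the cursor is at \<open>z\<close>, so that at
  most \<open>occupation z N z\<close> further events are expected.
\<close>
lemma hit_ge: "n \<le> N \<Longrightarrow> occupation z n x \<le> (1 + occupation z N z) * hit z n x"
proof (induction n arbitrary: x)
  case (Suc n)
  let ?M = "1 + occupation z N z"
  have "0 \<le> ?M * hit z n y - occupation z n y" for y using Suc by simp
  from base_step_killed_nonneg[where u = "\<lambda>y. ?M * hit z n y - occupation z n y", OF this, of x z]
  have 1: "0 \<le> ?M * base_step (hit z n) x - base_step (occupation z n) x - b * of_bool (x = z) * (?M * hit z n z - occupation z n z)"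
    by (simp add: base_step_diff base_step_cmult)
  have "b * of_bool (x = z) * (1 + occupation z n z) \<le> b * of_bool (x = z) * ?M"
    using occupation_mono'[of n N z] Suc.prems b_pos by (intro mult_left_mono) auto
  with 1 show ?case by (simp add: algebra_simps)
qed simp

lemma sum_hit_ge:
  assumes "z < 2 ^ J"
  shows "real N * b / (1 + b * (real N / 2 ^ J + 2 * green_bound)) \<le> (\<Sum>x<2 ^ J. hit z N x)"
proof -
  have occ0: "0 \<le> occupation z N z" using occupation_mono'[of 0 N z] by simp
  have "real N * b = (\<Sum>x<2 ^ J. occupation z N x)" using assms by (simp add: sum_occupation)
  also have "\<dots> \<le> (1 + occupation z N z) * (\<Sum>x<2 ^ J. hit z N x)"
    unfolding sum_distrib_left by (intro sum_mono hit_ge) auto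
  finally have 1: "real N * b \<le> (1 + occupation z N z) * (\<Sum>x<2 ^ J. hit z N x)" .
  have "real N * b / (1 + b * (real N / 2 ^ J + 2 * green_bound)) \<le> real N * b / (1 + occupation z N z)"
    using occupation_self_le[OF assms, of N] occ0 b_pos by (intro divide_left_mono mult_pos_pos) auto
  also have "\<dots> \<le> (\<Sum>x<2 ^ J. hit z N x)" using 1 occ0 by (simp add: field_simps)
  finally show ?thesis .
qed

end

section \<open>The walk with lamps\<close>

context sym_chain begin

definition transition :: "('v \<Rightarrow> real) \<Rightarrow> 'v \<Rightarrow> real" where
  "transition \<phi> x = (\<Sum>y\<in>V. k x y * \<phi> y)"

text \<open>
  Only the two ends of a path matter in the estimates from below; the rest integrates to a power of the
  transition operator.
\<close>
lemma sum_paths_hd_last: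
  "(\<Sum>l\<in>paths V (Suc n). path_weight k l * \<phi> (hd l) (last l)) = (\<Sum>x\<in>V. (transition ^^ n) (\<phi> x) x)"
proof (induction n arbitrary: \<phi>)
  case 0
  show ?case by (simp add: sum_paths_Suc paths_0)
next
  case (Suc n)
  have "(\<Sum>l\<in>paths V (Suc (Suc n)). path_weight k l * \<phi> (hd l) (last l))
     = (\<Sum>x\<in>V. \<Sum>l\<in>paths V (Suc n). path_weight k l * (k x (hd l) * \<phi> x (last l)))"
    unfolding sum_paths_Suc[of _ _ "Suc n"]
    by (intro sum.cong refl) (simp add: path_weight_Cons hd_paths mult_ac)
  also have "\<dots> = (\<Sum>x\<in>V. \<Sum>y\<in>V. (transition ^^ n) (\<lambda>z. k x y * \<phi> x z) y)"
    by (rule sum.cong[OF refl], rule Suc.IH[of "\<lambda>y z. k _ y * \<phi> _ z"])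
  also have "\<dots> = (\<Sum>x\<in>V. (transition ^^ Suc n) (\<phi> x) x)"
  proof (intro sum.cong refl)
    fix x
    have "(transition ^^ i) (\<lambda>z. c * \<psi> z) y = c * (transition ^^ i) \<psi> y" for i c \<psi> y
      by (induction i arbitrary: y) (simp_all add: transition_def sum_distrib_left mult_ac)
    then show "(\<Sum>y\<in>V. (transition ^^ n) (\<lambda>z. k x y * \<phi> x z) y) = (transition ^^ Suc n) (\<phi> x) x"
      by (simp add: transition_def)
  qed
  finally show ?case .
qed

end

context dyadic_chain begin

definition states :: "(nat set \<times> nat) set" where
  "states = Pow {..<2 ^ J} \<times> {..<2 ^ J}"

definition idle :: real where "idle = 1 - (\<Sum>j=1..J. a j) - b"

text \<open>
  A state records the set of lit lamps and the cursor. The condition \<open>A - {x} = B - {x}\<close> holds for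
  exactly two sets \<open>B\<close>, the two outcomes of resampling the lamp at \<open>x\<close>.
\<close>
definition kernel :: "nat set \<times> nat \<Rightarrow> nat set \<times> nat \<Rightarrow> real" where
  "kernel = (\<lambda>(A, x) (B, y). (\<Sum>j=1..J. a j * (of_bool (A = B \<and> y \<in> block j x) / 2 ^ j))
     + b / 2 * of_bool (x = y \<and> A - {x} = B - {x}) + idle * of_bool (A = B \<and> x = y))"

definition chain_step :: "(nat set \<times> nat \<Rightarrow> real) \<Rightarrow> nat set \<times> nat \<Rightarrow> real" where
  "chain_step \<phi> = (\<lambda>(A, x). (\<Sum>j=1..J. a j * ((\<Sum>y\<in>block j x. \<phi> (A, y)) / 2 ^ j))
     + b / 2 * (\<phi> (insert x A, x) + \<phi> (A - {x}, x)) + idle * \<phi> (A, x))"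

lemma idle_nonneg: "0 \<le> idle" using total by (simp add: idle_def)

lemma kernel_sym: "kernel s t = kernel t s"
proof -
  have 1: "(A = B \<and> y \<in> block j x) = (B = A \<and> x \<in> block j y)" for A B :: "nat set" and x y j
    by (metis block_sym)
  have 2: "(x = y \<and> A - {x} = B - {x}) = (y = x \<and> B - {y} = A - {y})" for A B :: "nat set" and x y
    by metis
  have 3: "(A = B \<and> x = y) = (B = A \<and> y = x)" for A B :: "nat set" and x y :: nat
    by metis
  obtain A x B y where st: "s = (A, x)" "t = (B, y)" by fastforce
  show ?thesis unfolding st kernel_def prod.case 1[of A B y _ x] 2[of x y A B] 3[of A B x y] ..
qed

lemma kernel_nonneg: "0 \<le> kernel s t"
  using a_pos b_pos idle_nonneg
  by (auto simp: kernel_def split: prod.splits intro!: add_nonneg_nonneg sum_nonneg mult_nonneg_nonneg simp: less_imp_le)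

lemma sum_of_bool_mult:
  fixes \<phi> :: "'b \<Rightarrow> real"
  assumes "finite V" "{t. P t} \<subseteq> V"
  shows "(\<Sum>t\<in>V. of_bool (P t) * \<phi> t) = (\<Sum>t | P t. \<phi> t)"
  using assms by (intro sum.mono_neutral_cong_right) auto

lemma sum_kernel:
  assumes "st \<in> states"
  shows "(\<Sum>t\<in>states. kernel st t * \<phi> t) = chain_step \<phi> st"
proof -
  obtain A x where st: "st = (A, x)" by fastforce
  have A: "A \<subseteq> {..<2 ^ J}" and x: "x < 2 ^ J" using assms by (auto simp: st states_def)
  have fin: "finite states" by (simp add: states_def)
  have 1: "(\<Sum>t\<in>states. of_bool (A = fst t \<and> snd t \<in> block j x) * \<phi> t) = (\<Sum>y\<in>block j x. \<phi> (A, y))"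
    if "j \<in> {1..J}" for j
  proof -
    have "{t. A = fst t \<and> snd t \<in> block j x} = Pair A ` block j x" by auto
    moreover have "Pair A ` block j x \<subseteq> states"
      using block_mono[of j J x] block_full[OF x] that A by (auto simp: states_def)
    ultimately show ?thesis
      by (subst sum_of_bool_mult[OF fin]) (auto simp: sum.reindex inj_on_def)
  qed
  have 2: "(\<Sum>t\<in>states. of_bool (x = snd t \<and> A - {x} = fst t - {x}) * \<phi> t) = \<phi> (insert x A, x) + \<phi> (A - {x}, x)"
  proof -
    have "A - {x} = B - {x} \<longleftrightarrow> B = insert x A \<or> B = A - {x}" for B by blast
    then have "x = snd t \<and> A - {x} = fst t - {x} \<longleftrightarrow> t = (insert x A, x) \<or> t = (A - {x}, x)" for t
      by (cases t) (simp only: fst_conv snd_conv prod.inject, metis)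
    then have "{t. x = snd t \<and> A - {x} = fst t - {x}} = {(insert x A, x), (A - {x}, x)}"
      by (simp only:) (simp only: insert_def Un_def mem_Collect_eq empty_iff, simp)
    moreover have "\<dots> \<subseteq> states" using A x by (auto simp: states_def)
    moreover have "insert x A \<noteq> A - {x}" by auto
    ultimately show ?thesis by (subst sum_of_bool_mult[OF fin]) auto
  qed
  have 3: "(\<Sum>t\<in>states. of_bool (A = fst t \<and> x = snd t) * \<phi> t) = \<phi> (A, x)"
  proof -
    have "{t. A = fst t \<and> x = snd t} = {(A, x)}" by auto
    moreover have "\<dots> \<subseteq> states" using A x by (auto simp: states_def)
    ultimately show ?thesis by (subst sum_of_bool_mult[OF fin]) auto
  qed
  have "(\<Sum>t\<in>states. kernel st t * \<phi> t)
    = (\<Sum>t\<in>states. \<Sum>j=1..J. a j * (of_bool (A = fst t \<and> snd t \<in> block j x) * \<phi> t / 2 ^ j))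
      + b / 2 * (\<Sum>t\<in>states. of_bool (x = snd t \<and> A - {x} = fst t - {x}) * \<phi> t)
      + idle * (\<Sum>t\<in>states. of_bool (A = fst t \<and> x = snd t) * \<phi> t)"
    unfolding sum_distrib_left sum.distrib[symmetric]
    by (intro sum.cong refl)
      (simp only: kernel_def st case_prod_unfold fst_conv snd_conv distrib_right sum_distrib_right mult.assoc times_divide_eq_left)
  also have "(\<Sum>t\<in>states. \<Sum>j=1..J. a j * (of_bool (A = fst t \<and> snd t \<in> block j x) * \<phi> t / 2 ^ j))
    = (\<Sum>j=1..J. a j * ((\<Sum>t\<in>states. of_bool (A = fst t \<and> snd t \<in> block j x) * \<phi> t) / 2 ^ j))"
    by (subst sum.swap) (simp add: sum_distrib_left sum_divide_distrib)
  also have "\<dots> = (\<Sum>j=1..J. a j * ((\<Sum>y\<in>block j x. \<phi> (A, y)) / 2 ^ j))"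
    by (intro sum.cong refl) (simp only: 1)
  finally show ?thesis by (simp add: 2 3 chain_step_def st)
qed

lemma sym_chain_kernel: "sym_chain states kernel"
proof
  show "finite states" by (simp add: states_def)
  show "(\<Sum>t\<in>states. kernel st t) = 1" if "st \<in> states" for st
    using sum_kernel[OF that, of "\<lambda>_. 1"]
    by (simp add: chain_step_def idle_def case_prod_unfold)
qed (use kernel_sym kernel_nonneg in auto)

interpretation chain: sym_chain states kernel by (rule sym_chain_kernel)

text \<open>
  A lamp that was resampled at least once is a fair coin, and any other lamp is in its original state. So
  the law of a single lamp is governed by the hitting probability alone.
\<close>
lemma transition_pow_lamp:
  assumes "(A, x) \<in> states"
  shows "(chain.transition ^^ N) (\<lambda>t. of_bool ((z \<in> fst t) \<noteq> \<epsilon>)) (A, x)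
    = (1 - hit z N x) * of_bool ((z \<in> A) \<noteq> \<epsilon>) + hit z N x / 2"
  using assms
proof (induction N arbitrary: A x)
  case (Suc N)
  define lit :: "nat set \<Rightarrow> real" where "lit A = of_bool ((z \<in> A) \<noteq> \<epsilon>)" for A
  define \<eta> where "\<eta> t = (1 - hit z N (snd t)) * lit (fst t) + hit z N (snd t) / 2" for t
  have "(chain.transition ^^ Suc N) (\<lambda>t. of_bool ((z \<in> fst t) \<noteq> \<epsilon>)) (A, x)
     = (\<Sum>t\<in>states. kernel (A, x) t * \<eta> t)"
  proof -
    have "(chain.transition ^^ N) (\<lambda>t. of_bool ((z \<in> fst t) \<noteq> \<epsilon>)) t = \<eta> t" if "t \<in> states" for t
      using Suc.IH[of "fst t" "snd t"] that by (simp only: prod.collapse \<eta>_def lit_def)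
    then show ?thesis
      by (simp only: funpow.simps o_apply chain.transition_def cong: sum.cong)
  qed
  also have "\<dots> = chain_step \<eta> (A, x)" by (rule sum_kernel[OF Suc.prems])
  also have "chain_step \<eta> (A, x) = (1 - hit z (Suc N) x) * lit A + hit z (Suc N) x / 2"
  proof -
    define h where "h = hit z N"
    define R where "R = (\<Sum>j=1..J. a j * ((\<Sum>y\<in>block j x. h y) / 2 ^ j))"
    have "(\<Sum>y\<in>block j x. \<eta> (A, y)) / 2 ^ j
      = lit A + (1 / 2 - lit A) * ((\<Sum>y\<in>block j x. h y) / 2 ^ j)" for j
    proof -
      have "(\<Sum>y\<in>block j x. \<eta> (A, y)) = (\<Sum>y\<in>block j x. lit A + (1 / 2 - lit A) * h y)"
        by (simp add: \<eta>_def h_def algebra_simps)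
      then show ?thesis by (simp add: sum.distrib add_divide_distrib flip: sum_distrib_left)
    qed
    then have "(\<Sum>j=1..J. a j * ((\<Sum>y\<in>block j x. \<eta> (A, y)) / 2 ^ j)) = (\<Sum>j=1..J. a j) * lit A + (1 / 2 - lit A) * R"
      by (simp add: R_def algebra_simps sum.distrib sum_distrib_left sum_distrib_right sum_subtractf sum_divide_distrib)
    then have st: "chain_step \<eta> (A, x) = (\<Sum>j=1..J. a j) * lit A + (1 / 2 - lit A) * R
       + b / 2 * (\<eta> (insert x A, x) + \<eta> (A - {x}, x)) + idle * \<eta> (A, x)"
      by (simp add: chain_step_def)
    have hS: "hit z (Suc N) x = R + (1 - (\<Sum>j=1..J. a j)) * h x - b * of_bool (x = z) * h z + b * of_bool (x = z)"
      by (simp add: base_step_def R_def h_def)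
    show ?thesis
    proof (cases "x = z")
      case True
      have "lit (insert x A) + lit (A - {x}) = 1" using True by (auto simp: lit_def)
      then have e: "\<eta> (insert x A, x) + \<eta> (A - {x}, x) = 1"
        by (simp add: \<eta>_def flip: distrib_left)
      show ?thesis unfolding st hS e
        using True by (simp add: idle_def \<eta>_def h_def field_simps)
    next
      case False
      then have "lit (insert x A) = lit A" "lit (A - {x}) = lit A" by (auto simp: lit_def)
      then show ?thesis unfolding st hS
        using False by (simp add: idle_def \<eta>_def h_def field_simps)
    qed
  qed
  finally show ?case by (simp add: lit_def)
qed simp

lemma transition_pow_sum:
  "finite I \<Longrightarrow> (chain.transition ^^ N) (\<lambda>t. \<Sum>i\<in>I. \<phi> i t) s = (\<Sum>i\<in>I. (chain.transition ^^ N) (\<phi> i) s)"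
proof (induction N arbitrary: s)
  case (Suc N)
  then show ?case by (simp add: chain.transition_def sum_distrib_left sum.swap[of _ I])
qed simp

lemma sum_displacement:
  "(2 ^ 2 ^ J * 2 ^ J) * (real N * b / (2 * (1 + b * (real N / 2 ^ J + 2 * green_bound))))
    \<le> (\<Sum>l\<in>paths states (Suc N). path_weight kernel l * real (card (sym_diff (fst (hd l)) (fst (last l)))))"
proof -
  let ?m = "2 ^ J :: nat"
  have card_eq: "real (card (sym_diff A B)) = (\<Sum>z<?m. of_bool ((z \<in> B) \<noteq> (z \<in> A)))"
    if "A \<subseteq> {..<?m}" "B \<subseteq> {..<?m}" for A B
  proof -
    have "sym_diff A B = {..<?m} \<inter> {z. (z \<in> B) \<noteq> (z \<in> A)}" using that by auto
    then show ?thesis by simp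
  qed
  have "(\<Sum>l\<in>paths states (Suc N). path_weight kernel l * real (card (sym_diff (fst (hd l)) (fst (last l)))))
    = (\<Sum>l\<in>paths states (Suc N). path_weight kernel l * (\<Sum>z<?m. of_bool ((z \<in> fst (last l)) \<noteq> (z \<in> fst (hd l)))))"
  proof (intro sum.cong refl)
    fix l assume l: "l \<in> paths states (Suc N)"
    then have "hd l \<in> states" "last l \<in> states"
      using hd_paths[OF l] by (auto simp: paths_def)
    then show "path_weight kernel l * real (card (sym_diff (fst (hd l)) (fst (last l))))
      = path_weight kernel l * (\<Sum>z<?m. of_bool ((z \<in> fst (last l)) \<noteq> (z \<in> fst (hd l))))"
      by (subst card_eq) (auto simp: states_def)
  qed
  also have "\<dots> = (\<Sum>s\<in>states. (chain.transition ^^ N) (\<lambda>t. \<Sum>z<?m. of_bool ((z \<in> fst t) \<noteq> (z \<in> fst s))) s)"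
    by (rule chain.sum_paths_hd_last[of "\<lambda>s t. \<Sum>z<?m. of_bool ((z \<in> fst t) \<noteq> (z \<in> fst s))"])
  also have "\<dots> = (\<Sum>s\<in>states. \<Sum>z<?m. hit z N (snd s) / 2)"
  proof (intro sum.cong refl)
    fix s assume s: "s \<in> states"
    show "(chain.transition ^^ N) (\<lambda>t. \<Sum>z<?m. of_bool ((z \<in> fst t) \<noteq> (z \<in> fst s))) s = (\<Sum>z<?m. hit z N (snd s) / 2)"
      using transition_pow_lamp[of "fst s" "snd s" N _ "_ \<in> fst s"] s by (subst transition_pow_sum) auto
  qed
  also have "\<dots> = (\<Sum>z<?m. \<Sum>A\<in>Pow {..<?m}. (\<Sum>x<?m. hit z N x) / 2)"
    unfolding states_def by (subst sum.swap) (simp add: sum.cartesian_product' sum_divide_distrib)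
  also have "\<dots> \<ge> (\<Sum>z<?m. \<Sum>A\<in>Pow {..<?m}. (real N * b / (1 + b * (real N / 2 ^ J + 2 * green_bound))) / 2)"
    by (intro sum_mono divide_right_mono sum_hit_ge) auto
  finally show ?thesis by (simp add: card_Pow mult_ac)
qed

lemma card_states: "real (card states) = 2 ^ 2 ^ J * 2 ^ J"
  by (simp add: states_def card_Pow)

end

section \<open>The space of p-integrable functions and word metrics\<close>

lemma Lp_norm_nonneg: "0 \<le> Lp_norm p u"
  by (simp add: Lp_norm_def)

lemma Lp_norm_powr:
  assumes "1 \<le> p"
  shows "Lp_norm p u powr p = (LINT t|lebesgue_on {0..1}. \<bar>u t\<bar> powr p)"
  using assms by (simp add: Lp_norm_def powr_powr)

lemma Lp_fun_diff:
  assumes p: "1 \<le> p" and u: "u \<in> Lp_fun p" and w: "w \<in> Lp_fun p"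
  shows "(\<lambda>t. u t - w t) \<in> Lp_fun p"
proof -
  have [measurable]: "u \<in> borel_measurable (lebesgue_on {0..1})" "w \<in> borel_measurable (lebesgue_on {0..1})"
    using u w by (auto simp: Lp_fun_def)
  have "integrable (lebesgue_on {0..1}) (\<lambda>t. \<bar>u t - w t\<bar> powr p)"
  proof (rule Bochner_Integration.integrable_bound)
    show "integrable (lebesgue_on {0..1}) (\<lambda>t. 2 powr p * (\<bar>u t\<bar> powr p + \<bar>w t\<bar> powr p))"
      using u w by (auto simp: Lp_fun_def)
    show "AE t in lebesgue_on {0..1}. norm (\<bar>u t - w t\<bar> powr p) \<le> norm (2 powr p * (\<bar>u t\<bar> powr p + \<bar>w t\<bar> powr p))"
      using abs_diff_powr_le_2[of p] p by (intro always_eventually) auto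
  qed measurable
  then show ?thesis by (simp add: Lp_fun_def)
qed

lemma Lp_norm_minus: "Lp_norm p (\<lambda>t. u t - w t) = Lp_norm p (\<lambda>t. w t - u t)"
  by (simp add: Lp_norm_def abs_minus_commute)

lemma abs_convex_comb_powr:
  fixes x y :: real
  assumes "1 \<le> p" "0 \<le> \<mu>" "\<mu> \<le> 1"
  shows "\<bar>\<mu> * x + (1 - \<mu>) * y\<bar> powr p \<le> \<mu> * \<bar>x\<bar> powr p + (1 - \<mu>) * \<bar>y\<bar> powr p"
proof -
  have "\<bar>\<mu> * x + (1 - \<mu>) * y\<bar> \<le> \<mu> * \<bar>x\<bar> + (1 - \<mu>) * \<bar>y\<bar>"
    using assms abs_triangle_ineq[of "\<mu> * x" "(1 - \<mu>) * y"] by (simp add: abs_mult)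
  then have "\<bar>\<mu> * x + (1 - \<mu>) * y\<bar> powr p \<le> (\<mu> * \<bar>x\<bar> + (1 - \<mu>) * \<bar>y\<bar>) powr p"
    using assms by (intro powr_mono2) auto
  also have "\<dots> \<le> \<mu> * \<bar>x\<bar> powr p + (1 - \<mu>) * \<bar>y\<bar> powr p"
    using powr_sum_le[of p "UNIV :: bool set" "\<lambda>i. if i then \<mu> else 1 - \<mu>" "\<lambda>i. if i then \<bar>x\<bar> else \<bar>y\<bar>"] assms
    by (simp add: UNIV_bool add.commute)
  finally show ?thesis .
qed

text \<open>
  For \<open>A\<close> and \<open>B\<close> larger than the two norms, \<open>u + w\<close> is \<open>A + B\<close> times a convex combination of \<open>u / A\<close> and
  \<open>w / B\<close>, so convexity of the power applies pointwise.
\<close>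
lemma Lp_minkowski:
  assumes p: "1 \<le> p" and u: "u \<in> Lp_fun p" and w: "w \<in> Lp_fun p"
  shows "Lp_norm p (\<lambda>t. u t + w t) \<le> Lp_norm p u + Lp_norm p w"
proof -
  let ?M = "lebesgue_on {0..1 :: real}"
  have [measurable]: "u \<in> borel_measurable ?M" "w \<in> borel_measurable ?M"
    and iu: "integrable ?M (\<lambda>t. \<bar>u t\<bar> powr p)" and iw: "integrable ?M (\<lambda>t. \<bar>w t\<bar> powr p)"
    using u w by (auto simp: Lp_fun_def)
  have le: "Lp_norm p (\<lambda>t. u t + w t) \<le> A + B"
    if A: "Lp_norm p u < A" and B: "Lp_norm p w < B" for A B
  proof -
    have pos: "0 < A" "0 < B" using A B Lp_norm_nonneg[of p u] Lp_norm_nonneg[of p w] by linarith+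
    define \<mu> where "\<mu> = A / (A + B)"
    have \<mu>: "0 \<le> \<mu>" "\<mu> \<le> 1" "1 - \<mu> = B / (A + B)" using pos by (auto simp: \<mu>_def field_simps)
    have pt: "\<bar>u t + w t\<bar> powr p \<le> (A + B) powr p * (\<mu> / A powr p * \<bar>u t\<bar> powr p + (1 - \<mu>) / B powr p * \<bar>w t\<bar> powr p)" for t
    proof -
      have "u t + w t = (A + B) * (\<mu> * (u t / A) + (1 - \<mu>) * (w t / B))"
      proof -
        have "(A + B) * (\<mu> * (u t / A)) = u t" "(A + B) * ((1 - \<mu>) * (w t / B)) = w t"
          unfolding \<mu>(3) using pos by (simp_all add: \<mu>_def)
        then show ?thesis by (simp only: distrib_left)
      qed
      then have "\<bar>u t + w t\<bar> powr p = (A + B) powr p * \<bar>\<mu> * (u t / A) + (1 - \<mu>) * (w t / B)\<bar> powr p"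
        using pos by (simp add: abs_mult powr_mult)
      also have "\<dots> \<le> (A + B) powr p * (\<mu> * \<bar>u t / A\<bar> powr p + (1 - \<mu>) * \<bar>w t / B\<bar> powr p)"
        by (intro mult_left_mono abs_convex_comb_powr p \<mu>) auto
      also have "\<dots> = (A + B) powr p * (\<mu> / A powr p * \<bar>u t\<bar> powr p + (1 - \<mu>) / B powr p * \<bar>w t\<bar> powr p)"
        using pos by (simp add: powr_divide)
      finally show ?thesis .
    qed
    have "(LINT t|?M. \<bar>u t + w t\<bar> powr p)
      \<le> (LINT t|?M. (A + B) powr p * (\<mu> / A powr p * \<bar>u t\<bar> powr p + (1 - \<mu>) / B powr p * \<bar>w t\<bar> powr p))"
      using iu iw pt Lp_fun_diff[OF p u, of "\<lambda>t. - w t"] w by (intro integral_mono) (auto simp: Lp_fun_def)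
    also have "\<dots> = (A + B) powr p * (\<mu> / A powr p * Lp_norm p u powr p + (1 - \<mu>) / B powr p * Lp_norm p w powr p)"
      using iu iw p by (simp add: Lp_norm_powr)
    also have "\<dots> \<le> (A + B) powr p * (\<mu> / A powr p * A powr p + (1 - \<mu>) / B powr p * B powr p)"
      using A B p \<mu> Lp_norm_nonneg by (intro mult_left_mono add_mono powr_mono2 divide_nonneg_nonneg) auto
    also have "\<dots> = (A + B) powr p" using pos by simp
    finally have "Lp_norm p (\<lambda>t. u t + w t) powr p \<le> (A + B) powr p" using p by (simp add: Lp_norm_powr)
    then show ?thesis using p pos powr_less_mono2[of p "A + B" "Lp_norm p (\<lambda>t. u t + w t)"] by linarith
  qed
  show ?thesis
  proof (rule field_le_epsilon)
    fix e :: real assume "0 < e"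
    then show "Lp_norm p (\<lambda>t. u t + w t) \<le> Lp_norm p u + Lp_norm p w + e"
      using le[of "Lp_norm p u + e / 2" "Lp_norm p w + e / 2"] by (simp add: field_simps)
  qed
qed

lemma Lp_triangle:
  assumes p: "1 \<le> p" and "u \<in> Lp_fun p" "v \<in> Lp_fun p" "w \<in> Lp_fun p"
  shows "Lp_norm p (\<lambda>t. u t - w t) \<le> Lp_norm p (\<lambda>t. u t - v t) + Lp_norm p (\<lambda>t. v t - w t)"
  using Lp_minkowski[OF p Lp_fun_diff[OF p assms(2,3)] Lp_fun_diff[OF p assms(3,4)]] by simp

lemma (in monoid) foldr_mult_closed: "set w \<subseteq> carrier G \<Longrightarrow> foldr (mult G) w \<one> \<in> carrier G"
  by (induction w) auto

lemma (in monoid) foldr_mult_append: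
  "set u \<subseteq> carrier G \<Longrightarrow> set w \<subseteq> carrier G \<Longrightarrow>
    foldr (mult G) (u @ w) \<one> = foldr (mult G) u \<one> \<otimes> foldr (mult G) w \<one>"
  by (induction u) (auto simp: foldr_mult_closed m_assoc)

context group begin

lemma word_exists:
  assumes S: "sym_generating_set G S" and g: "g \<in> carrier G"
  shows "\<exists>w. set w \<subseteq> S \<and> foldr (mult G) w \<one> = g"
proof -
  have sub: "S \<subseteq> carrier G" and inv: "\<And>s. s \<in> S \<Longrightarrow> inv s \<in> S" and "g \<in> generate G S"
    using S g by (auto simp: sym_generating_set_def)
  from this(3) show ?thesis
  proof (induction rule: generate.induct)
    case one
    show ?case by (rule exI[of _ "[]"]) simp
  next
    case (incl h)
    then show ?case using sub by (intro exI[of _ "[h]"]) auto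
  next
    case (inv h)
    then show ?case using sub \<open>\<And>s. s \<in> S \<Longrightarrow> inv s \<in> S\<close> by (intro exI[of _ "[inv h]"]) auto
  next
    case (eng h1 h2)
    then obtain w1 w2 where "set w1 \<subseteq> S" "foldr (mult G) w1 \<one> = h1" "set w2 \<subseteq> S" "foldr (mult G) w2 \<one> = h2"
      by blast
    then show ?case using sub foldr_mult_append[of w1 w2] by (intro exI[of _ "w1 @ w2"]) auto
  qed
qed

lemma word_length_le: "set w \<subseteq> S \<Longrightarrow> word_length G S (foldr (mult G) w \<one>) \<le> length w"
  unfolding word_length_def by (rule Least_le) blast

lemma word_length_attained:
  assumes "sym_generating_set G S" "g \<in> carrier G"
  obtains w where "set w \<subseteq> S" "length w = word_length G S g" "foldr (mult G) w \<one> = g"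
proof -
  obtain w where "set w \<subseteq> S" "foldr (mult G) w \<one> = g" using word_exists[OF assms] by blast
  then have "\<exists>v. set v \<subseteq> S \<and> length v = length w \<and> foldr (mult G) v \<one> = g" by blast
  from LeastI[where P = "\<lambda>n. \<exists>v. set v \<subseteq> S \<and> length v = n \<and> foldr (mult G) v \<one> = g", OF this]
  show ?thesis using that unfolding word_length_def by blast
qed

lemma word_length_mult:
  assumes S: "sym_generating_set G S" and gh: "g \<in> carrier G" "h \<in> carrier G"
  shows "word_length G S (g \<otimes> h) \<le> word_length G S g + word_length G S h"
proof -
  obtain u w where "set u \<subseteq> S" "length u = word_length G S g" "foldr (mult G) u \<one> = g"
    "set w \<subseteq> S" "length w = word_length G S h" "foldr (mult G) w \<one> = h"
    using word_length_attained[OF S] gh by metis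
  moreover have "S \<subseteq> carrier G" using S by (simp add: sym_generating_set_def)
  ultimately show ?thesis using word_length_le[of "u @ w" S] foldr_mult_append[of u w] by auto
qed

lemma word_length_one: "word_length G S \<one> = 0"
  using word_length_le[of "[]" S] by simp

lemma word_length_gen: "s \<in> S \<Longrightarrow> s \<in> carrier G \<Longrightarrow> word_length G S s \<le> 1"
  using word_length_le[of "[s]" S] by simp

lemma word_length_comparable:
  assumes S: "sym_generating_set G S" and T: "sym_generating_set G T"
  obtains C :: nat where "\<And>g. g \<in> carrier G \<Longrightarrow> word_length G T g \<le> C * word_length G S g"
proof -
  have fin: "finite S" and sub: "S \<subseteq> carrier G" using S by (auto simp: sym_generating_set_def)
  define C where "C = (\<Sum>s\<in>S. word_length G T s)"
  have le: "word_length G T s \<le> C" if "s \<in> S" for s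
    unfolding C_def using fin that by (intro member_le_sum) auto
  have "word_length G T (foldr (mult G) w \<one>) \<le> C * length w" if "set w \<subseteq> S" for w
    using that
  proof (induction w)
    case Nil
    then show ?case by (simp add: word_length_one)
  next
    case (Cons s w)
    then have "s \<in> carrier G" "foldr (mult G) w \<one> \<in> carrier G"
      using sub foldr_mult_closed[of w] by auto
    then have "word_length G T (foldr (mult G) (s # w) \<one>) \<le> word_length G T s + word_length G T (foldr (mult G) w \<one>)"
      using word_length_mult[OF T] by simp
    then show ?case using Cons le[of s] by simp
  qed
  then show ?thesis using word_length_attained[OF S] that by metis
qed

end

lemma Lp_compression_exponent_mono:
  fixes G :: "('a, 'b) monoid_scheme"
  assumes "group G" and S: "sym_generating_set G S" and T: "sym_generating_set G T"
  shows "Lp_compression_exponent p G S \<le> Lp_compression_exponent p G T"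
proof -
  interpret group G by fact
  obtain C where C: "\<And>g. g \<in> carrier G \<Longrightarrow> word_length G T g \<le> C * word_length G S g"
    using word_length_comparable[OF S T] by blast
  obtain C' where C': "\<And>g. g \<in> carrier G \<Longrightarrow> word_length G S g \<le> C' * word_length G T g"
    using word_length_comparable[OF T S] by blast
  show ?thesis
    unfolding Lp_compression_exponent_def
  proof (rule Sup_subset_mono, safe, goal_cases)
    case (1 _ \<alpha> f c)
    obtain L where L: "\<forall>x\<in>carrier G. \<forall>y\<in>carrier G. Lp_norm p (\<lambda>t. f x t - f y t) \<le> L * real (word_dist G S x y)"
      using 1(2) unfolding Lp_Lipschitz_def by blast
    have "Lp_Lipschitz G T p f"
      unfolding Lp_Lipschitz_def
    proof (intro conjI exI[of _ "\<bar>L\<bar> * C'"] ballI)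
      show "f x \<in> Lp_fun p" if "x \<in> carrier G" for x using 1(2) that unfolding Lp_Lipschitz_def by blast
      show "Lp_norm p (\<lambda>t. f x t - f y t) \<le> \<bar>L\<bar> * C' * real (word_dist G T x y)"
        if "x \<in> carrier G" "y \<in> carrier G" for x y
      proof -
        have "Lp_norm p (\<lambda>t. f x t - f y t) \<le> L * real (word_dist G S x y)" using L that by blast
        also have "\<dots> \<le> \<bar>L\<bar> * real (word_dist G S x y)" by (intro mult_right_mono) auto
        also have "\<dots> \<le> \<bar>L\<bar> * real (C' * word_dist G T x y)"
          using C'[of "inv\<^bsub>G\<^esub> x \<otimes>\<^bsub>G\<^esub> y"] that by (intro mult_left_mono of_nat_mono) (auto simp: word_dist_def)
        finally show ?thesis by (simp add: mult_ac)
      qed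
    qed
    moreover have "c / (real C + 1) powr \<alpha> > 0" using 1 by simp
    moreover have "c / (real C + 1) powr \<alpha> * real (word_dist G T x y) powr \<alpha> \<le> Lp_norm p (\<lambda>t. f x t - f y t)"
      if "x \<in> carrier G" "y \<in> carrier G" for x y
    proof -
      have "word_dist G T x y \<le> C * word_dist G S x y"
        using C[of "inv\<^bsub>G\<^esub> x \<otimes>\<^bsub>G\<^esub> y"] that by (simp add: word_dist_def)
      then have "real (word_dist G T x y) \<le> real (C * word_dist G S x y)" by (rule of_nat_mono)
      also have "\<dots> \<le> (real C + 1) * real (word_dist G S x y)" by (simp add: algebra_simps)
      finally have "real (word_dist G T x y) powr \<alpha> \<le> ((real C + 1) * real (word_dist G S x y)) powr \<alpha>"
        using 1 by (intro powr_mono2) auto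
      then have "c / (real C + 1) powr \<alpha> * real (word_dist G T x y) powr \<alpha>
        \<le> c / (real C + 1) powr \<alpha> * ((real C + 1) * real (word_dist G S x y)) powr \<alpha>"
        using 1 by (intro mult_left_mono) auto
      also have "\<dots> = c * real (word_dist G S x y) powr \<alpha>"
        by (simp add: powr_mult)
      also have "\<dots> \<le> Lp_norm p (\<lambda>t. f x t - f y t)" using 1 that by blast
      finally show ?thesis .
    qed
    ultimately show ?case using 1 by blast
  qed
qed

lemma Lp_compression_exponent_gen_indep:
  assumes "group G" "sym_generating_set G S" "sym_generating_set G T"
  shows "Lp_compression_exponent p G S = Lp_compression_exponent p G T"
  using Lp_compression_exponent_mono[OF assms] Lp_compression_exponent_mono[OF assms(1,3,2)] by (rule order.antisym)

section \<open>The chain inside the wreath product\<close>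

abbreviation wl :: "(int \<Rightarrow> int) \<times> int \<Rightarrow> nat" where
  "wl \<equiv> word_length Z_wr_Z Z_wr_Z_gens"

abbreviation wd :: "(int \<Rightarrow> int) \<times> int \<Rightarrow> (int \<Rightarrow> int) \<times> int \<Rightarrow> nat" where
  "wd \<equiv> word_dist Z_wr_Z Z_wr_Z_gens"

lemma Z_wr_Z_carrier: "(f, x) \<in> carrier Z_wr_Z \<longleftrightarrow> finite {z. f z \<noteq> 0}"
  by (simp add: Z_wr_Z_def)

lemma Z_wr_Z_mult: "(f, x) \<otimes>\<^bsub>Z_wr_Z\<^esub> (g, y) = (\<lambda>z. f z + g (z - x), x + y)"
  by (simp add: Z_wr_Z_def)

lemma Z_wr_Z_one: "\<one>\<^bsub>Z_wr_Z\<^esub> = (\<lambda>z. 0, 0)"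
  by (simp add: Z_wr_Z_def)

lemma Z_wr_Z_inv:
  assumes "finite {z. f z \<noteq> 0}"
  shows "inv\<^bsub>Z_wr_Z\<^esub> (f, x) = (\<lambda>z. - f (z + x), - x)"
proof -
  interpret group Z_wr_Z by (rule group_Z_wr_Z)
  show ?thesis
    using assms finite_support_shift[OF assms, of x]
    by (intro inv_equality) (auto simp: Z_wr_Z_carrier Z_wr_Z_mult Z_wr_Z_one)
qed

lemma wd_eq:
  assumes "finite {z. f z \<noteq> 0}"
  shows "wd (f, x) (g, y) = wl (\<lambda>z. g (z + x) - f (z + x), y - x)"
  by (simp add: word_dist_def Z_wr_Z_inv[OF assms] Z_wr_Z_mult)

lemma wl_mult:
  "g \<in> carrier Z_wr_Z \<Longrightarrow> h \<in> carrier Z_wr_Z \<Longrightarrow> wl (g \<otimes>\<^bsub>Z_wr_Z\<^esub> h) \<le> wl g + wl h"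
  by (rule group.word_length_mult[OF group_Z_wr_Z sym_generating_set_Z_wr_Z_gens])

lemma wl_gen: "s \<in> Z_wr_Z_gens \<Longrightarrow> wl s \<le> 1"
  by (rule group.word_length_gen[OF group_Z_wr_Z _ Z_wr_Z_gens_closed(1)])

lemma wl_one: "wl (\<lambda>z. 0, 0) = 0"
  using group.word_length_one[OF group_Z_wr_Z] by (simp add: Z_wr_Z_one)

lemma wl_step:
  assumes "g \<in> carrier Z_wr_Z" "s \<in> Z_wr_Z_gens"
  shows "wl (g \<otimes>\<^bsub>Z_wr_Z\<^esub> s) \<le> wl g + 1"
  using wl_mult[OF assms(1) Z_wr_Z_gens_closed(1)[OF assms(2)]] wl_gen[OF assms(2)] by simp

lemma wl_shift: "wl (\<lambda>z. 0, k) \<le> nat \<bar>k\<bar>"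
proof (induction k rule: int_induct[where k = 0])
  case base
  show ?case by (simp add: wl_one)
next
  case (step1 i)
  then show ?case
    using wl_step[of "(\<lambda>z. 0, i)" "(\<lambda>z. 0, 1)"] by (simp add: Z_wr_Z_carrier Z_wr_Z_mult Z_wr_Z_gens_def)
next
  case (step2 i)
  then show ?case
    using wl_step[of "(\<lambda>z. 0, i)" "(\<lambda>z. 0, -1)"] by (simp add: Z_wr_Z_carrier Z_wr_Z_mult Z_wr_Z_gens_def)
qed

lemma finite_lamp_support: "finite {z :: int. (if z = 0 then k else 0 :: int) \<noteq> 0}"
  by (rule finite_subset[of _ "{0}"]) auto

lemma wl_lamp: "wl (\<lambda>z. if z = 0 then k else 0, 0) \<le> nat \<bar>k\<bar>"
proof (induction k rule: int_induct[where k = 0])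
  case base
  show ?case by (simp add: wl_one)
next
  case (step1 i)
  have "(\<lambda>z. (if z = 0 then i else 0) + (if z = 0 then 1 else 0)) = (\<lambda>z :: int. if z = 0 then i + 1 else 0)"
    by auto
  then show ?case
    using step1 wl_step[of "(\<lambda>z. if z = 0 then i else 0, 0)" "(\<lambda>z. if z = 0 then 1 else 0, 0)"]
    by (simp add: Z_wr_Z_carrier Z_wr_Z_mult Z_wr_Z_gens_def finite_lamp_support)
next
  case (step2 i)
  have "(\<lambda>z. (if z = 0 then i else 0) + (if z = 0 then -1 else 0)) = (\<lambda>z :: int. if z = 0 then i - 1 else 0)"
    by auto
  then show ?case
    using step2 wl_step[of "(\<lambda>z. if z = 0 then i else 0, 0)" "(\<lambda>z. if z = 0 then -1 else 0, 0)"]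
    by (simp add: Z_wr_Z_carrier Z_wr_Z_mult Z_wr_Z_gens_def finite_lamp_support)
qed

text \<open>
  A letter changes the lamps by a translation or by one unit at one site. The window is arbitrary, so
  that translations can be absorbed into it.
\<close>
lemma window_le_length:
  assumes "set w \<subseteq> Z_wr_Z_gens" "finite Z"
  shows "(\<Sum>z\<in>Z. \<bar>fst (foldr (mult Z_wr_Z) w \<one>\<^bsub>Z_wr_Z\<^esub>) z\<bar>) \<le> int (length w)"
  using assms
proof (induction w arbitrary: Z)
  case Nil
  then show ?case by (simp add: Z_wr_Z_one)
next
  case (Cons s w)
  obtain f x where fx: "foldr (mult Z_wr_Z) w \<one>\<^bsub>Z_wr_Z\<^esub> = (f, x)" by fastforce
  have IH: "(\<Sum>z\<in>Z. \<bar>f z\<bar>) \<le> int (length w)" if "finite Z" for Z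
    using Cons.IH[of Z] Cons.prems that by (simp add: fx)
  have shift: "(\<Sum>z\<in>Z. \<bar>f (z - c)\<bar>) \<le> int (length w)" for c
    using IH[of "(\<lambda>z. z - c) ` Z"] Cons.prems by (simp add: sum.reindex inj_on_def)
  have lamp: "(\<Sum>z\<in>Z. \<bar>(if z = 0 then c else 0) + f z\<bar>) \<le> int (length w) + 1" if "\<bar>c\<bar> = 1" for c
  proof -
    have "(\<Sum>z\<in>Z. \<bar>(if z = 0 then c else 0) + f z\<bar>) \<le> (\<Sum>z\<in>Z. \<bar>f z\<bar> + (if z = 0 then 1 else 0))"
      using that by (intro sum_mono) auto
    also have "\<dots> \<le> (\<Sum>z\<in>Z. \<bar>f z\<bar>) + 1" using Cons.prems by (simp add: sum.distrib)
    finally show ?thesis using IH[of Z] Cons.prems by simp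
  qed
  have s: "s \<in> Z_wr_Z_gens" using Cons.prems by simp
  have "(\<Sum>z\<in>Z. \<bar>fst (s \<otimes>\<^bsub>Z_wr_Z\<^esub> (f, x)) z\<bar>) \<le> int (length w) + 1"
    using s unfolding Z_wr_Z_gens_def
    by (elim insertE emptyE) (use shift[of 1] shift[of "-1"] lamp[of 1] lamp[of "-1"] in \<open>simp_all add: Z_wr_Z_mult\<close>)
  then show ?case by (simp add: fx)
qed

lemma window_le_wl:
  assumes "(f, x) \<in> carrier Z_wr_Z" "finite Z"
  shows "(\<Sum>z\<in>Z. \<bar>f z\<bar>) \<le> int (wl (f, x))"
proof -
  obtain w where "set w \<subseteq> Z_wr_Z_gens" "length w = wl (f, x)" "foldr (mult Z_wr_Z) w \<one>\<^bsub>Z_wr_Z\<^esub> = (f, x)"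
    using group.word_length_attained[OF group_Z_wr_Z sym_generating_set_Z_wr_Z_gens assms(1)] by blast
  then show ?thesis using window_le_length[of w Z] assms(2) by simp
qed

definition embed :: "nat \<Rightarrow> nat set \<times> nat \<Rightarrow> (int \<Rightarrow> int) \<times> int" where
  "embed K = (\<lambda>(A, x). (\<lambda>z. if 0 \<le> z \<and> nat z \<in> A then int K else 0, int x))"

lemma embed_support: "finite A \<Longrightarrow> finite {z. (if 0 \<le> z \<and> nat z \<in> A then int K else 0) \<noteq> 0}"
  by (rule finite_subset[of _ "int ` A"]) (auto simp: image_iff intro!: bexI[of _ "nat _"])

lemma embed_carrier: "finite A \<Longrightarrow> embed K (A, x) \<in> carrier Z_wr_Z"
  using embed_support[of A K] by (simp add: embed_def Z_wr_Z_carrier)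

lemma wd_embed_move: "finite A \<Longrightarrow> real (wd (embed K (A, x)) (embed K (A, y))) \<le> \<bar>real x - real y\<bar>"
  using wl_shift[of "int y - int x"] by (simp add: embed_def wd_eq[OF embed_support])

lemma wd_embed_lamp:
  assumes "finite A" "A - {x} = B - {x}"
  shows "wd (embed K (A, x)) (embed K (B, x)) \<le> K"
proof -
  have iff: "i \<in> B \<longleftrightarrow> i \<in> A" if "i \<noteq> x" for i using assms(2) that by blast
  define c where "c = (if x \<in> B then int K else 0) - (if x \<in> A then int K else 0)"
  have "(\<lambda>z. (if 0 \<le> z + int x \<and> nat (z + int x) \<in> B then int K else 0) -
      (if 0 \<le> z + int x \<and> nat (z + int x) \<in> A then int K else 0)) = (\<lambda>z. if z = 0 then c else 0)"
  proof
    fix z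
    show "(if 0 \<le> z + int x \<and> nat (z + int x) \<in> B then int K else 0) -
      (if 0 \<le> z + int x \<and> nat (z + int x) \<in> A then int K else 0) = (if z = 0 then c else 0)"
    proof (cases "z = 0")
      case False
      then have "nat (z + int x) \<noteq> x \<or> \<not> 0 \<le> z + int x" by auto
      then show ?thesis using iff[of "nat (z + int x)"] False by auto
    qed (simp add: c_def)
  qed
  then have "wd (embed K (A, x)) (embed K (B, x)) = wl (\<lambda>z. if z = 0 then c else 0, 0)"
    using assms by (simp add: embed_def wd_eq[OF embed_support])
  also have "\<dots> \<le> nat \<bar>c\<bar>" by (rule wl_lamp)
  also have "\<dots> \<le> K" by (auto simp: c_def)
  finally show ?thesis .
qed

lemma wd_embed_ge:
  assumes "finite A" "finite B"
  shows "K * card (sym_diff A B) \<le> wd (embed K (A, x)) (embed K (B, y))"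
proof -
  define f where "f z = (if 0 \<le> z + int x \<and> nat (z + int x) \<in> B then int K else 0) -
      (if 0 \<le> z + int x \<and> nat (z + int x) \<in> A then int K else 0)" for z
  define Z where "Z = (\<lambda>i. int i - int x) ` sym_diff A B"
  have fin: "finite {z. f z \<noteq> 0}"
  proof (rule finite_subset)
    show "{z. f z \<noteq> 0} \<subseteq> (\<lambda>i. int i - int x) ` (A \<union> B)"
    proof
      fix z assume "z \<in> {z. f z \<noteq> 0}"
      then have "0 \<le> z + int x" "nat (z + int x) \<in> A \<union> B" by (auto simp: f_def split: if_splits)
      then show "z \<in> (\<lambda>i. int i - int x) ` (A \<union> B)" by (intro image_eqI[of _ _ "nat (z + int x)"]) auto
    qed
  qed (use assms in auto)
  have "(\<Sum>z\<in>Z. \<bar>f z\<bar>) = (\<Sum>i\<in>sym_diff A B. int K)"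
  proof -
    have "(\<Sum>z\<in>Z. \<bar>f z\<bar>) = (\<Sum>i\<in>sym_diff A B. \<bar>f (int i - int x)\<bar>)"
      unfolding Z_def by (subst sum.reindex) (auto simp: inj_on_def)
    also have "\<dots> = (\<Sum>i\<in>sym_diff A B. int K)" by (intro sum.cong refl) (auto simp: f_def)
    finally show ?thesis .
  qed
  moreover have "(\<Sum>z\<in>Z. \<bar>f z\<bar>) \<le> int (wl (f, int y - int x))"
    by (rule window_le_wl) (use fin assms in \<open>auto simp: Z_wr_Z_carrier Z_def\<close>)
  moreover have "wd (embed K (A, x)) (embed K (B, y)) = wl (f, int y - int x)"
    using assms by (simp add: embed_def wd_eq[OF embed_support] f_def[abs_def])
  ultimately have "int (K * card (sym_diff A B)) \<le> int (wd (embed K (A, x)) (embed K (B, y)))"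
    by (simp add: mult.commute)
  then show ?thesis by (simp only: of_nat_le_iff)
qed

text \<open>
  The parameters that make the chain as fast as its \<open>r\<close>-th moment permits: cursor jumps of length
  \<open>2 ^ j\<close> and lamp changes of size \<open>K\<close> occur at the rates that give each of these \<open>J + 1\<close> kinds of
  steps a contribution of at most \<open>1 / (J + 1)\<close> to that moment.
\<close>
locale tuned_chain =
  fixes J :: nat and r :: real
  assumes r: "1 \<le> r" "r \<le> 2"
begin

definition m :: real where "m = 2 ^ J"
definition K :: nat where "K = nat \<lceil>m powr ((r - 1) / r)\<rceil>"
definition n :: nat where "n = nat \<lceil>(real J + 1)\<^sup>2 * m powr r\<rceil>"

lemma m_ge: "1 \<le> m" by (simp add: m_def)

lemma K_ge: "m powr ((r - 1) / r) \<le> real K" "1 \<le> K"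
  and K_le: "real K \<le> 2 * m powr ((r - 1) / r)" "real K \<le> 2 * m"
proof -
  have 1: "1 \<le> m powr ((r - 1) / r)" using m_ge r by (intro ge_one_powr_ge_zero) auto
  show a: "m powr ((r - 1) / r) \<le> real K" unfolding K_def by linarith
  then show "1 \<le> K" using 1 by linarith
  show b: "real K \<le> 2 * m powr ((r - 1) / r)" unfolding K_def using 1 by linarith
  have "m powr ((r - 1) / r) \<le> m powr 1" using m_ge r by (intro powr_mono) (auto simp: field_simps)
  then show "real K \<le> 2 * m" using b m_ge by simp
qed

lemma n_ge: "(real J + 1)\<^sup>2 * m powr r \<le> real n" "1 \<le> n"
  and n_le: "real n \<le> 2 * ((real J + 1)\<^sup>2 * m powr r)"
proof -
  have 1: "1 * 1 \<le> (real J + 1)\<^sup>2 * m powr r"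
    using m_ge r by (intro mult_mono ge_one_powr_ge_zero) auto
  show a: "(real J + 1)\<^sup>2 * m powr r \<le> real n" unfolding n_def by linarith
  then show "1 \<le> n" using 1 by linarith
  show "real n \<le> 2 * ((real J + 1)\<^sup>2 * m powr r)" unfolding n_def using 1 by linarith
qed

definition rate :: "nat \<Rightarrow> real" where "rate j = 2 powr (- (real j * r)) / (real J + 1)"
definition lrate :: real where "lrate = real K powr (- r) / (real J + 1)"

sublocale dyadic_chain J rate lrate
proof
  show "0 < rate j" for j by (simp add: rate_def)
  show "0 < lrate" using K_ge by (simp add: lrate_def)
  have "rate j \<le> 1 / (real J + 1)" for j
    unfolding rate_def using r powr_mono[of "- (real j * r)" 0 "2 :: real"] by (intro divide_right_mono) auto
  then have "(\<Sum>j=1..J. rate j) \<le> (\<Sum>j=1..J. 1 / (real J + 1))" by (intro sum_mono)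
  moreover have "lrate \<le> 1 / (real J + 1)"
    unfolding lrate_def using r K_ge powr_mono[of "- r" 0 "real K"] by (intro divide_right_mono) auto
  ultimately have "(\<Sum>j=1..J. rate j) + lrate \<le> real J / (real J + 1) + 1 / (real J + 1)" by simp
  also have "\<dots> = 1" by (simp add: field_simps)
  finally show "(\<Sum>j=1..J. rate j) + lrate \<le> 1" .
qed

lemma green_bound_le: "green_bound \<le> 4 * (real J + 1)\<^sup>2 * m powr (r - 1)"
proof -
  have "1 / (2 ^ j * coarse_rate j) \<le> (real J + 1) * (4 * m powr (r - 1))" if j: "j < J" for j
  proof -
    have "rate (Suc j) \<le> coarse_rate j"
      unfolding coarse_rate_def using j a_pos by (intro member_le_sum) (auto simp: less_imp_le)
    then have "1 / (2 ^ j * coarse_rate j) \<le> 1 / (2 ^ j * rate (Suc j))"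
      using a_pos[of "Suc j"] by (intro divide_left_mono mult_left_mono mult_pos_pos) auto
    also have "\<dots> = (real J + 1) * 2 powr (real (Suc j) * r - real j)"
      by (simp add: rate_def powr_diff powr_minus powr_realpow field_simps powr_add)
    also have "\<dots> \<le> (real J + 1) * 2 powr (2 + real J * (r - 1))"
    proof (intro mult_left_mono powr_mono)
      have "real j * (r - 1) \<le> real J * (r - 1)" using j r by (intro mult_right_mono) auto
      then show "real (Suc j) * r - real j \<le> 2 + real J * (r - 1)" using r by (simp add: algebra_simps)
    qed auto
    also have "2 powr (2 + real J * (r - 1)) = 4 * m powr (r - 1)"
      by (simp add: powr_add m_def powr_powr flip: powr_realpow)
    finally show ?thesis .
  qed
  then have "green_bound \<le> (\<Sum>j<J. (real J + 1) * (4 * m powr (r - 1)))"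
    unfolding green_bound_def by (intro sum_mono) auto
  also have "\<dots> \<le> (real J + 1) * ((real J + 1) * (4 * m powr (r - 1)))"
    by (simp add: mult_right_mono)
  finally show ?thesis by (simp only: power2_eq_square mult_ac)
qed

text \<open>
  With \<open>t\<close> the mean number of times that a given lamp is resampled, the return bound \<open>green_bound\<close> costs at
  most another \<open>4 * t\<close>, so the probability of a resampling is at least \<open>t / (1 + 5 * t)\<close>; and \<open>t\<close> is bounded
  below.
\<close>
lemma sum_displacement_ge:
  "real (card states) * (m / 18)
    \<le> (\<Sum>l\<in>paths states (2 * n + 1). path_weight kernel l * real (card (sym_diff (fst (hd l)) (fst (last l)))))"
proof -
  define N where "N = 2 * n"
  define t where "t = real N * lrate / m"
  have m0: "0 < m" using m_ge by simp
  have l0: "0 < lrate" by (rule b_pos)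
  have mr: "m powr r = m * m powr (r - 1)" using m0 by (simp add: powr_diff)
  have t: "1 / 4 \<le> t"
  proof -
    have Kr: "real K powr r \<le> 4 * m powr (r - 1)"
    proof -
      have "real K powr r \<le> (2 * m powr ((r - 1) / r)) powr r"
        using K_le r by (intro powr_mono2) auto
      also have "\<dots> = 2 powr r * m powr (r - 1)" using r m0 by (simp add: powr_mult powr_powr)
      also have "2 powr r \<le> (2 :: real) powr 2" using r by (intro powr_mono) auto
      finally show ?thesis using m0 by (simp add: mult_right_mono)
    qed
    have K0: "0 < real K powr r" using K_ge by simp
    have J1: "real J + 1 \<le> (real J + 1)\<^sup>2" by (simp add: power2_eq_square)
    have "real K powr r * (real J + 1) \<le> 4 * m powr (r - 1) * (real J + 1)\<^sup>2"
      using Kr J1 by (intro mult_mono) auto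
    then have "m * (real K powr r * (real J + 1)) \<le> 4 * ((real J + 1)\<^sup>2 * m powr r)"
      unfolding mr using m0 by (simp add: mult_ac)
    also have "\<dots> \<le> 4 * real n" using n_ge by simp
    finally have "m * (real K powr r * (real J + 1)) \<le> 4 * real N" by (simp add: N_def)
    moreover have "t = real N / (m * (real K powr r * (real J + 1)))"
      unfolding t_def lrate_def using m0 by (simp add: powr_minus divide_simps)
    moreover have "0 < m * (real K powr r * (real J + 1))" using m0 K0 by simp
    ultimately show ?thesis by (simp only: le_divide_eq) simp
  qed
  have "lrate * (2 * green_bound) \<le> 4 * t"
  proof -
    have "green_bound * m \<le> 4 * (real J + 1)\<^sup>2 * m powr (r - 1) * m"
      using green_bound_le m0 by (intro mult_right_mono) auto
    also have "\<dots> = 4 * ((real J + 1)\<^sup>2 * m powr r)" by (simp add: mr)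
    also have "\<dots> \<le> 4 * real n" using n_ge by simp
    finally have "2 * green_bound * m \<le> 4 * real N" by (simp add: N_def mult_ac)
    then have "2 * green_bound \<le> 4 * (real N / m)" using m0 by (simp add: field_simps)
    then have "lrate * (2 * green_bound) \<le> lrate * (4 * (real N / m))" using l0 by (intro mult_left_mono) auto
    then show ?thesis by (simp add: t_def mult_ac)
  qed
  moreover have "lrate * (real N / 2 ^ J) = t" by (simp add: t_def m_def)
  ultimately have den: "1 + lrate * (real N / 2 ^ J + 2 * green_bound) \<le> 1 + 5 * t" by (simp add: distrib_left)
  have green_bound0: "0 \<le> green_bound" using abs_potential[of 0 0] by linarith
  have "m / 18 \<le> m * (t / (2 * (1 + 5 * t)))"
  proof -
    have "1 / 18 \<le> t / (2 * (1 + 5 * t))" using t by (simp add: field_simps)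
    then have "m * (1 / 18) \<le> m * (t / (2 * (1 + 5 * t)))" using m0 by (intro mult_left_mono) auto
    then show ?thesis by simp
  qed
  also have "\<dots> = real N * lrate / (2 * (1 + 5 * t))" using m0 by (simp add: t_def)
  also have "\<dots> \<le> real N * lrate / (2 * (1 + lrate * (real N / 2 ^ J + 2 * green_bound)))"
    using den l0 green_bound0 t by (intro divide_left_mono mult_left_mono mult_pos_pos add_pos_nonneg mult_nonneg_nonneg add_nonneg_nonneg) auto
  finally have "real (card states) * (m / 18) \<le> real (card states) * (real N * lrate / (2 * (1 + lrate * (real N / 2 ^ J + 2 * green_bound))))"
    by (intro mult_left_mono) auto
  also have "\<dots> \<le> (\<Sum>l\<in>paths states (Suc N). path_weight kernel l * real (card (sym_diff (fst (hd l)) (fst (last l)))))"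
    unfolding card_states by (rule sum_displacement)
  finally show ?thesis by (simp add: N_def)
qed

abbreviation state_dist :: "nat set \<times> nat \<Rightarrow> nat set \<times> nat \<Rightarrow> real" where
  "state_dist s t \<equiv> real (wd (embed K s) (embed K t))"

text \<open>
  For \<open>q = r\<close> the right hand side is \<open>1\<close>. The case \<open>q = p > 2 = r\<close> is the one in which it grows with \<open>m\<close>.
\<close>
lemma step_moment_le:
  assumes q: "r \<le> q" and s: "s \<in> states"
  shows "(\<Sum>t\<in>states. kernel s t * state_dist s t powr q) \<le> (2 * m) powr (q - r)"
proof -
  obtain A x where sAx: "s = (A, x)" by fastforce
  have A: "finite A" using s finite_subset by (auto simp: sAx states_def)
  let ?B = "(2 * m) powr (q - r)"
  let ?D = "real J + 1"
  have q0: "0 < q" using q r by linarith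
  have move: "rate j * ((\<Sum>y\<in>block j x. state_dist s (A, y) powr q) / 2 ^ j) \<le> ?B / ?D" if j: "j \<in> {1..J}" for j
  proof -
    have "state_dist s (A, y) powr q \<le> (2 ^ j) powr q" if "y \<in> block j x" for y
    proof (rule powr_mono2)
      show "state_dist s (A, y) \<le> 2 ^ j"
        using wd_embed_move[OF A, of K x y] block_dist[OF that] unfolding sAx by linarith
    qed (use q0 in auto)
    then have "(\<Sum>y\<in>block j x. state_dist s (A, y) powr q) \<le> (\<Sum>y\<in>block j x. (2 ^ j) powr q)" by (rule sum_mono)
    then have "(\<Sum>y\<in>block j x. state_dist s (A, y) powr q) / 2 ^ j \<le> (2 ^ j) powr q" by (simp add: field_simps)
    then have "rate j * ((\<Sum>y\<in>block j x. state_dist s (A, y) powr q) / 2 ^ j) \<le> rate j * (2 ^ j) powr q"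
      using a_pos[of j] by (intro mult_left_mono) auto
    also have "\<dots> = (2 ^ j) powr (q - r) / ?D"
      by (simp add: rate_def powr_powr powr_diff powr_minus field_simps flip: powr_realpow)
    also have "\<dots> \<le> ?B / ?D"
    proof (intro divide_right_mono powr_mono2)
      have "(2 :: real) ^ j \<le> m" unfolding m_def using j by (intro power_increasing) auto
      then show "2 ^ j \<le> 2 * m" using m_ge by linarith
    qed (use q in auto)
    finally show ?thesis .
  qed
  have lamp: "lrate / 2 * (state_dist s (insert x A, x) powr q + state_dist s (A - {x}, x) powr q) \<le> ?B / ?D"
  proof -
    have K0: "0 < real K" using K_ge by simp
    have "state_dist s (insert x A, x) powr q \<le> real K powr q" "state_dist s (A - {x}, x) powr q \<le> real K powr q"
      using q0 wd_embed_lamp[OF A, of x "insert x A" K] wd_embed_lamp[OF A, of x "A - {x}" K]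
      by (auto simp: sAx intro!: powr_mono2)
    then have "lrate / 2 * (state_dist s (insert x A, x) powr q + state_dist s (A - {x}, x) powr q)
      \<le> lrate / 2 * (real K powr q + real K powr q)"
      using b_pos by (intro mult_left_mono add_mono) auto
    also have "\<dots> = lrate * real K powr q" by simp
    also have "\<dots> = real K powr (q - r) / ?D" using K0 by (simp add: lrate_def powr_diff powr_minus field_simps)
    also have "\<dots> \<le> ?B / ?D" using K_le q by (intro divide_right_mono powr_mono2) auto
    finally show ?thesis .
  qed
  have self: "state_dist s s = 0" using wd_embed_move[OF A, of K x x] by (simp add: sAx)
  have "(\<Sum>t\<in>states. kernel s t * state_dist s t powr q) = chain_step (\<lambda>t. state_dist s t powr q) s" by (rule sum_kernel[OF s])
  also have "\<dots> = (\<Sum>j=1..J. rate j * ((\<Sum>y\<in>block j x. state_dist s (A, y) powr q) / 2 ^ j))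
     + lrate / 2 * (state_dist s (insert x A, x) powr q + state_dist s (A - {x}, x) powr q)"
    using self by (simp add: chain_step_def sAx)
  also have "\<dots> \<le> (\<Sum>j=1..J. ?B / ?D) + ?B / ?D"
    by (intro add_mono sum_mono move lamp)
  also have "\<dots> = ?D * (?B / ?D)" by (simp add: distrib_right add_divide_distrib)
  also have "\<dots> = ?B" by simp
  finally show ?thesis .
qed

end

section \<open>The upper bound for the exponent\<close>

context tuned_chain begin

interpretation chain: sym_chain states kernel by (rule sym_chain_kernel)

lemma finite_lit: "s \<in> states \<Longrightarrow> finite (fst s)"
  using finite_subset[of "fst s" "{..<2 ^ J}"] by (auto simp: states_def)

lemma embed_states: "s \<in> states \<Longrightarrow> embed K s \<in> carrier Z_wr_Z"
  using embed_carrier[of "fst s" K "snd s"] finite_lit by simp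

text \<open>
  Jensen's inequality again, from the tangent at \<open>K * m / 18\<close>; here only a lower bound of the mean is
  known.
\<close>
lemma Lp_displacement_ge:
  assumes \<beta>: "1 \<le> \<beta>"
  shows "real (card states) * (real K * m / 18) powr \<beta>
    \<le> (\<Sum>l\<in>paths states (2 * n + 1). path_weight kernel l * state_dist (hd l) (last l) powr \<beta>)"
proof -
  define \<mu> where "\<mu> = real K * m / 18"
  define X where "X l = real K * real (card (sym_diff (fst (hd l)) (fst (last l))))" for l :: "(nat set \<times> nat) list"
  let ?P = "paths states (2 * n + 1)"
  have \<mu>0: "0 \<le> \<mu>" using m_ge by (simp add: \<mu>_def)
  have total: "(\<Sum>l\<in>?P. path_weight kernel l) = real (card states)"
    using chain.sum_paths_hd[of "\<lambda>_. 1" "2 * n"] by simp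
  have mean: "real (card states) * \<mu> \<le> (\<Sum>l\<in>?P. path_weight kernel l * X l)"
  proof -
    have "real (card states) * \<mu> = real K * (real (card states) * (m / 18))" by (simp add: \<mu>_def)
    also have "\<dots> \<le> real K * (\<Sum>l\<in>?P. path_weight kernel l * real (card (sym_diff (fst (hd l)) (fst (last l)))))"
      by (intro mult_left_mono sum_displacement_ge) auto
    finally show ?thesis by (simp add: X_def sum_distrib_left mult_ac)
  qed
  have "real (card states) * \<mu> powr \<beta>
     \<le> real (card states) * \<mu> powr \<beta> + \<beta> * \<mu> powr (\<beta> - 1) * ((\<Sum>l\<in>?P. path_weight kernel l * X l) - real (card states) * \<mu>)"
    using mean \<beta> by simp
  also have "\<dots> = (\<Sum>l\<in>?P. path_weight kernel l * (\<mu> powr \<beta> + \<beta> * \<mu> powr (\<beta> - 1) * (X l - \<mu>)))"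
    unfolding total[symmetric]
    by (simp add: algebra_simps sum.distrib sum_distrib_left sum_distrib_right sum_subtractf)
  also have "\<dots> \<le> (\<Sum>l\<in>?P. path_weight kernel l * state_dist (hd l) (last l) powr \<beta>)"
  proof (intro sum_mono mult_left_mono)
    fix l assume l: "l \<in> ?P"
    have "hd l \<in> states" "last l \<in> states" using l hd_paths[of l states "2 * n"] by (auto simp: paths_def)
    then have fin: "finite (fst (hd l))" "finite (fst (last l))"
      by (simp_all add: finite_lit)
    have "X l = real (K * card (sym_diff (fst (hd l)) (fst (last l))))" by (simp add: X_def)
    also have "\<dots> \<le> state_dist (hd l) (last l)"
      using wd_embed_ge[OF fin, of K "snd (hd l)" "snd (last l)"] by (intro of_nat_mono) simp
    finally have "X l \<le> state_dist (hd l) (last l)" .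
    then have "X l powr \<beta> \<le> state_dist (hd l) (last l) powr \<beta>" using \<beta> by (intro powr_mono2) (auto simp: X_def)
    moreover have "\<mu> powr \<beta> + \<beta> * \<mu> powr (\<beta> - 1) * (X l - \<mu>) \<le> X l powr \<beta>"
      using \<beta> \<mu>0 by (intro powr_above_tangent) (auto simp: X_def)
    ultimately show "\<mu> powr \<beta> + \<beta> * \<mu> powr (\<beta> - 1) * (X l - \<mu>) \<le> state_dist (hd l) (last l) powr \<beta>" by linarith
    show "0 \<le> path_weight kernel l" using l by (rule chain.weight_nonneg)
  qed
  finally show ?thesis by (simp add: \<mu>_def)
qed

text \<open>
  For \<open>p > 2\<close> the mean square of the step length is bounded uniformly in \<open>J\<close>, although its \<open>p\<close>-th moment is not. The
  added \<open>1\<close> keeps the weight positive on steps of length \<open>0\<close>.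
\<close>
definition step_weight :: "real \<Rightarrow> nat set \<times> nat \<Rightarrow> nat set \<times> nat \<Rightarrow> real" where
  "step_weight p s t = (if p \<le> 2 then 1 else (state_dist s t)\<^sup>2 + 1) / (2 * real n)"

lemma step_weight_budget:
  assumes "r = min p 2" "s \<in> states"
  shows "real n * (\<Sum>t\<in>states. kernel s t * step_weight p s t) \<le> 1"
proof (cases "p \<le> 2")
  case True
  then show ?thesis using n_ge chain.k_row[OF assms(2)]
    by (simp add: step_weight_def flip: sum_divide_distrib)
next
  case False
  then have "r = 2" using assms by simp
  then have "(\<Sum>t\<in>states. kernel s t * (state_dist s t)\<^sup>2) \<le> 1" using step_moment_le[of 2 s] assms m_ge by (simp add: powr_numeral)
  moreover have "real n * (\<Sum>t\<in>states. kernel s t * step_weight p s t)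
     = ((\<Sum>t\<in>states. kernel s t * (state_dist s t)\<^sup>2) + (\<Sum>t\<in>states. kernel s t)) / 2"
  proof -
    have "real n * (kernel s t * step_weight p s t) = (kernel s t * (state_dist s t)\<^sup>2 + kernel s t) / 2" for t
      using False n_ge by (simp add: step_weight_def field_simps)
    then show ?thesis unfolding sum_distrib_left by (simp only:) (simp add: sum.distrib flip: sum_divide_distrib)
  qed
  ultimately show ?thesis using chain.k_row[OF assms(2)] by simp
qed

lemma weighted_moment:
  assumes p: "1 \<le> p" and r': "r = min p 2" and s: "s \<in> states"
  shows "(\<Sum>t\<in>states. kernel s t * ((1 + step_weight p s t powr (1 - max p 2 / 2)) * state_dist s t powr p))
     \<le> 2 * (4 * real n) powr (max p 2 / 2 - 1)"
proof (cases "p \<le> 2")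
  case True
  then have "r = p" using r' by simp
  have "step_weight p s t powr 0 = 1" for t using n_ge True by (simp add: step_weight_def)
  then show ?thesis
    using True step_moment_le[of p s] \<open>r = p\<close> s m_ge n_ge by (simp add: max_def mult.left_commute flip: sum_distrib_left)
next
  case False
  then have r2: "r = 2" using r' by simp
  have n0: "1 \<le> real n" using n_ge by simp
  define h where "h = p / 2 - 1"
  have h: "0 \<le> h" using False by (simp add: h_def)
  have "step_weight p s t powr (- h) * state_dist s t powr p \<le> (2 * real n) powr h * state_dist s t powr 2" for t
  proof (cases "state_dist s t = 0")
    case c: False
    define d where "d = state_dist s t"
    have d: "0 < d" using c by (simp add: d_def)
    have "step_weight p s t powr (- h) = (2 * real n) powr h * (d\<^sup>2 + 1) powr (- h)"
      using False n0 by (simp add: step_weight_def d_def powr_divide powr_minus divide_simps)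
    also have "\<dots> \<le> (2 * real n) powr h * (d\<^sup>2) powr (- h)"
      using d h by (intro mult_left_mono powr_mono2') auto
    also have "(d\<^sup>2) powr (- h) = d powr (2 - p)"
    proof -
      have "(d\<^sup>2) powr (- h) = (d powr 2) powr (- h)" using d by (simp add: powr_numeral)
      then show ?thesis by (simp add: powr_powr h_def algebra_simps)
    qed
    finally have "step_weight p s t powr (- h) * d powr p \<le> (2 * real n) powr h * d powr (2 - p) * d powr p"
      by (intro mult_right_mono) auto
    also have "\<dots> = (2 * real n) powr h * d powr 2" by (simp add: mult.assoc flip: powr_add)
    finally show ?thesis by (simp add: d_def)
  qed auto
  then have "(\<Sum>t\<in>states. kernel s t * (step_weight p s t powr (- h) * state_dist s t powr p))
    \<le> (\<Sum>t\<in>states. kernel s t * ((2 * real n) powr h * state_dist s t powr 2))"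
    by (intro sum_mono mult_left_mono kernel_nonneg)
  also have "\<dots> = (2 * real n) powr h * (\<Sum>t\<in>states. kernel s t * state_dist s t powr 2)"
    by (simp add: sum_distrib_left mult_ac)
  also have "\<dots> \<le> (2 * real n) powr h * 1"
    using step_moment_le[of 2 s] s r2 m_ge by (intro mult_left_mono) auto
  also have "\<dots> \<le> (4 * real n) powr h" using h n0 by (simp add: powr_mono2)
  finally have 1: "(\<Sum>t\<in>states. kernel s t * (step_weight p s t powr (- h) * state_dist s t powr p)) \<le> (4 * real n) powr h" .
  have "(\<Sum>t\<in>states. kernel s t * state_dist s t powr p) \<le> (2 * m) powr (p - 2)"
    using step_moment_le[of p s] s r2 False by simp
  also have "\<dots> = ((2 * m) powr 2) powr h" by (simp add: powr_powr h_def algebra_simps)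
  also have "\<dots> \<le> (4 * real n) powr h"
  proof (intro powr_mono2 h)
    have "1 * m powr 2 \<le> (real J + 1)\<^sup>2 * m powr r" unfolding r2 by (intro mult_right_mono) auto
    then have "m powr 2 \<le> real n" using n_ge by linarith
    then show "(2 * m) powr 2 \<le> 4 * real n" using m_ge by (simp add: powr_mult)
  qed auto
  finally have 2: "(\<Sum>t\<in>states. kernel s t * state_dist s t powr p) \<le> (4 * real n) powr h" .
  have "1 - max p 2 / 2 = - h" "max p 2 / 2 - 1 = h" using False by (auto simp: h_def)
  then show ?thesis using 1 2 by (simp only:) (simp add: distrib_right distrib_left sum.distrib)
qed

end

text \<open>
  Both sides of the real inequality are sums of p-th powers of differences, so it may be applied at each
  point of the unit interval and integrated.
\<close>
lemma Lp_markov_type: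
  fixes p :: real
  assumes p: "1 \<le> p"
  shows "\<exists>C\<ge>0. \<forall>(V :: 'v set) k n (F :: 'v \<Rightarrow> real \<Rightarrow> real) v. admissible n V k v \<longrightarrow> (\<forall>x\<in>V. F x \<in> Lp_fun p) \<longrightarrow>
      (\<Sum>l\<in>paths V (2 * n + 1). path_weight k l * Lp_norm p (\<lambda>t. F (last l) t - F (hd l) t) powr p)
       \<le> C * real n * (\<Sum>x\<in>V. \<Sum>y\<in>V. k x y * ((1 + v x y powr (1 - max p 2 / 2)) * Lp_norm p (\<lambda>t. F x t - F y t) powr p))"
proof -
  obtain C where C: "0 \<le> C" and
    real: "\<And>(V :: 'v set) k n f v. admissible n V k v \<Longrightarrow>
      (\<Sum>l\<in>paths V (2 * n + 1). path_weight k l * \<bar>f (last l) - f (hd l)\<bar> powr p)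
       \<le> C * real n * (\<Sum>x\<in>V. \<Sum>y\<in>V. k x y * ((1 + v x y powr (1 - max p 2 / 2)) * \<bar>f x - f y\<bar> powr p))"
    using real_markov_type[OF p, where 'v = 'v] by blast
  show ?thesis
  proof (intro exI[of _ C] conjI C allI impI)
    fix V :: "'v set" and k n and F :: "'v \<Rightarrow> real \<Rightarrow> real" and v
    assume adm: "admissible n V k v" and "\<forall>x\<in>V. F x \<in> Lp_fun p"
    then have F: "\<And>x. x \<in> V \<Longrightarrow> F x \<in> Lp_fun p" by blast
    let ?M = "lebesgue_on {0..1 :: real}"
    have int: "integrable ?M (\<lambda>t. \<bar>F x t - F y t\<bar> powr p)" if "x \<in> V" "y \<in> V" for x y
      using Lp_fun_diff[OF p F[OF that(1)] F[OF that(2)]] by (simp add: Lp_fun_def)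
    have hl: "hd l \<in> V" "last l \<in> V" if "l \<in> paths V (2 * n + 1)" for l
      using that hd_paths[of l V "2 * n"] by (auto simp: paths_def)
    have "(\<Sum>l\<in>paths V (2 * n + 1). path_weight k l * Lp_norm p (\<lambda>t. F (last l) t - F (hd l) t) powr p)
      = (LINT t|?M. (\<Sum>l\<in>paths V (2 * n + 1). path_weight k l * \<bar>F (last l) t - F (hd l) t\<bar> powr p))"
      using int hl by (simp add: Lp_norm_powr[OF p])
    also have "\<dots> \<le> (LINT t|?M. C * real n * (\<Sum>x\<in>V. \<Sum>y\<in>V. k x y * ((1 + v x y powr (1 - max p 2 / 2)) * \<bar>F x t - F y t\<bar> powr p)))"
      using int hl by (intro integral_mono Bochner_Integration.integrable_sum integrable_mult_right real[OF adm]) auto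
    also have "\<dots> = C * real n * (\<Sum>x\<in>V. \<Sum>y\<in>V. k x y * ((1 + v x y powr (1 - max p 2 / 2)) * Lp_norm p (\<lambda>t. F x t - F y t) powr p))"
      using int by (simp add: Lp_norm_powr[OF p] Bochner_Integration.integral_sum)
    finally show "(\<Sum>l\<in>paths V (2 * n + 1). path_weight k l * Lp_norm p (\<lambda>t. F (last l) t - F (hd l) t) powr p)
       \<le> C * real n * (\<Sum>x\<in>V. \<Sum>y\<in>V. k x y * ((1 + v x y powr (1 - max p 2 / 2)) * Lp_norm p (\<lambda>t. F x t - F y t) powr p))" .
  qed
qed

lemma exp_beats_poly:
  fixes \<gamma> e B :: real
  assumes "0 < \<gamma>"
  shows "\<exists>J :: nat. B * (real J + 1) powr e < (2 ^ J) powr \<gamma>"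
proof -
  have "((\<lambda>J. B * (real J + 1) powr e / 2 powr (\<gamma> * real J)) \<longlongrightarrow> 0) sequentially"
    using assms by real_asymp
  then have "eventually (\<lambda>J. B * (real J + 1) powr e / 2 powr (\<gamma> * real J) < 1) sequentially"
    by (rule order_tendstoD(2)) simp
  then obtain J where "B * (real J + 1) powr e / 2 powr (\<gamma> * real J) < 1"
    using eventually_happens'[OF sequentially_bot] by blast
  then have "B * (real J + 1) powr e < 2 powr (\<gamma> * real J)" by (simp add: field_simps)
  also have "\<dots> = (2 ^ J) powr \<gamma>" by (simp add: powr_powr mult.commute flip: powr_realpow)
  finally show ?thesis by blast
qed

text \<open>
  Were \<open>\<alpha>\<close> larger, \<open>(2 ^ J) powr \<gamma>\<close> with a positive \<open>\<gamma>\<close> would be bounded by a polynomial in \<open>J\<close>.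
\<close>
theorem compression_upper:
  assumes p: "1 \<le> p" and \<alpha>: "0 \<le> \<alpha>" and L: "Lp_Lipschitz Z_wr_Z Z_wr_Z_gens p f"
    and c: "0 < c" and lower: "\<And>x y. x \<in> carrier Z_wr_Z \<Longrightarrow> y \<in> carrier Z_wr_Z \<Longrightarrow>
       c * real (wd x y) powr \<alpha> \<le> Lp_norm p (\<lambda>t. f x t - f y t)"
  shows "\<alpha> \<le> min p 2 / (2 * min p 2 - 1)"
proof (rule ccontr)
  assume neg: "\<not> \<alpha> \<le> min p 2 / (2 * min p 2 - 1)"
  define r where "r = min p 2"
  have r: "1 \<le> r" "r \<le> 2" "r \<le> p" using p by (auto simp: r_def)
  have \<alpha>r: "r < \<alpha> * (2 * r - 1)" using neg r by (simp add: r_def[symmetric] not_le divide_less_eq)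
  have \<beta>: "1 \<le> \<alpha> * p"
  proof -
    have "2 * r - 1 \<le> r * r" using zero_le_square[of "r - 1"] by (simp add: algebra_simps)
    also have "r * r \<le> r * (\<alpha> * (2 * r - 1))" using \<alpha>r r by (intro mult_left_mono) auto
    finally have "1 * (2 * r - 1) \<le> (\<alpha> * r) * (2 * r - 1)" by (simp add: mult_ac)
    then have "1 \<le> \<alpha> * r" using r by (subst (asm) mult_le_cancel_right) auto
    also have "\<dots> \<le> \<alpha> * p" using r \<alpha> by (intro mult_left_mono) auto
    finally show ?thesis .
  qed
  obtain L where L0: "0 \<le> L" and L: "\<And>x y. x \<in> carrier Z_wr_Z \<Longrightarrow> y \<in> carrier Z_wr_Z \<Longrightarrow>
      Lp_norm p (\<lambda>t. f x t - f y t) \<le> L * real (wd x y)" and fLp: "\<And>x. x \<in> carrier Z_wr_Z \<Longrightarrow> f x \<in> Lp_fun p"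
  proof -
    obtain L where "\<And>x y. x \<in> carrier Z_wr_Z \<Longrightarrow> y \<in> carrier Z_wr_Z \<Longrightarrow> Lp_norm p (\<lambda>t. f x t - f y t) \<le> L * real (wd x y)"
      and "\<And>x. x \<in> carrier Z_wr_Z \<Longrightarrow> f x \<in> Lp_fun p"
      using L unfolding Lp_Lipschitz_def by blast
    moreover from this have "Lp_norm p (\<lambda>t. f x t - f y t) \<le> \<bar>L\<bar> * real (wd x y)"
      if "x \<in> carrier Z_wr_Z" "y \<in> carrier Z_wr_Z" for x y
      using that by (meson abs_ge_self mult_right_mono of_nat_0_le_iff order.trans)
    ultimately show ?thesis using that[of "\<bar>L\<bar>"] by auto
  qed
  obtain C where C: "0 \<le> C" and
    mt: "\<And>(V :: (nat set \<times> nat) set) k n (F :: _ \<Rightarrow> real \<Rightarrow> real) v. admissible n V k v \<Longrightarrow> \<forall>x\<in>V. F x \<in> Lp_fun p \<Longrightarrow>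
      (\<Sum>l\<in>paths V (2 * n + 1). path_weight k l * Lp_norm p (\<lambda>t. F (last l) t - F (hd l) t) powr p)
       \<le> C * real n * (\<Sum>x\<in>V. \<Sum>y\<in>V. k x y * ((1 + v x y powr (1 - max p 2 / 2)) * Lp_norm p (\<lambda>t. F x t - F y t) powr p))"
    using Lp_markov_type[OF p, where 'v = "nat set \<times> nat"] by blast
  define \<gamma> where "\<gamma> = p * (\<alpha> * (2 * r - 1) / r - 1)"
  have \<gamma>: "0 < \<gamma>" using \<alpha>r r p unfolding \<gamma>_def by (intro mult_pos_pos) (auto simp: field_simps)
  define B where "B = 18 powr (\<alpha> * p) / c powr p * (C * 2 * L powr p * 8 powr (p / r))"
  have key: "(2 ^ J) powr \<gamma> \<le> B * (real J + 1) powr (2 * p / r)" for J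
  proof -
    interpret tuned_chain J r using r by unfold_locales auto
    interpret chain: sym_chain states kernel by (rule sym_chain_kernel)
    let ?F = "\<lambda>s. f (embed K s)"
    let ?P = "paths states (2 * n + 1)"
    define q where "q = real (card states)"
    have q: "0 < q" unfolding q_def card_states by simp
    have n0: "1 \<le> real n" using n_ge by simp
    have m0: "0 < m" using m_ge by simp
    have "c powr p * (q * (real K * m / 18) powr (\<alpha> * p))
      \<le> c powr p * (\<Sum>l\<in>?P. path_weight kernel l * state_dist (hd l) (last l) powr (\<alpha> * p))"
      unfolding q_def by (intro mult_left_mono Lp_displacement_ge \<beta>) auto
    also have "\<dots> = (\<Sum>l\<in>?P. path_weight kernel l * (c * state_dist (hd l) (last l) powr \<alpha>) powr p)"
      using c by (simp add: powr_mult powr_powr sum_distrib_left mult_ac)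
    also have "\<dots> \<le> (\<Sum>l\<in>?P. path_weight kernel l * Lp_norm p (\<lambda>t. ?F (last l) t - ?F (hd l) t) powr p)"
    proof (intro sum_mono mult_left_mono powr_mono2)
      fix l assume l: "l \<in> ?P"
      then have "hd l \<in> states" "last l \<in> states" using hd_paths[of l states "2 * n"] by (auto simp: paths_def)
      then show "c * state_dist (hd l) (last l) powr \<alpha> \<le> Lp_norm p (\<lambda>t. ?F (last l) t - ?F (hd l) t)"
        using lower[of "embed K (hd l)" "embed K (last l)"] embed_states Lp_norm_minus[of p "?F (last l)"] by simp
      show "0 \<le> path_weight kernel l" using l by (rule chain.weight_nonneg)
    qed (use c p in auto)
    also have "\<dots> \<le> C * real n * (\<Sum>s\<in>states. \<Sum>t\<in>states. kernel s t * ((1 + step_weight p s t powr (1 - max p 2 / 2)) * Lp_norm p (\<lambda>u. ?F s u - ?F t u) powr p))"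
    proof (rule mt)
      have "0 < step_weight p s t" for s t using n0 by (auto simp: step_weight_def intro!: divide_pos_pos add_nonneg_pos)
      then show "admissible n states kernel (step_weight p)"
        using sym_chain_kernel step_weight_budget[OF r_def] by (simp add: admissible_def)
      show "\<forall>s\<in>states. ?F s \<in> Lp_fun p" using embed_states fLp by blast
    qed
    also have "\<dots> \<le> C * real n * (\<Sum>s\<in>states. L powr p * (2 * (4 * real n) powr (max p 2 / 2 - 1)))"
    proof (intro mult_left_mono sum_mono)
      fix s assume s: "s \<in> states"
      have "(\<Sum>t\<in>states. kernel s t * ((1 + step_weight p s t powr (1 - max p 2 / 2)) * Lp_norm p (\<lambda>u. ?F s u - ?F t u) powr p))
        \<le> (\<Sum>t\<in>states. kernel s t * ((1 + step_weight p s t powr (1 - max p 2 / 2)) * (L * state_dist s t) powr p))"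
        using L embed_states s p kernel_nonneg Lp_norm_nonneg
        by (intro sum_mono mult_left_mono powr_mono2) auto
      also have "\<dots> = L powr p * (\<Sum>t\<in>states. kernel s t * ((1 + step_weight p s t powr (1 - max p 2 / 2)) * state_dist s t powr p))"
        using L0 by (simp add: powr_mult sum_distrib_left mult_ac)
      also have "\<dots> \<le> L powr p * (2 * (4 * real n) powr (max p 2 / 2 - 1))"
        using weighted_moment[OF p r_def s] by (intro mult_left_mono) auto
      finally show "(\<Sum>t\<in>states. kernel s t * ((1 + step_weight p s t powr (1 - max p 2 / 2)) * Lp_norm p (\<lambda>u. ?F s u - ?F t u) powr p))
        \<le> L powr p * (2 * (4 * real n) powr (max p 2 / 2 - 1))" .
    qed (use C in auto)
    also have "\<dots> = q * (C * 2 * L powr p * (real n * (4 * real n) powr (max p 2 / 2 - 1)))"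
      by (simp add: q_def)
    finally have "q * (c powr p * (real K * m / 18) powr (\<alpha> * p))
        \<le> q * (C * 2 * L powr p * (real n * (4 * real n) powr (max p 2 / 2 - 1)))"
      by (simp only: mult.left_commute[of q])
    then have "c powr p * (real K * m / 18) powr (\<alpha> * p) \<le> C * 2 * L powr p * (real n * (4 * real n) powr (max p 2 / 2 - 1))"
      using q by (rule mult_left_le_imp_le)
    also have "\<dots> \<le> C * 2 * L powr p * (4 * real n) powr (p / r)"
    proof (intro mult_left_mono)
      have "p / r = 1 + (max p 2 / 2 - 1)" using p by (auto simp: r_def min_def max_def)
      then have "(4 * real n) powr (p / r) = 4 * real n * (4 * real n) powr (max p 2 / 2 - 1)"
        using n0 by (simp only: powr_add) simp
      then show "real n * (4 * real n) powr (max p 2 / 2 - 1) \<le> (4 * real n) powr (p / r)"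
        by (simp add: mult_right_mono)
    qed (use C in auto)
    also have "\<dots> \<le> C * 2 * L powr p * (8 * ((real J + 1)\<^sup>2 * m powr r)) powr (p / r)"
    proof (intro mult_left_mono powr_mono2)
      show "4 * real n \<le> 8 * ((real J + 1)\<^sup>2 * m powr r)" using n_le by linarith
    qed (use p r C in auto)
    also have "\<dots> = (C * 2 * L powr p * 8 powr (p / r)) * (real J + 1) powr (2 * p / r) * m powr p"
    proof -
      have "(real J + 1)\<^sup>2 = (real J + 1) powr 2" by (simp add: powr_numeral)
      then have "((real J + 1)\<^sup>2) powr (p / r) = (real J + 1) powr (2 * p / r)"
        by (simp only: powr_powr times_divide_eq_right)
      then show ?thesis using m0 r by (simp add: powr_mult powr_powr)
    qed
    finally have 1: "c powr p * (real K * m / 18) powr (\<alpha> * p)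
       \<le> (C * 2 * L powr p * 8 powr (p / r)) * (real J + 1) powr (2 * p / r) * m powr p" .
    have "m powr ((2 * r - 1) / r) = m powr ((r - 1) / r) * m"
    proof -
      have "(2 * r - 1) / r = (r - 1) / r + 1" using r by (simp add: field_simps)
      then show ?thesis using m0 by (simp only: powr_add) simp
    qed
    also have "\<dots> \<le> real K * m" using K_ge m0 by (intro mult_right_mono) auto
    finally have "(m powr ((2 * r - 1) / r) / 18) powr (\<alpha> * p) \<le> (real K * m / 18) powr (\<alpha> * p)"
      using \<beta> by (intro powr_mono2 divide_right_mono) auto
    then have "c powr p * (m powr ((2 * r - 1) / r) / 18) powr (\<alpha> * p)
        \<le> (C * 2 * L powr p * 8 powr (p / r)) * (real J + 1) powr (2 * p / r) * m powr p"
      using 1 by (meson mult_left_mono order.trans powr_ge_zero)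
    moreover have "(m powr ((2 * r - 1) / r) / 18) powr (\<alpha> * p) = m powr \<gamma> * m powr p / 18 powr (\<alpha> * p)"
    proof -
      have "(2 * r - 1) / r * (\<alpha> * p) = \<gamma> + p" using r by (simp add: \<gamma>_def field_simps)
      then show ?thesis by (simp add: powr_divide powr_powr powr_add)
    qed
    ultimately have "m powr \<gamma> * (c powr p / 18 powr (\<alpha> * p)) * m powr p
        \<le> (C * 2 * L powr p * 8 powr (p / r)) * (real J + 1) powr (2 * p / r) * m powr p"
      by (simp add: mult_ac)
    then have "m powr \<gamma> * (c powr p / 18 powr (\<alpha> * p)) \<le> (C * 2 * L powr p * 8 powr (p / r)) * (real J + 1) powr (2 * p / r)"
      by (rule mult_right_le_imp_le) (use m0 in simp)
    then have "m powr \<gamma> \<le> B * (real J + 1) powr (2 * p / r)"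
      using c by (simp add: B_def field_simps)
    then show ?thesis by (simp add: m_def)
  qed
  obtain J where "B * (real J + 1) powr (2 * p / r) < (2 ^ J) powr \<gamma>" using exp_beats_poly[OF \<gamma>] by blast
  then show False using key[of J] by linarith
qed

section \<open>Distances realized in the space of p-integrable functions\<close>

text \<open>
  Borel functions on the whole line that vanish off the open unit interval: two of them can be rescaled and
  put side by side without meeting.
\<close>
definition unit_Lp :: "real \<Rightarrow> (real \<Rightarrow> real) set" where
  "unit_Lp p = {u. u \<in> borel_measurable borel \<and> (\<forall>t. t \<notin> {0<..<1} \<longrightarrow> u t = 0) \<and>
                   integrable lborel (\<lambda>t. \<bar>u t\<bar> powr p)}"

lemma unit_Lp_integral:
  assumes "u \<in> unit_Lp p"
  shows "u \<in> Lp_fun p" "(LINT t|lebesgue_on {0..1}. \<bar>u t\<bar> powr p) = (LINT t|lborel. \<bar>u t\<bar> powr p)"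
proof -
  have [measurable]: "u \<in> borel_measurable borel" and z: "\<And>t. t \<notin> {0<..<1} \<Longrightarrow> u t = 0"
    and int: "integrable lborel (\<lambda>t. \<bar>u t\<bar> powr p)"
    using assms by (auto simp: unit_Lp_def)
  have eq: "indicat_real {0..1} t *\<^sub>R (\<bar>u t\<bar> powr p) = \<bar>u t\<bar> powr p" for t
    using z[of t] by (cases "t \<in> {0<..<1}") (auto simp: indicator_def)
  have "integrable lebesgue (\<lambda>t. \<bar>u t\<bar> powr p)"
    using int by (subst integrable_completion) auto
  then have "integrable (lebesgue_on {0..1}) (\<lambda>t. \<bar>u t\<bar> powr p)"
    by (subst integrable_restrict_space) (simp_all only: eq, simp)
  moreover have "u \<in> borel_measurable (lebesgue_on {0..1})"
    by (intro measurable_restrict_space1 measurable_completion) simp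
  ultimately show "u \<in> Lp_fun p" by (simp add: Lp_fun_def)
  have "(LINT t|lebesgue_on {0..1}. \<bar>u t\<bar> powr p) = (LINT t|lebesgue. \<bar>u t\<bar> powr p)"
    by (subst integral_restrict_space) (simp_all only: eq, simp)
  also have "\<dots> = (LINT t|lborel. \<bar>u t\<bar> powr p)" by (rule integral_completion) simp
  finally show "(LINT t|lebesgue_on {0..1}. \<bar>u t\<bar> powr p) = (LINT t|lborel. \<bar>u t\<bar> powr p)" .
qed

text \<open>
  \<open>D\<close> records \<open>p\<close>-th powers of distances, since these add up when maps are glued.
\<close>
definition realizes :: "real \<Rightarrow> 'a set \<Rightarrow> ('a \<Rightarrow> real \<Rightarrow> real) \<Rightarrow> ('a \<Rightarrow> 'a \<Rightarrow> real) \<Rightarrow> bool" where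
  "realizes p X F D \<longleftrightarrow> (\<forall>x\<in>X. F x \<in> unit_Lp p) \<and>
     (\<forall>x\<in>X. \<forall>y\<in>X. (LINT t|lborel. \<bar>F x t - F y t\<bar> powr p) = D x y)"

lemma unit_Lp_diff:
  assumes p: "1 \<le> p" and u: "u \<in> unit_Lp p" and w: "w \<in> unit_Lp p"
  shows "(\<lambda>t. u t - w t) \<in> unit_Lp p"
proof -
  have [measurable]: "u \<in> borel_measurable borel" "w \<in> borel_measurable borel"
    using u w by (auto simp: unit_Lp_def)
  have "integrable lborel (\<lambda>t. \<bar>u t - w t\<bar> powr p)"
  proof (rule Bochner_Integration.integrable_bound)
    show "integrable lborel (\<lambda>t. 2 powr p * (\<bar>u t\<bar> powr p + \<bar>w t\<bar> powr p))"
      using u w by (auto simp: unit_Lp_def)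
    show "AE t in lborel. norm (\<bar>u t - w t\<bar> powr p) \<le> norm (2 powr p * (\<bar>u t\<bar> powr p + \<bar>w t\<bar> powr p))"
      using abs_diff_powr_le_2[of p] p by (intro always_eventually) auto
  qed measurable
  then show ?thesis using u w by (auto simp: unit_Lp_def)
qed

lemma realizes_Lp_norm:
  assumes p: "1 \<le> p" and F: "realizes p X F D" and "x \<in> X" "y \<in> X"
  shows "F x \<in> Lp_fun p" "Lp_norm p (\<lambda>t. F x t - F y t) = D x y powr (1 / p)" "0 \<le> D x y"
proof -
  have u: "F x \<in> unit_Lp p" "F y \<in> unit_Lp p" using F assms by (auto simp: realizes_def)
  show "F x \<in> Lp_fun p" using u(1) by (rule unit_Lp_integral)
  show "Lp_norm p (\<lambda>t. F x t - F y t) = D x y powr (1 / p)"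
    unfolding Lp_norm_def unit_Lp_integral(2)[OF unit_Lp_diff[OF p u]] using F assms by (simp add: realizes_def)
  have "D x y = (LINT t|lborel. \<bar>F x t - F y t\<bar> powr p)" using F assms by (simp add: realizes_def)
  then show "0 \<le> D x y" by simp
qed

lemma realizes_comp: "realizes p X F D \<Longrightarrow> \<phi> ` Y \<subseteq> X \<Longrightarrow> realizes p Y (\<lambda>y. F (\<phi> y)) (\<lambda>x y. D (\<phi> x) (\<phi> y))"
  unfolding realizes_def by (meson image_subset_iff)

lemma realizes_glue:
  assumes p: "1 \<le> p" and F1: "realizes p X F1 D1" and F2: "realizes p X F2 D2"
  shows "\<exists>F. realizes p X F (\<lambda>x y. (D1 x y + D2 x y) / 2)"
proof -
  define F where "F x t = F1 x (2 * t) + F2 x (2 * t - 1)" for x t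
  have split: "\<bar>u (2 * t) + w (2 * t - 1)\<bar> powr p = \<bar>u (2 * t)\<bar> powr p + \<bar>w (2 * t - 1)\<bar> powr p"
    if "u \<in> unit_Lp p" "w \<in> unit_Lp p" for u w t
  proof -
    have "u (2 * t) = 0 \<or> w (2 * t - 1) = 0"
      using that by (cases "t < 1 / 2") (auto simp: unit_Lp_def)
    then show ?thesis by auto
  qed
  have aff: "integrable lborel (\<lambda>t. \<bar>u (2 * t + c)\<bar> powr p)"
      "(LINT t|lborel. \<bar>u (2 * t + c)\<bar> powr p) = (LINT t|lborel. \<bar>u t\<bar> powr p) / 2"
    if u: "u \<in> unit_Lp p" for u c
  proof -
    have i: "integrable lborel (\<lambda>t. \<bar>u t\<bar> powr p)" using u by (simp add: unit_Lp_def)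
    show "integrable lborel (\<lambda>t. \<bar>u (2 * t + c)\<bar> powr p)"
      using lborel_integrable_real_affine[OF i, of 2 c] by (simp add: add.commute)
    show "(LINT t|lborel. \<bar>u (2 * t + c)\<bar> powr p) = (LINT t|lborel. \<bar>u t\<bar> powr p) / 2"
      using lborel_integral_real_affine[of 2 "\<lambda>t. \<bar>u t\<bar> powr p" c] by (simp add: add.commute)
  qed
  have mem: "F1 x \<in> unit_Lp p" "F2 x \<in> unit_Lp p" if "x \<in> X" for x
    using F1 F2 that by (auto simp: realizes_def)
  have val: "(LINT t|lborel. \<bar>u (2 * t) + w (2 * t - 1)\<bar> powr p)
      = ((LINT t|lborel. \<bar>u t\<bar> powr p) + (LINT t|lborel. \<bar>w t\<bar> powr p)) / 2"
    and fin: "integrable lborel (\<lambda>t. \<bar>u (2 * t) + w (2 * t - 1)\<bar> powr p)"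
    if "u \<in> unit_Lp p" "w \<in> unit_Lp p" for u w
    using aff[OF that(1), of 0] aff[OF that(2), of "-1"] by (simp_all add: split[OF that] add_divide_distrib)
  have "realizes p X F (\<lambda>x y. (D1 x y + D2 x y) / 2)"
    unfolding realizes_def
  proof (intro conjI ballI)
    fix x assume x: "x \<in> X"
    have "F1 x \<in> borel_measurable borel" "F2 x \<in> borel_measurable borel"
      using mem[OF x] by (auto simp: unit_Lp_def)
    then have "F x \<in> borel_measurable borel" unfolding F_def by measurable
    moreover have "F x t = 0" if "t \<notin> {0<..<1}" for t
      using mem[OF x] that by (auto simp: unit_Lp_def F_def)
    ultimately show "F x \<in> unit_Lp p"
      using fin[OF mem[OF x]] by (simp add: unit_Lp_def F_def)
    fix y assume y: "y \<in> X"
    have "\<bar>F x t - F y t\<bar> = \<bar>(F1 x (2 * t) - F1 y (2 * t)) + (F2 x (2 * t - 1) - F2 y (2 * t - 1))\<bar>" for t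
      by (simp add: F_def)
    then show "(LINT t|lborel. \<bar>F x t - F y t\<bar> powr p) = (D1 x y + D2 x y) / 2"
      using val[OF unit_Lp_diff[OF p mem(1)[OF x] mem(1)[OF y]] unit_Lp_diff[OF p mem(2)[OF x] mem(2)[OF y]]]
        F1 F2 x y by (simp add: realizes_def)
  qed
  then show ?thesis by blast
qed

text \<open>
  Countably many disjoint intervals in the unit interval carry the coordinates of an \<open>l\<^sub>p\<close> space.
\<close>
definition dyadic :: "nat \<Rightarrow> real set" where "dyadic e = {1 / 2 ^ Suc e <..< 1 / 2 ^ e}"

lemma dyadic_disjoint: "t \<in> dyadic e \<Longrightarrow> t \<in> dyadic e' \<Longrightarrow> e = e'"
proof (induction e e' rule: linorder_wlog)
  case (le e e')
  show ?case
  proof (rule ccontr)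
    assume "e \<noteq> e'"
    then have "Suc e \<le> e'" using le by simp
    then have "1 / 2 ^ e' \<le> (1 :: real) / 2 ^ Suc e" by (intro divide_left_mono power_increasing) auto
    then show False using le by (auto simp: dyadic_def)
  qed
qed simp

definition lp_distance :: "real \<Rightarrow> ('a \<Rightarrow> 'i \<Rightarrow> real) \<Rightarrow> 'a \<Rightarrow> 'a \<Rightarrow> real" where
  "lp_distance p c x y = (\<Sum>i | c x i \<noteq> c y i. \<bar>c x i - c y i\<bar> powr p)"

lemma lp_distance_eq:
  assumes "finite S" "\<And>i. c x i \<noteq> c y i \<Longrightarrow> i \<in> S"
  shows "lp_distance p c x y = (\<Sum>i\<in>S. \<bar>c x i - c y i\<bar> powr p)"
  unfolding lp_distance_def using assms by (intro sum.mono_neutral_left) auto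

lemma realizes_lp:
  fixes c :: "'a \<Rightarrow> 'i \<Rightarrow> real"
  assumes p: "1 \<le> p" and X: "countable X" and fin: "\<And>x. x \<in> X \<Longrightarrow> finite {i. c x i \<noteq> 0}"
  shows "\<exists>F. realizes p X F (lp_distance p c)"
proof -
  define I where "I = (\<Union>x\<in>X. {i. c x i \<noteq> 0})"
  have I: "countable I" unfolding I_def using X fin by (intro countable_UN) (auto intro: countable_finite)
  define \<psi> where "\<psi> i t = 2 powr (real (Suc (to_nat_on I i)) / p) * indicat_real (dyadic (to_nat_on I i)) t" for i t
  define F where "F x t = (\<Sum>i | c x i \<noteq> 0. c x i * \<psi> i t)" for x t
  have [measurable]: "\<psi> i \<in> borel_measurable borel" for i
    unfolding \<psi>_def dyadic_def by measurable
  have single: "\<bar>\<Sum>i\<in>S. d i * \<psi> i t\<bar> powr p = (\<Sum>i\<in>S. \<bar>d i\<bar> powr p * \<bar>\<psi> i t\<bar> powr p)"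
    if S: "finite S" "S \<subseteq> I" for S d t
  proof (cases "\<exists>j\<in>S. \<psi> j t \<noteq> 0")
    case True
    then obtain j where j: "j \<in> S" "\<psi> j t \<noteq> 0" by blast
    have z: "\<psi> i t = 0" if "i \<in> S - {j}" for i
    proof (rule ccontr)
      assume "\<psi> i t \<noteq> 0"
      then have "to_nat_on I i = to_nat_on I j"
        using j dyadic_disjoint[of t "to_nat_on I i" "to_nat_on I j"] by (auto simp: \<psi>_def indicator_def split: if_splits)
      then show False using inj_on_to_nat_on[OF I] that j S by (auto dest: inj_onD)
    qed
    have "(\<Sum>i\<in>S. d i * \<psi> i t) = d j * \<psi> j t"
      using j z S(1) by (subst sum.remove[of _ j]) auto
    moreover have "(\<Sum>i\<in>S. \<bar>d i\<bar> powr p * \<bar>\<psi> i t\<bar> powr p) = \<bar>d j\<bar> powr p * \<bar>\<psi> j t\<bar> powr p"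
      using j z S(1) by (subst sum.remove[of _ j]) auto
    ultimately show ?thesis by (simp add: abs_mult powr_mult)
  qed auto
  have \<psi>: "has_bochner_integral lborel (\<lambda>t. \<bar>\<psi> i t\<bar> powr p) 1" for i
  proof -
    let ?e = "to_nat_on I i"
    have "\<bar>\<psi> i t\<bar> powr p = 2 ^ Suc ?e * indicat_real (dyadic ?e) t" for t
    proof -
      have "2 powr real (Suc ?e) = (2 :: real) ^ Suc ?e" by (rule powr_realpow) simp
      then show ?thesis using p by (auto simp: \<psi>_def indicator_def powr_powr)
    qed
    moreover have "has_bochner_integral lborel (\<lambda>t. 2 ^ Suc ?e * indicat_real (dyadic ?e) t) (2 ^ Suc ?e * measure lborel (dyadic ?e))"
      by (intro has_bochner_integral_mult_right has_bochner_integral_real_indicator)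
        (auto simp: dyadic_def field_simps)
    moreover have "measure lborel (dyadic ?e) = 1 / 2 ^ Suc ?e" by (simp add: dyadic_def field_simps)
    ultimately show ?thesis by simp
  qed
  have norm: "has_bochner_integral lborel (\<lambda>t. \<bar>\<Sum>i\<in>S. d i * \<psi> i t\<bar> powr p) (\<Sum>i\<in>S. \<bar>d i\<bar> powr p)"
    if S: "finite S" "S \<subseteq> I" for S d
    unfolding single[OF S]
    using has_bochner_integral_sum[of S lborel "\<lambda>i t. \<bar>d i\<bar> powr p * \<bar>\<psi> i t\<bar> powr p" "\<lambda>i. \<bar>d i\<bar> powr p"]
      has_bochner_integral_mult_right[OF \<psi>] by fastforce
  have "realizes p X F (lp_distance p c)"
    unfolding realizes_def
  proof (intro conjI ballI)
    fix x assume x: "x \<in> X"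
    have sub: "{i. c x i \<noteq> 0} \<subseteq> I" if "x \<in> X" for x using that by (auto simp: I_def)
    have "F x t = 0" if "t \<notin> {0<..<1}" for t
    proof -
      have "\<psi> i t = 0" for i
      proof -
        have "1 / 2 ^ to_nat_on I i \<le> (1 :: real)" by simp
        moreover have "0 < (1 :: real) / 2 ^ Suc (to_nat_on I i)" by simp
        ultimately have "t \<notin> dyadic (to_nat_on I i)"
          using that unfolding dyadic_def greaterThanLessThan_iff by linarith
        then show ?thesis by (simp add: \<psi>_def)
      qed
      then show ?thesis by (simp add: F_def)
    qed
    moreover have "F x \<in> borel_measurable borel" unfolding F_def by measurable
    ultimately show "F x \<in> unit_Lp p"
      using norm[OF fin[OF x] sub[OF x], of "c x"]
      by (auto simp: unit_Lp_def F_def has_bochner_integral_iff)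
    fix y assume y: "y \<in> X"
    define S where "S = {i. c x i \<noteq> 0} \<union> {i. c y i \<noteq> 0}"
    have S: "finite S" "S \<subseteq> I" using fin sub x y by (auto simp: S_def)
    have "F x t = (\<Sum>i\<in>S. c x i * \<psi> i t)" "F y t = (\<Sum>i\<in>S. c y i * \<psi> i t)" for t
      unfolding F_def using S by (auto intro!: sum.mono_neutral_left simp: S_def)
    then have "F x t - F y t = (\<Sum>i\<in>S. (c x i - c y i) * \<psi> i t)" for t
      by (simp add: left_diff_distrib sum_subtractf)
    then show "(LINT t|lborel. \<bar>F x t - F y t\<bar> powr p) = lp_distance p c x y"
      using norm[OF S, of "\<lambda>i. c x i - c y i"] S(1)
      by (subst lp_distance_eq[of S]) (auto simp: has_bochner_integral_iff S_def)
  qed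
  then show ?thesis by blast
qed

section \<open>Lamp configurations in the space of p-integrable functions\<close>

text \<open>
  Hartley's functions are a bounded orthonormal system of real functions on the unit interval, indexed by
  the integers.
\<close>
definition cas :: "int \<Rightarrow> real \<Rightarrow> real" where
  "cas z t = cos (2 * pi * of_int z * t) + sin (2 * pi * of_int z * t)"

lemma abs_cas: "\<bar>cas z t\<bar> \<le> 2"
  unfolding cas_def using abs_cos_le_one[of "2 * pi * of_int z * t"] abs_sin_le_one[of "2 * pi * of_int z * t"]
  by linarith

lemma cas_mult: "cas z t * cas w t = cos (2 * pi * of_int (z - w) * t) + sin (2 * pi * of_int (z + w) * t)"
  by (simp add: cas_def cos_diff sin_add algebra_simps)

lemma cas_continuous: "isCont (cas z) t"
  unfolding cas_def[abs_def] by (intro continuous_intros)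

lemma cas_orthonormal:
  "has_bochner_integral lborel (\<lambda>t. cas z t * cas w t * indicator {0..1} t) (of_bool (z = w))"
proof -
  define A where "A t = (if z - w = 0 then t else sin (2 * pi * of_int (z - w) * t) / (2 * pi * of_int (z - w)))" for t
  define B where "B t = (if z + w = 0 then 0 else - cos (2 * pi * of_int (z + w) * t) / (2 * pi * of_int (z + w)))" for t
  have A: "(A has_real_derivative cos (2 * pi * of_int (z - w) * t)) (at t)" for t
  proof (cases "z - w = 0")
    case True
    then show ?thesis unfolding A_def[abs_def] by simp
  next
    case False
    then have "2 * pi * real_of_int (z - w) \<noteq> 0" by simp
    then show ?thesis unfolding A_def[abs_def] using False
      by (auto intro!: derivative_eq_intros simp del: of_int_diff)
  qed
  have B: "(B has_real_derivative sin (2 * pi * of_int (z + w) * t)) (at t)" for t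
  proof (cases "z + w = 0")
    case True
    then show ?thesis unfolding B_def[abs_def] by (simp del: of_int_add)
  next
    case False
    then have "2 * pi * real_of_int (z + w) \<noteq> 0" by (simp del: of_int_add)
    then show ?thesis unfolding B_def[abs_def] using False
      by (auto intro!: derivative_eq_intros simp del: of_int_add)
  qed
  have "has_bochner_integral lborel (\<lambda>t. (cas z t * cas w t) * indicator {0..1} t) ((A 1 + B 1) - (A 0 + B 0))"
  proof (rule has_bochner_integral_FTC_Icc_real)
    show "((\<lambda>t. A t + B t) has_real_derivative cas z t * cas w t) (at t)" for t
      unfolding cas_mult by (intro DERIV_add A B)
    show "isCont (\<lambda>t. cas z t * cas w t) t" for t
      by (intro continuous_intros cas_continuous)
  qed simp
  moreover have "A 1 - A 0 = of_bool (z = w)" "B 1 - B 0 = 0"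
    using sin_int_2pin[of "z - w"] cos_int_2pin[of "z + w"] by (auto simp: A_def B_def simp del: of_int_diff of_int_add)
  ultimately show ?thesis by (simp add: algebra_simps)
qed

lemma cas_parseval:
  assumes "finite S"
  shows "has_bochner_integral lborel (\<lambda>t. (\<Sum>z\<in>S. d z * cas z t)\<^sup>2 * indicator {0..1} t) (\<Sum>z\<in>S. (d z)\<^sup>2)"
proof -
  have "has_bochner_integral lborel (\<lambda>t. \<Sum>z\<in>S. \<Sum>w\<in>S. (d z * d w) * (cas z t * cas w t * indicator {0..1} t))
    (\<Sum>z\<in>S. \<Sum>w\<in>S. (d z * d w) * of_bool (z = w))"
    by (intro has_bochner_integral_sum has_bochner_integral_mult_right cas_orthonormal)
  moreover have "(\<Sum>z\<in>S. \<Sum>w\<in>S. (d z * d w) * of_bool (z = w)) = (\<Sum>z\<in>S. (d z)\<^sup>2)"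
    using assms by (intro sum.cong refl) (simp add: power2_eq_square)
  moreover have "(\<Sum>z\<in>S. \<Sum>w\<in>S. (d z * d w) * (cas z t * cas w t * indicator {0..1} t))
    = (\<Sum>z\<in>S. d z * cas z t)\<^sup>2 * indicator {0..1} t" for t
    by (simp only: power2_eq_square sum_product sum_distrib_right[of _ _ "indicator {0..1} t"]) (simp only: mult_ac)
  ultimately show ?thesis by simp
qed

definition config :: "(int \<Rightarrow> int) set" where "config = {f. finite {z. f z \<noteq> 0}}"

lemma countable_config: "countable config"
proof -
  have "config \<subseteq> (\<lambda>A z. if \<exists>v. (z, v) \<in> A then (THE v. (z, v) \<in> A) else 0) ` {A :: (int \<times> int) set. finite A}"
  proof
    fix f assume "f \<in> config"
    then have "finite ((\<lambda>z. (z, f z)) ` {z. f z \<noteq> 0})" by (simp add: config_def)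
    then show "f \<in> (\<lambda>A z. if \<exists>v. (z, v) \<in> A then (THE v. (z, v) \<in> A) else 0) ` {A. finite A}"
      by (intro image_eqI[where x = "(\<lambda>z. (z, f z)) ` {z. f z \<noteq> 0}"]) (auto simp: fun_eq_iff image_iff)
  qed
  then show ?thesis by (rule countable_subset) (intro countable_image countable_Collect_finite)
qed

lemma finite_config_diff: "f \<in> config \<Longrightarrow> g \<in> config \<Longrightarrow> finite {z. f z \<noteq> g z}"
  by (rule finite_subset[of _ "{z. f z \<noteq> 0} \<union> {z. g z \<noteq> 0}"]) (auto simp: config_def)

definition lamp_energy :: "real \<Rightarrow> (int \<Rightarrow> int) \<Rightarrow> (int \<Rightarrow> int) \<Rightarrow> real" where
  "lamp_energy r f g = (\<Sum>z | f z \<noteq> g z. \<bar>real_of_int (f z - g z)\<bar> powr r)"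

text \<open>
  For \<open>p \<ge> 2\<close> the \<open>L\<^sub>p\<close> norm on a probability space dominates the \<open>L\<^sub>2\<close> norm. The norm of a
  finite Hartley series is therefore at least the \<open>l\<^sub>2\<close> norm of its coefficients, while a bounded change of
  one coefficient has a bounded effect.
\<close>
lemma realizes_hartley:
  assumes p: "2 \<le> p"
  shows "\<exists>F D. realizes p config F D \<and> (\<forall>f\<in>config. \<forall>g\<in>config. lamp_energy 2 f g powr (p / 2) \<le> D f g) \<and>
    (\<forall>f\<in>config. \<forall>z e. \<bar>e\<bar> \<le> 1 \<longrightarrow> D f (f(z := f z + e)) \<le> 2 powr p)"
proof -
  define U where "U S d t = (\<Sum>z\<in>S. d z * cas z t) * indicator {0<..<1} t" for S and d :: "int \<Rightarrow> real" and t
  define F where "F f = U {z. f z \<noteq> 0} (\<lambda>z. real_of_int (f z))" for f :: "int \<Rightarrow> int"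
  define D where "D f g = (LINT t|lborel. \<bar>F f t - F g t\<bar> powr p)" for f g
  have [measurable]: "cas z \<in> borel_measurable borel" for z
    unfolding cas_def[abs_def] by measurable
  have mem: "U S d \<in> unit_Lp p" if S: "finite S" for S d
  proof -
    have [measurable]: "U S d \<in> borel_measurable borel" unfolding U_def[abs_def] by measurable
    have "\<bar>U S d t\<bar> powr p \<le> (\<Sum>z\<in>S. \<bar>d z\<bar> * 2) powr p * indicator {0<..<1} t" for t
    proof -
      have "\<bar>\<Sum>z\<in>S. d z * cas z t\<bar> \<le> (\<Sum>z\<in>S. \<bar>d z\<bar> * 2)"
        using abs_cas by (intro order.trans[OF sum_abs] sum_mono) (simp add: abs_mult mult_left_mono)
      then have "\<bar>\<Sum>z\<in>S. d z * cas z t\<bar> powr p \<le> (\<Sum>z\<in>S. \<bar>d z\<bar> * 2) powr p"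
        using p by (intro powr_mono2) auto
      then show ?thesis by (simp add: U_def indicator_def)
    qed
    then have 1: "AE t in lborel. norm (\<bar>U S d t\<bar> powr p) \<le> norm ((\<Sum>z\<in>S. \<bar>d z\<bar> * 2) powr p * indicat_real {0<..<1} (t :: real))"
      by (intro always_eventually allI) (simp add: abs_mult)
    have 2: "integrable lborel (\<lambda>t. (\<Sum>z\<in>S. \<bar>d z\<bar> * 2) powr p * indicat_real {0<..<1} (t :: real))"
      by (intro integrable_mult_right integrable_real_indicator) auto
    have "integrable lborel (\<lambda>t. \<bar>U S d t\<bar> powr p)"
      by (rule Bochner_Integration.integrable_bound[OF 2 _ 1]) measurable
    moreover have "U S d t = 0" if "t \<notin> {0<..<1}" for t using that by (simp add: U_def)
    ultimately show ?thesis by (simp add: unit_Lp_def)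
  qed
  have lower: "(\<Sum>z\<in>S. (d z)\<^sup>2) powr (p / 2) \<le> (LINT t|lborel. \<bar>U S d t\<bar> powr p)" if S: "finite S" for S d
  proof -
    define \<mu> where "\<mu> = (\<Sum>z\<in>S. (d z)\<^sup>2)"
    define h where "h t = (\<Sum>z\<in>S. d z * cas z t)" for t
    have \<mu>: "0 \<le> \<mu>" unfolding \<mu>_def by (intro sum_nonneg) auto
    have I1: "has_bochner_integral lborel (\<lambda>t. (h t)\<^sup>2 * indicator {0..1} t) \<mu>"
      unfolding h_def \<mu>_def by (rule cas_parseval[OF S])
    have I2: "has_bochner_integral lborel (\<lambda>t. c * indicator {0..1 :: real} t) c" for c :: real
      using has_bochner_integral_mult_right[OF has_bochner_integral_real_indicator[of "{0..1 :: real}" lborel], of c] by simp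
    let ?k = "p / 2 * \<mu> powr (p / 2 - 1)"
    have I3: "has_bochner_integral lborel
       (\<lambda>t. (\<mu> powr (p / 2) - ?k * \<mu>) * indicator {0..1} t + ?k * ((h t)\<^sup>2 * indicator {0..1} t))
       (\<mu> powr (p / 2) - ?k * \<mu> + ?k * \<mu>)"
      by (intro has_bochner_integral_add has_bochner_integral_mult_right I1 I2)
    have "\<mu> powr (p / 2) = (LINT t|lborel. (\<mu> powr (p / 2) - ?k * \<mu>) * indicator {0..1} t + ?k * ((h t)\<^sup>2 * indicator {0..1} t))"
      using has_bochner_integral_integral_eq[OF I3] by simp
    also have "\<dots> \<le> (LINT t|lborel. \<bar>U S d t\<bar> powr p)"
    proof (rule integral_mono_AE)
      show "integrable lborel (\<lambda>t. (\<mu> powr (p / 2) - ?k * \<mu>) * indicator {0..1} t + ?k * ((h t)\<^sup>2 * indicator {0..1} t))"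
        using I3 by (simp add: has_bochner_integral_iff)
      show "integrable lborel (\<lambda>t. \<bar>U S d t\<bar> powr p)" using mem[OF S] by (simp add: unit_Lp_def)
      have pt: "(\<mu> powr (p / 2) - ?k * \<mu>) * indicator {0..1} t + ?k * ((h t)\<^sup>2 * indicator {0..1} t) \<le> \<bar>U S d t\<bar> powr p"
        if t: "t \<noteq> 0" "t \<noteq> 1" for t
      proof (cases "t \<in> {0<..<1}")
        case True
        have "\<mu> powr (p / 2) + ?k * ((h t)\<^sup>2 - \<mu>) \<le> ((h t)\<^sup>2) powr (p / 2)"
          using p \<mu> by (intro powr_above_tangent) auto
        also have "((h t)\<^sup>2) powr (p / 2) = (\<bar>h t\<bar> powr 2) powr (p / 2)" by (simp add: powr_numeral)
        also have "\<dots> = \<bar>h t\<bar> powr p" by (simp only: powr_powr) simp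
        finally have "(\<mu> powr (p / 2) - ?k * \<mu>) + ?k * (h t)\<^sup>2 \<le> \<bar>h t\<bar> powr p"
          unfolding right_diff_distrib by linarith
        then show ?thesis using True by (simp add: U_def h_def)
      next
        case False
        then show ?thesis using t by (auto simp: indicator_def)
      qed
      show "AE t in lborel. (\<mu> powr (p / 2) - ?k * \<mu>) * indicator {0..1} t + ?k * ((h t)\<^sup>2 * indicator {0..1} t) \<le> \<bar>U S d t\<bar> powr p"
        using AE_lborel_singleton[of 0] AE_lborel_singleton[of 1] by eventually_elim (rule pt)
    qed
    finally show ?thesis by (simp add: \<mu>_def)
  qed
  have diff: "F f t - F g t = U {z. f z \<noteq> g z} (\<lambda>z. real_of_int (f z - g z)) t" if fg: "f \<in> config" "g \<in> config" for f g t
  proof -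
    define S where "S = {z. f z \<noteq> 0} \<union> {z. g z \<noteq> 0}"
    have S: "finite S" using fg by (auto simp: S_def config_def)
    have ext: "F h t = U S (\<lambda>z. real_of_int (h z)) t" if "{z. h z \<noteq> 0} \<subseteq> S" for h
      unfolding F_def U_def using that S by (auto intro!: sum.mono_neutral_left simp: indicator_def)
    have "F f t - F g t = U S (\<lambda>z. real_of_int (f z - g z)) t"
      using ext[of f] ext[of g] by (simp add: S_def U_def left_diff_distrib sum_subtractf)
    also have "\<dots> = U {z. f z \<noteq> g z} (\<lambda>z. real_of_int (f z - g z)) t"
      unfolding U_def using S by (auto intro!: sum.mono_neutral_right simp: indicator_def S_def)
    finally show ?thesis .
  qed
  have D_eq: "D f g = (LINT t|lborel. \<bar>U {z. f z \<noteq> g z} (\<lambda>z. real_of_int (f z - g z)) t\<bar> powr p)"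
    if "f \<in> config" "g \<in> config" for f g
    unfolding D_def by (simp only: diff[OF that])
  show ?thesis
  proof (intro exI conjI ballI allI impI)
    show "realizes p config F D"
      using mem by (auto simp: realizes_def D_def F_def config_def)
    show "lamp_energy 2 f g powr (p / 2) \<le> D f g" if "f \<in> config" "g \<in> config" for f g
      using lower[OF finite_config_diff[OF that]] by (simp add: D_eq[OF that] lamp_energy_def powr_numeral)
    show "D f (f(z := f z + e)) \<le> 2 powr p" if f: "f \<in> config" and e: "\<bar>e\<bar> \<le> 1" for f z e
    proof -
      have g: "f(z := f z + e) \<in> config"
        using f by (auto simp: config_def intro: finite_subset[of _ "insert z {z. f z \<noteq> 0}"])
      have eq: "U {w. f w \<noteq> (f(z := f z + e)) w} (\<lambda>w. real_of_int (f w - (f(z := f z + e)) w)) t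
          = - real_of_int e * cas z t * indicator {0<..<1} t" for t
      proof -
        have "{w. f w \<noteq> (f(z := f z + e)) w} = (if e = 0 then {} else {z})" by auto
        then show ?thesis by (simp add: U_def)
      qed
      have "D f (f(z := f z + e)) = (LINT t|lborel. \<bar>- real_of_int e * cas z t * indicator {0<..<1} t\<bar> powr p)"
        unfolding D_eq[OF f g] eq ..
      also have "\<dots> \<le> (LINT t|lborel. 2 powr p * indicator {0<..<1 :: real} t)"
      proof (rule integral_mono)
        show "integrable lborel (\<lambda>t. \<bar>- real_of_int e * cas z t * indicator {0<..<1} t\<bar> powr p)"
          using mem[OF finite_config_diff[OF f g], of "\<lambda>w. real_of_int (f w - (f(z := f z + e)) w)"]
          by (simp only: unit_Lp_def eq mem_Collect_eq)
        show "integrable lborel (\<lambda>t. 2 powr p * indicator {0<..<1 :: real} t)"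
          by (intro integrable_mult_right integrable_real_indicator) auto
        fix t
        have "\<bar>- real_of_int e * cas z t\<bar> \<le> 1 * 2"
          unfolding abs_mult using e abs_cas[of z t] by (intro mult_mono) auto
        then show "\<bar>- real_of_int e * cas z t * indicator {0<..<1} t\<bar> powr p \<le> 2 powr p * indicator {0<..<1} t"
          using p powr_mono2[of p "\<bar>- real_of_int e * cas z t\<bar>" 2] by (auto simp: indicator_def)
      qed
      also have "\<dots> = 2 powr p" by simp
      finally show ?thesis .
    qed
  qed
qed

text \<open>
  The coordinates of \<open>l\<^sub>p\<close> are the right choice for \<open>p \<le> 2\<close>; beyond \<open>2\<close> the Hartley functions do better,
  since they control the larger \<open>l\<^sub>2\<close> norm.
\<close>
lemma realizes_lamps:
  assumes p: "1 \<le> p"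
  shows "\<exists>F D. realizes p config F D \<and> (\<forall>f\<in>config. \<forall>g\<in>config. lamp_energy (min p 2) f g powr (p / min p 2) \<le> D f g) \<and>
    (\<forall>f\<in>config. \<forall>z e. \<bar>e\<bar> \<le> 1 \<longrightarrow> D f (f(z := f z + e)) \<le> 2 powr p)"
proof (cases "2 \<le> p")
  case True
  then show ?thesis using realizes_hartley[OF True] by simp
next
  case False
  define c where "c f z = real_of_int (f z)" for f :: "int \<Rightarrow> int" and z
  obtain F where F: "realizes p config F (lp_distance p c)"
    using realizes_lp[OF p countable_config, of c] by (auto simp: c_def config_def)
  have eq: "lp_distance p c f g = lamp_energy p f g" for f g
    by (simp add: lp_distance_def lamp_energy_def c_def)
  have "lamp_energy p f (f(z := f z + e)) \<le> 2 powr p" if "\<bar>e\<bar> \<le> 1" for f z e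
  proof -
    have "{w. f w \<noteq> (f(z := f z + e)) w} = (if e = 0 then {} else {z})" by auto
    moreover have "\<bar>real_of_int e\<bar> powr p \<le> 2 powr p" using that p by (intro powr_mono2) auto
    ultimately show ?thesis by (simp add: lamp_energy_def)
  qed
  moreover have "0 \<le> lamp_energy p f g" for f g unfolding lamp_energy_def by (intro sum_nonneg) auto
  ultimately show ?thesis using F False p by (intro exI[of _ F] exI[of _ "lp_distance p c"]) (auto simp: eq)
qed

section \<open>The farthest differing lamp\<close>

text \<open>
  The restriction of \<open>f\<close> to \<open>{n..}\<close>, coded by the graph of its support.
\<close>
definition tail :: "(int \<Rightarrow> int) \<Rightarrow> int \<Rightarrow> (int \<times> int) set" where
  "tail f n = (\<lambda>z. (z, f z)) ` {z. n \<le> z \<and> f z \<noteq> 0}"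

lemma mem_tail: "(w, v) \<in> tail f n \<longleftrightarrow> n \<le> w \<and> f w \<noteq> 0 \<and> v = f w"
  by (auto simp: tail_def)

definition weight :: "real \<Rightarrow> int \<Rightarrow> real" where
  "weight \<beta> k = (if k \<le> 0 then 0 else real_of_int k powr \<beta>)"

text \<open>
  For every \<open>n\<close> to the right of the cursor there is a coordinate for each possible restriction to
  \<open>{n..}\<close>, and the element \<open>(f, x)\<close> puts the weight of \<open>n - x\<close> on its own restriction. Two elements are
  separated at all \<open>n\<close> between the cursors and the last lamp on which they differ, and a change of the
  lamp under the cursor is not seen at all. The empty restriction is omitted to keep supports finite.
\<close>
definition right_coord :: "real \<Rightarrow> (int \<Rightarrow> int) \<times> int \<Rightarrow> int \<times> (int \<times> int) set \<Rightarrow> real" where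
  "right_coord \<beta> = (\<lambda>(f, x) (n, A). if A = tail f n \<and> A \<noteq> {} then weight \<beta> (n - x) else 0)"

lemma weight_nonneg: "0 \<le> weight \<beta> k" by (simp add: weight_def)

lemma weight_mono: "0 \<le> \<beta> \<Longrightarrow> j \<le> k \<Longrightarrow> weight \<beta> j \<le> weight \<beta> k"
  by (auto simp: weight_def intro!: powr_mono2)

text \<open>
  The exponent is just small enough for the increments of the weight to be \<open>p\<close>-summable, which is what a
  move of the cursor costs, and large enough for the sum of the \<open>p\<close>-th powers of the first \<open>T\<close> weights to
  be nearly \<open>T powr p\<close>. It is not allowed to be negative, so that weights increase.
\<close>
lemma weight_summable:
  assumes p: "1 \<le> p" and \<epsilon>: "0 < \<epsilon>" and \<beta>: "\<beta> = max 0 (1 - 1 / p - \<epsilon>)"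
  shows "summable (\<lambda>u. \<bar>weight \<beta> (int u + 1) - weight \<beta> (int u)\<bar> powr p)"
proof (rule summable_comparison_test')
  show "summable (\<lambda>u. real u powr (- 1 - \<epsilon> * p))"
    using p \<epsilon> by (subst summable_real_powr_iff) simp
  fix u :: nat assume u: "1 \<le> u"
  show "norm (\<bar>weight \<beta> (int u + 1) - weight \<beta> (int u)\<bar> powr p) \<le> real u powr (- 1 - \<epsilon> * p)"
  proof (cases "1 - 1 / p - \<epsilon> \<le> 0")
    case True
    then have "\<beta> = 0" using \<beta> by simp
    then show ?thesis using u by (simp add: weight_def)
  next
    case False
    then have b: "\<beta> = 1 - 1 / p - \<epsilon>" using \<beta> by simp
    have b1: "\<beta> \<le> 1" "0 \<le> \<beta>" using b p \<epsilon> \<beta> by (auto simp: field_simps)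
    have u0: "0 < real u" using u by simp
    have "(real u + 1) powr \<beta> = (real u + 1) * (real u + 1) powr (\<beta> - 1)" using u0 by (simp add: powr_diff)
    also have "\<dots> \<le> (real u + 1) * real u powr (\<beta> - 1)"
      using u0 b1 by (intro mult_left_mono powr_mono2') auto
    also have "\<dots> = real u powr \<beta> + real u powr (\<beta> - 1)" using u0 by (simp add: powr_diff field_simps)
    finally have "(real u + 1) powr \<beta> - real u powr \<beta> \<le> real u powr (\<beta> - 1)" by simp
    moreover have "real u powr \<beta> \<le> (real u + 1) powr \<beta>" using b1 by (intro powr_mono2) auto
    ultimately have "\<bar>weight \<beta> (int u + 1) - weight \<beta> (int u)\<bar> \<le> real u powr (\<beta> - 1)"
      using u by (simp add: weight_def)
    then have "\<bar>weight \<beta> (int u + 1) - weight \<beta> (int u)\<bar> powr p \<le> (real u powr (\<beta> - 1)) powr p"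
      using p by (intro powr_mono2) auto
    also have "(\<beta> - 1) * p = - 1 - \<epsilon> * p" using p by (simp add: b field_simps)
    then have "(real u powr (\<beta> - 1)) powr p = real u powr (- 1 - \<epsilon> * p)" by (simp add: powr_powr)
    finally show ?thesis by simp
  qed
qed

lemma sum_powr_ge:
  assumes s: "0 \<le> s"
  shows "real T powr (s + 1) / (s + 1) \<le> (\<Sum>v=1..T. real v powr s)"
proof (induction T)
  case (Suc T)
  have "real (Suc T) powr (s + 1) + (s + 1) * real (Suc T) powr (s + 1 - 1) * (real T - real (Suc T)) \<le> real T powr (s + 1)"
    using s by (intro powr_above_tangent) auto
  then have "real (Suc T) powr (s + 1) \<le> real T powr (s + 1) + (s + 1) * real (Suc T) powr s" by simp
  then have "real (Suc T) powr (s + 1) / (s + 1) \<le> (real T powr (s + 1) + (s + 1) * real (Suc T) powr s) / (s + 1)"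
    using s by (intro divide_right_mono) auto
  also have "\<dots> = real T powr (s + 1) / (s + 1) + real (Suc T) powr s"
    using s by (simp add: add_divide_distrib)
  finally have "real (Suc T) powr (s + 1) / (s + 1) \<le> real T powr (s + 1) / (s + 1) + real (Suc T) powr s" .
  then show ?case using Suc.IH by simp
qed (use s in simp)

lemma carrier_config: "a \<in> carrier Z_wr_Z \<longleftrightarrow> fst a \<in> config"
  by (cases a) (simp add: Z_wr_Z_carrier config_def)

lemma right_coord_support:
  assumes "f \<in> config"
  shows "finite {n. x < n \<and> tail f n \<noteq> {}}" (is "finite ?N")
    and "{i. right_coord \<beta> (f, x) i \<noteq> 0} \<subseteq> (\<lambda>n. (n, tail f n)) ` {n. x < n \<and> tail f n \<noteq> {}}"
proof -
  have "?N \<subseteq> (\<Union>z\<in>{z. f z \<noteq> 0}. {x<..z})" by (auto simp: tail_def)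
  moreover have "finite \<dots>" using assms by (auto simp: config_def)
  ultimately show "finite ?N" by (rule finite_subset)
  show "{i. right_coord \<beta> (f, x) i \<noteq> 0} \<subseteq> (\<lambda>n. (n, tail f n)) ` ?N"
    by (auto simp: right_coord_def weight_def split: if_splits)
qed

lemma right_distance_shift:
  assumes f: "f \<in> config" and sm: "summable (\<lambda>u. \<bar>weight \<beta> (int u + 1) - weight \<beta> (int u)\<bar> powr p)"
  shows "lp_distance p (right_coord \<beta>) (f, x) (f, x + 1) \<le> (\<Sum>u. \<bar>weight \<beta> (int u + 1) - weight \<beta> (int u)\<bar> powr p)"
proof -
  let ?N = "{n. x < n \<and> tail f n \<noteq> {}}"
  let ?inc = "\<lambda>u. \<bar>weight \<beta> (int u + 1) - weight \<beta> (int u)\<bar> powr p"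
  have fin: "finite ?N" using right_coord_support[OF f] by simp
  have "lp_distance p (right_coord \<beta>) (f, x) (f, x + 1)
    = (\<Sum>i\<in>(\<lambda>n. (n, tail f n)) ` ?N. \<bar>right_coord \<beta> (f, x) i - right_coord \<beta> (f, x + 1) i\<bar> powr p)"
  proof (rule lp_distance_eq)
    show "finite ((\<lambda>n. (n, tail f n)) ` ?N)" using fin by simp
    show "i \<in> (\<lambda>n. (n, tail f n)) ` ?N" if "right_coord \<beta> (f, x) i \<noteq> right_coord \<beta> (f, x + 1) i" for i
      using that by (auto simp: right_coord_def weight_def split: if_splits prod.splits)
  qed
  also have "\<dots> = (\<Sum>n\<in>?N. \<bar>weight \<beta> (n - x) - weight \<beta> (n - x - 1)\<bar> powr p)"
    by (subst sum.reindex) (auto simp: inj_on_def right_coord_def algebra_simps intro!: sum.cong)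
  also have "\<dots> = (\<Sum>u\<in>(\<lambda>n. nat (n - x - 1)) ` ?N. ?inc u)"
    by (subst sum.reindex) (auto simp: inj_on_def nat_eq_iff intro!: sum.cong)
  also have "\<dots> \<le> (\<Sum>u. ?inc u)"
    using fin by (intro sum_le_suminf sm) auto
  finally show ?thesis .
qed

lemma right_distance_lamp:
  "lp_distance p (right_coord \<beta>) (f, x) (f(x := v), x) = 0"
proof -
  have "right_coord \<beta> (f, x) i = right_coord \<beta> (f(x := v), x) i" for i
  proof (cases "fst i \<le> x")
    case True
    then show ?thesis by (auto simp: right_coord_def weight_def split: prod.splits)
  next
    case False
    then have "tail f (fst i) = tail (f(x := v)) (fst i)" by (auto simp: tail_def image_iff)
    then show ?thesis by (auto simp: right_coord_def split: prod.splits)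
  qed
  then show ?thesis by (simp add: lp_distance_def)
qed

text \<open>
  At each \<open>n\<close> between the cursors and \<open>z\<close> the two restrictions differ. One of them is non-empty, and on its
  coordinate one of the two elements vanishes.
\<close>
lemma right_distance_ge:
  assumes p: "1 \<le> p" and \<beta>: "0 \<le> \<beta>" and fg: "f \<in> config" "g \<in> config"
    and z: "f z \<noteq> g z" "max x y < z"
  shows "real_of_int (z - max x y) powr (\<beta> * p + 1) / (\<beta> * p + 1) \<le> lp_distance p (right_coord \<beta>) (f, x) (g, y)"
proof -
  define M where "M = max x y"
  define idx where "idx n = (if tail f n \<noteq> {} then (n, tail f n) else (n, tail g n))" for n
  let ?d = "\<lambda>i. right_coord \<beta> (f, x) i - right_coord \<beta> (g, y) i"
  have far: "weight \<beta> (n - M) \<le> \<bar>?d (idx n)\<bar>" "0 < weight \<beta> (n - M)" if n: "n \<in> {M<..z}" for n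
  proof -
    have ne: "tail f n \<noteq> tail g n"
    proof
      assume eq: "tail f n = tail g n"
      have "f z \<noteq> 0 \<and> (z, f z) \<in> tail f n \<or> g z \<noteq> 0 \<and> (z, g z) \<in> tail g n"
        using z n by (cases "f z = 0") (simp_all add: mem_tail)
      then show False using eq z(1) by (metis mem_tail)
    qed
    have m: "weight \<beta> (n - M) \<le> weight \<beta> (n - x)" "weight \<beta> (n - M) \<le> weight \<beta> (n - y)"
      by (auto intro!: weight_mono \<beta> simp: M_def)
    show "weight \<beta> (n - M) \<le> \<bar>?d (idx n)\<bar>"
    proof (cases "tail f n = {}")
      case True
      then have "?d (idx n) = - weight \<beta> (n - y)" using ne by (auto simp: idx_def right_coord_def)
      then show ?thesis using m weight_nonneg[of \<beta> "n - y"] by simp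
    next
      case False
      then have "?d (idx n) = weight \<beta> (n - x)" using ne by (auto simp: idx_def right_coord_def)
      then show ?thesis using m weight_nonneg[of \<beta> "n - x"] by simp
    qed
    show "0 < weight \<beta> (n - M)" using n by (simp add: weight_def)
  qed
  have fin: "finite {i. right_coord \<beta> (f, x) i \<noteq> right_coord \<beta> (g, y) i}"
  proof (rule finite_subset)
    show "{i. right_coord \<beta> (f, x) i \<noteq> right_coord \<beta> (g, y) i}
      \<subseteq> {i. right_coord \<beta> (f, x) i \<noteq> 0} \<union> {i. right_coord \<beta> (g, y) i \<noteq> 0}" by auto
    show "finite ({i. right_coord \<beta> (f, x) i \<noteq> 0} \<union> {i. right_coord \<beta> (g, y) i \<noteq> 0})"
      using right_coord_support fg by (meson finite_Un finite_imageI finite_subset)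
  qed
  define T where "T = nat (z - M)"
  have T: "real T = real_of_int (z - M)" using z by (simp add: T_def M_def)
  have "real T powr (\<beta> * p + 1) / (\<beta> * p + 1) \<le> (\<Sum>v=1..T. real v powr (\<beta> * p))"
    using \<beta> p by (intro sum_powr_ge) auto
  also have "\<dots> = (\<Sum>n\<in>{M<..z}. weight \<beta> (n - M) powr p)"
    by (rule sum.reindex_bij_witness[of _ "\<lambda>n. nat (n - M)" "\<lambda>v. int v + M"])
      (auto simp: T_def weight_def powr_powr)
  also have "\<dots> \<le> (\<Sum>n\<in>{M<..z}. \<bar>?d (idx n)\<bar> powr p)"
    using far p weight_nonneg by (intro sum_mono powr_mono2) auto
  also have "\<dots> = (\<Sum>i\<in>idx ` {M<..z}. \<bar>?d i\<bar> powr p)"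
    by (subst sum.reindex) (auto simp: inj_on_def idx_def split: if_splits)
  also have "\<dots> \<le> lp_distance p (right_coord \<beta>) (f, x) (g, y)"
    unfolding lp_distance_def
  proof (rule sum_mono2[OF fin])
    show "idx ` {M<..z} \<subseteq> {i. right_coord \<beta> (f, x) i \<noteq> right_coord \<beta> (g, y) i}"
      using far by fastforce
  qed auto
  finally show ?thesis by (simp add: T M_def)
qed

lemma realizes_right:
  assumes p: "1 \<le> p" and \<epsilon>: "0 < \<epsilon>" "\<epsilon> < 1"
  shows "\<exists>F D W. realizes p (carrier Z_wr_Z) F D \<and>
     (\<forall>f\<in>config. \<forall>x. D (f, x) (f, x + 1) \<le> W) \<and>
     (\<forall>f\<in>config. \<forall>x v. D (f, x) (f(x := v), x) = 0) \<and>
     (\<forall>f\<in>config. \<forall>g\<in>config. \<forall>x y z. f z \<noteq> g z \<longrightarrow> max x y < z \<longrightarrow>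
        real_of_int (z - max x y) powr (p * (1 - \<epsilon>)) \<le> p * D (f, x) (g, y))"
proof -
  define \<beta> where "\<beta> = max 0 (1 - 1 / p - \<epsilon>)"
  have \<beta>: "0 \<le> \<beta>" by (simp add: \<beta>_def)
  have e: "p * (1 - \<epsilon>) \<le> \<beta> * p + 1" "\<beta> * p + 1 \<le> p"
  proof -
    have "(1 - 1 / p - \<epsilon>) * p \<le> \<beta> * p" using p by (intro mult_right_mono) (auto simp: \<beta>_def)
    then show "p * (1 - \<epsilon>) \<le> \<beta> * p + 1" using p by (simp add: algebra_simps)
    have "\<beta> * p \<le> (1 - 1 / p) * p" using p \<epsilon> by (intro mult_right_mono) (auto simp: \<beta>_def)
    then show "\<beta> * p + 1 \<le> p" using p by (simp add: algebra_simps)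
  qed
  have sm: "summable (\<lambda>u. \<bar>weight \<beta> (int u + 1) - weight \<beta> (int u)\<bar> powr p)"
    by (rule weight_summable[OF p \<epsilon>(1)]) (simp add: \<beta>_def)
  have "countable (carrier Z_wr_Z)"
    using countable_config by (simp add: Z_wr_Z_def config_def)
  moreover have "finite {i. right_coord \<beta> a i \<noteq> 0}" if "a \<in> carrier Z_wr_Z" for a
  proof -
    have "fst a \<in> config" using that by (simp add: carrier_config)
    from finite_subset[OF right_coord_support(2)[OF this] finite_imageI[OF right_coord_support(1)[OF this]], of \<beta> "snd a"]
    show ?thesis by simp
  qed
  ultimately obtain F where F: "realizes p (carrier Z_wr_Z) F (lp_distance p (right_coord \<beta>))"
    using realizes_lp[OF p] by blast
  have lower: "real_of_int (z - max x y) powr (p * (1 - \<epsilon>)) \<le> p * lp_distance p (right_coord \<beta>) (f, x) (g, y)"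
    if "f \<in> config" "g \<in> config" "f z \<noteq> g z" "max x y < z" for f g x y z
  proof -
    let ?D = "lp_distance p (right_coord \<beta>) (f, x) (g, y)"
    have D0: "0 \<le> ?D" unfolding lp_distance_def by (intro sum_nonneg) auto
    have "1 \<le> real_of_int (z - max x y)" using that by linarith
    then have "real_of_int (z - max x y) powr (p * (1 - \<epsilon>)) \<le> real_of_int (z - max x y) powr (\<beta> * p + 1)"
      using e by (intro powr_mono) auto
    also have "\<dots> \<le> (\<beta> * p + 1) * ?D"
      using right_distance_ge[OF p \<beta> that] \<beta> p by (simp add: pos_divide_le_eq add_nonneg_pos mult.commute)
    also have "\<dots> \<le> p * ?D" using e D0 by (intro mult_right_mono) auto
    finally show ?thesis .
  qed
  show ?thesis
  proof (intro exI conjI ballI allI impI)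
    show "realizes p (carrier Z_wr_Z) F (lp_distance p (right_coord \<beta>))" by (rule F)
  qed (use right_distance_shift[OF _ sm] right_distance_lamp lower in blast)+
qed

section \<open>The lower bound for the exponent\<close>

lemma Z_wr_Z_closed: "a \<in> carrier Z_wr_Z \<Longrightarrow> b \<in> carrier Z_wr_Z \<Longrightarrow> a \<otimes>\<^bsub>Z_wr_Z\<^esub> b \<in> carrier Z_wr_Z"
  using group.is_monoid[OF group_Z_wr_Z] by (rule monoid.m_closed)

text \<open>
  A single sweep from left to right sets all the lamps on the way.
\<close>
lemma wl_sweep:
  assumes "{z. g z \<noteq> 0} \<subseteq> {0..<int n}"
  shows "int (wl (g, int n)) \<le> (\<Sum>z\<in>{0..<int n}. \<bar>g z\<bar>) + int n"
  using assms
proof (induction n arbitrary: g)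
  case 0
  then have "g = (\<lambda>z. 0)" by auto
  then show ?case by (simp add: wl_one)
next
  case (Suc n)
  define h where "h = g(int n := 0)"
  have h: "{z. h z \<noteq> 0} \<subseteq> {0..<int n}"
  proof
    fix z assume "z \<in> {z. h z \<noteq> 0}"
    then have z: "z \<noteq> int n" "g z \<noteq> 0" by (auto simp: h_def split: if_splits)
    then have "z \<in> {0..<int (Suc n)}" using Suc.prems by blast
    then show "z \<in> {0..<int n}" using z by auto
  qed
  have fin: "finite {z. h z \<noteq> 0}" using h by (rule finite_subset) simp
  let ?l = "(\<lambda>z :: int. if z = 0 then g (int n) else 0, 0 :: int)" and ?s = "(\<lambda>z :: int. 0 :: int, 1 :: int)"
  have c: "(h, int n) \<in> carrier Z_wr_Z" "?l \<in> carrier Z_wr_Z" "?s \<in> carrier Z_wr_Z"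
    using fin by (simp_all add: Z_wr_Z_carrier finite_lamp_support)
  have eq: "(h, int n) \<otimes>\<^bsub>Z_wr_Z\<^esub> (?l \<otimes>\<^bsub>Z_wr_Z\<^esub> ?s) = (g, int (Suc n))"
    by (auto simp: Z_wr_Z_mult h_def fun_eq_iff)
  have "wl (g, int (Suc n)) \<le> wl (h, int n) + (wl ?l + wl ?s)"
    unfolding eq[symmetric] using c wl_mult[OF c(1) Z_wr_Z_closed[OF c(2,3)]] wl_mult[OF c(2,3)] by linarith
  moreover have "wl ?l \<le> nat \<bar>g (int n)\<bar>" by (rule wl_lamp)
  moreover have "wl ?s \<le> 1" using wl_shift[of 1] by simp
  moreover have "int (wl (h, int n)) \<le> (\<Sum>z\<in>{0..<int n}. \<bar>h z\<bar>) + int n" by (rule Suc.IH[OF h])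
  moreover have "(\<Sum>z\<in>{0..<int n}. \<bar>h z\<bar>) = (\<Sum>z\<in>{0..<int n}. \<bar>g z\<bar>)"
    by (intro sum.cong) (auto simp: h_def)
  moreover have "{0..<int (Suc n)} = insert (int n) {0..<int n}" by auto
  ultimately show ?case by simp
qed

lemma wl_le:
  assumes f: "{z. f z \<noteq> 0} \<subseteq> {- int R..<int R}"
  shows "int (wl (f, x)) \<le> 4 * int R + \<bar>x\<bar> + (\<Sum>z\<in>{- int R..<int R}. \<bar>f z\<bar>)"
proof -
  define g where "g z = f (z - int R)" for z
  have fin: "finite {z. f z \<noteq> 0}" using f by (rule finite_subset) simp
  have g: "{z. g z \<noteq> 0} \<subseteq> {0..<int (2 * R)}" using f by (auto simp: g_def)
  let ?a = "(\<lambda>z :: int. 0 :: int, - int R)" and ?b = "(g, int (2 * R))" and ?c = "(\<lambda>z :: int. 0 :: int, x - int R)"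
  have c: "?a \<in> carrier Z_wr_Z" "?b \<in> carrier Z_wr_Z" "?c \<in> carrier Z_wr_Z"
    using finite_subset[OF g] by (simp_all add: Z_wr_Z_carrier)
  have eq: "?a \<otimes>\<^bsub>Z_wr_Z\<^esub> (?b \<otimes>\<^bsub>Z_wr_Z\<^esub> ?c) = (f, x)" by (simp add: Z_wr_Z_mult g_def)
  have "wl (f, x) \<le> wl ?a + (wl ?b + wl ?c)"
    unfolding eq[symmetric] using wl_mult[OF c(1) Z_wr_Z_closed[OF c(2,3)]] wl_mult[OF c(2,3)] by linarith
  moreover have "int (wl ?a) \<le> int R" using wl_shift[of "- int R"] by simp
  moreover have "int (wl ?c) \<le> \<bar>x\<bar> + int R" using wl_shift[of "x - int R"] by linarith
  moreover have "int (wl ?b) \<le> (\<Sum>z\<in>{0..<int (2 * R)}. \<bar>g z\<bar>) + int (2 * R)" by (rule wl_sweep[OF g])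
  moreover have "(\<Sum>z\<in>{0..<int (2 * R)}. \<bar>g z\<bar>) = (\<Sum>z\<in>{- int R..<int R}. \<bar>f z\<bar>)"
    by (rule sum.reindex_bij_witness[of _ "\<lambda>z. z + int R" "\<lambda>z. z - int R"]) (auto simp: g_def)
  ultimately show ?thesis by simp
qed

lemma Lp_Lipschitz_of_gens:
  assumes p: "1 \<le> p" and F: "\<And>a. a \<in> carrier Z_wr_Z \<Longrightarrow> F a \<in> Lp_fun p"
    and step: "\<And>a s. a \<in> carrier Z_wr_Z \<Longrightarrow> s \<in> Z_wr_Z_gens \<Longrightarrow> Lp_norm p (\<lambda>t. F a t - F (a \<otimes>\<^bsub>Z_wr_Z\<^esub> s) t) \<le> L"
  shows "Lp_Lipschitz Z_wr_Z Z_wr_Z_gens p F"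
proof -
  interpret group Z_wr_Z by (rule group_Z_wr_Z)
  have path: "Lp_norm p (\<lambda>t. F a t - F (a \<otimes>\<^bsub>Z_wr_Z\<^esub> foldr (mult Z_wr_Z) w \<one>\<^bsub>Z_wr_Z\<^esub>) t) \<le> L * real (length w)"
    if "set w \<subseteq> Z_wr_Z_gens" "a \<in> carrier Z_wr_Z" for w a
    using that
  proof (induction w arbitrary: a)
    case Nil
    then show ?case using p by (simp add: Lp_norm_def)
  next
    case (Cons s w)
    have s: "s \<in> Z_wr_Z_gens" "s \<in> carrier Z_wr_Z" using Cons.prems Z_wr_Z_gens_closed by auto
    have "set w \<subseteq> carrier Z_wr_Z" using Cons.prems Z_wr_Z_gens_closed by auto
    then have w: "foldr (mult Z_wr_Z) w \<one>\<^bsub>Z_wr_Z\<^esub> \<in> carrier Z_wr_Z" by (rule foldr_mult_closed)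
    let ?b = "a \<otimes>\<^bsub>Z_wr_Z\<^esub> s"
    let ?c = "?b \<otimes>\<^bsub>Z_wr_Z\<^esub> foldr (mult Z_wr_Z) w \<one>\<^bsub>Z_wr_Z\<^esub>"
    have b: "?b \<in> carrier Z_wr_Z" "?c \<in> carrier Z_wr_Z" using Cons.prems s w by auto
    have "Lp_norm p (\<lambda>t. F a t - F ?c t) \<le> Lp_norm p (\<lambda>t. F a t - F ?b t) + Lp_norm p (\<lambda>t. F ?b t - F ?c t)"
      by (rule Lp_triangle[OF p]) (use F b Cons.prems in auto)
    also have "\<dots> \<le> L + L * real (length w)"
      using Cons.IH[of ?b] Cons.prems step s b by (intro add_mono) auto
    finally show ?case using Cons.prems s w by (simp add: m_assoc algebra_simps)
  qed
  show ?thesis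
    unfolding Lp_Lipschitz_def
  proof (intro conjI ballI exI[of _ L] F)
    fix a b assume ab: "a \<in> carrier Z_wr_Z" "b \<in> carrier Z_wr_Z"
    then have "inv\<^bsub>Z_wr_Z\<^esub> a \<otimes>\<^bsub>Z_wr_Z\<^esub> b \<in> carrier Z_wr_Z" by simp
    then obtain w where w: "set w \<subseteq> Z_wr_Z_gens" "length w = wd a b"
      "foldr (mult Z_wr_Z) w \<one>\<^bsub>Z_wr_Z\<^esub> = inv\<^bsub>Z_wr_Z\<^esub> a \<otimes>\<^bsub>Z_wr_Z\<^esub> b"
      using word_length_attained[OF sym_generating_set_Z_wr_Z_gens] unfolding word_dist_def by blast
    have "a \<otimes>\<^bsub>Z_wr_Z\<^esub> (inv\<^bsub>Z_wr_Z\<^esub> a \<otimes>\<^bsub>Z_wr_Z\<^esub> b) = b" using ab by (simp flip: m_assoc)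
    then show "Lp_norm p (\<lambda>t. F a t - F b t) \<le> L * real (wd a b)" using path[OF w(1) ab(1)] w by simp
  qed
qed

lemma config_reflect: "f \<in> config \<Longrightarrow> (\<lambda>z. f (- z)) \<in> config"
proof -
  assume "f \<in> config"
  moreover have "{z. f (- z) \<noteq> 0} = uminus ` {z. f z \<noteq> 0}" by force
  ultimately show ?thesis by (simp add: config_def)
qed

lemma realizes_sym:
  assumes "realizes p X F D" "x \<in> X" "y \<in> X"
  shows "D x y = D y x"
proof -
  have "(LINT t|lborel. \<bar>F x t - F y t\<bar> powr p) = D x y" "(LINT t|lborel. \<bar>F y t - F x t\<bar> powr p) = D y x"
    using assms by (simp_all add: realizes_def)
  then show ?thesis by (simp add: abs_minus_commute)
qed

lemma realizes_base:
  assumes p: "1 \<le> p"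
  shows "\<exists>F. realizes p (carrier Z_wr_Z) F (\<lambda>a b. \<bar>real_of_int (snd a - snd b)\<bar> powr p)"
proof -
  define c where "c a i = real_of_int (snd a)" for a :: "(int \<Rightarrow> int) \<times> int" and i :: unit
  have "countable (carrier Z_wr_Z)"
    using countable_config by (simp add: Z_wr_Z_def config_def)
  then obtain F where "realizes p (carrier Z_wr_Z) F (lp_distance p c)"
    using realizes_lp[OF p, of "carrier Z_wr_Z" c] by auto
  moreover have "lp_distance p c = (\<lambda>a b. \<bar>real_of_int (snd a - snd b)\<bar> powr p)"
  proof (intro ext)
    fix a b
    have "lp_distance p c a b = (\<Sum>i\<in>UNIV. \<bar>c a i - c b i\<bar> powr p)" by (rule lp_distance_eq) auto
    then show "lp_distance p c a b = \<bar>real_of_int (snd a - snd b)\<bar> powr p" by (simp add: c_def UNIV_unit)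
  qed
  ultimately show ?thesis by auto
qed

text \<open>
  The reflection of the integers exchanges the two sides of the cursor.
\<close>
lemma realizes_left:
  assumes p: "1 \<le> p" and \<epsilon>: "0 < \<epsilon>" "\<epsilon> < 1"
  shows "\<exists>F D W. realizes p (carrier Z_wr_Z) F D \<and>
     (\<forall>f\<in>config. \<forall>x. D (f, x) (f, x + 1) \<le> W) \<and>
     (\<forall>f\<in>config. \<forall>x v. D (f, x) (f(x := v), x) = 0) \<and>
     (\<forall>f\<in>config. \<forall>g\<in>config. \<forall>x y z. f z \<noteq> g z \<longrightarrow> z < min x y \<longrightarrow>
        real_of_int (min x y - z) powr (p * (1 - \<epsilon>)) \<le> p * D (f, x) (g, y))"
proof -
  define \<rho> :: "(int \<Rightarrow> int) \<times> int \<Rightarrow> _" where "\<rho> = (\<lambda>(f, x). (\<lambda>z. f (- z), - x))"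
  obtain F D W where F: "realizes p (carrier Z_wr_Z) F D"
    and sh: "\<And>f x. f \<in> config \<Longrightarrow> D (f, x) (f, x + 1) \<le> W"
    and la: "\<And>f x v. f \<in> config \<Longrightarrow> D (f, x) (f(x := v), x) = 0"
    and lo: "\<And>f g x y z. f \<in> config \<Longrightarrow> g \<in> config \<Longrightarrow> f z \<noteq> g z \<Longrightarrow> max x y < z \<Longrightarrow>
        real_of_int (z - max x y) powr (p * (1 - \<epsilon>)) \<le> p * D (f, x) (g, y)"
    using realizes_right[OF p \<epsilon>] by metis
  have "\<rho> ` carrier Z_wr_Z \<subseteq> carrier Z_wr_Z"
    using config_reflect by (auto simp: carrier_config \<rho>_def)
  note R = realizes_comp[OF F this]
  show ?thesis
  proof (intro exI conjI ballI allI impI)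
    show "realizes p (carrier Z_wr_Z) (\<lambda>a. F (\<rho> a)) (\<lambda>a b. D (\<rho> a) (\<rho> b))" by (rule R)
    fix f assume f: "f \<in> config"
    note f' = config_reflect[OF f]
    show "D (\<rho> (f, x)) (\<rho> (f, x + 1)) \<le> W" for x
      using sh[OF f', of "- x - 1"] realizes_sym[OF F, of "\<rho> (f, x)" "\<rho> (f, x + 1)"] f'
      by (simp add: \<rho>_def carrier_config)
    show "D (\<rho> (f, x)) (\<rho> (f(x := v), x)) = 0" for x v
    proof -
      have "\<rho> (f(x := v), x) = ((\<lambda>z. f (- z))(- x := v), - x)" by (auto simp: \<rho>_def fun_eq_iff)
      then show ?thesis using la[OF f', of "- x" v] by (simp add: \<rho>_def)
    qed
    fix g x y z assume g: "g \<in> config" and "f z \<noteq> g z" "z < min x y"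
    moreover have "max (- x) (- y) = - min x y" by (simp only: minus_min_eq_max)
    ultimately show "real_of_int (min x y - z) powr (p * (1 - \<epsilon>)) \<le> p * D (\<rho> (f, x)) (\<rho> (g, y))"
      using lo[OF f' config_reflect[OF g], of "- z" "- x" "- y"] by (simp add: \<rho>_def)
  qed
qed

lemma Z_wr_Z_mult_gen:
  assumes "s \<in> Z_wr_Z_gens"
  shows "(\<exists>e. \<bar>e\<bar> = 1 \<and> (f, x) \<otimes>\<^bsub>Z_wr_Z\<^esub> s = (f(x := f x + e), x)) \<or>
    (f, x) \<otimes>\<^bsub>Z_wr_Z\<^esub> s = (f, x + 1) \<or> (f, x) \<otimes>\<^bsub>Z_wr_Z\<^esub> s = (f, x - 1)"
proof -
  have lamp: "(f, x) \<otimes>\<^bsub>Z_wr_Z\<^esub> (\<lambda>z. if z = 0 then e else 0, 0) = (f(x := f x + e), x)" for e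
    by (auto simp: Z_wr_Z_mult fun_eq_iff)
  have shift: "(f, x) \<otimes>\<^bsub>Z_wr_Z\<^esub> (\<lambda>z. 0, e) = (f, x + e)" for e by (simp add: Z_wr_Z_mult)
  consider "s = (\<lambda>z. 0, 1)" | "s = (\<lambda>z. 0, - 1)" | e where "s = (\<lambda>z. if z = 0 then e else 0, 0)" "\<bar>e\<bar> = 1"
    using assms unfolding Z_wr_Z_gens_def by (elim insertE emptyE) auto
  then show ?thesis
  proof cases
    case 1
    then show ?thesis using shift[of 1] by simp
  next
    case 2
    then show ?thesis using shift[of "- 1"] by simp
  next
    case (3 e)
    then show ?thesis using lamp[of e] by blast
  qed
qed

text \<open>
  All four components are bounded by a power of \<open>X\<close>, the normalized distance of the images. The window
  that contains the differing lamps then has length of order \<open>X powr A\<close>, and Hoelder's inequality on this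
  window bounds the word length.
\<close>
theorem compression_lower:
  assumes p: "1 \<le> p" and \<epsilon>: "0 < \<epsilon>" "\<epsilon> < 1"
  defines "r \<equiv> min p 2"
  defines "\<alpha> \<equiv> (1 - \<epsilon>) / (2 - 1 / r)"
  shows "\<exists>f c. Lp_Lipschitz Z_wr_Z Z_wr_Z_gens p f \<and> c > 0 \<and>
          (\<forall>x\<in>carrier Z_wr_Z. \<forall>y\<in>carrier Z_wr_Z. Lp_norm p (\<lambda>t. f x t - f y t) \<ge> c * real (wd x y) powr \<alpha>)"
proof -
  let ?G = "carrier Z_wr_Z"
  have r: "1 \<le> r" "r \<le> p" using p by (auto simp: r_def)
  have r2: "1 \<le> 2 - 1 / r" using r by (simp add: field_simps)
  have \<alpha>: "0 \<le> \<alpha>" "\<alpha> \<le> 1"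
  proof -
    show "0 \<le> \<alpha>" unfolding \<alpha>_def using \<epsilon> r2 by (intro divide_nonneg_nonneg) auto
    have "\<alpha> \<le> (1 - \<epsilon>) / 1" unfolding \<alpha>_def using \<epsilon> r2 by (intro divide_left_mono) auto
    then show "\<alpha> \<le> 1" using \<epsilon> by simp
  qed
  define Db where "Db a b = \<bar>real_of_int (snd a - snd b)\<bar> powr p" for a b :: "(int \<Rightarrow> int) \<times> int"
  obtain Fb where Fb: "realizes p ?G Fb Db" unfolding Db_def[abs_def] using realizes_base[OF p] by blast
  obtain FR DR WR where FR: "realizes p ?G FR DR"
    and shR: "\<And>f x. f \<in> config \<Longrightarrow> DR (f, x) (f, x + 1) \<le> WR"
    and laR: "\<And>f x v. f \<in> config \<Longrightarrow> DR (f, x) (f(x := v), x) = 0"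
    and loR: "\<And>f g x y z. f \<in> config \<Longrightarrow> g \<in> config \<Longrightarrow> f z \<noteq> g z \<Longrightarrow> max x y < z \<Longrightarrow>
        real_of_int (z - max x y) powr (p * (1 - \<epsilon>)) \<le> p * DR (f, x) (g, y)"
    using realizes_right[OF p \<epsilon>] by metis
  obtain FL DL WL where FL: "realizes p ?G FL DL"
    and shL: "\<And>f x. f \<in> config \<Longrightarrow> DL (f, x) (f, x + 1) \<le> WL"
    and laL: "\<And>f x v. f \<in> config \<Longrightarrow> DL (f, x) (f(x := v), x) = 0"
    and loL: "\<And>f g x y z. f \<in> config \<Longrightarrow> g \<in> config \<Longrightarrow> f z \<noteq> g z \<Longrightarrow> z < min x y \<Longrightarrow>
        real_of_int (min x y - z) powr (p * (1 - \<epsilon>)) \<le> p * DL (f, x) (g, y)"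
    using realizes_left[OF p \<epsilon>] by metis
  obtain F0 D0 where F0: "realizes p config F0 D0"
    and lo0: "\<And>f g. f \<in> config \<Longrightarrow> g \<in> config \<Longrightarrow> lamp_energy r f g powr (p / r) \<le> D0 f g"
    and la0: "\<And>f z e. f \<in> config \<Longrightarrow> \<bar>e\<bar> \<le> 1 \<Longrightarrow> D0 f (f(z := f z + e)) \<le> 2 powr p"
    using realizes_lamps[OF p] unfolding r_def by metis
  have "fst ` ?G \<subseteq> config" by (auto simp: carrier_config)
  note F0' = realizes_comp[OF F0 this]
  define Dt where "Dt a b = Db a b + DR a b + DL a b + D0 (fst a) (fst b)" for a b
  obtain F1 where F1: "realizes p ?G F1 (\<lambda>a b. (Db a b + DR a b) / 2)"
    using realizes_glue[OF p Fb FR] by blast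
  obtain F2 where F2: "realizes p ?G F2 (\<lambda>a b. (DL a b + D0 (fst a) (fst b)) / 2)"
    using realizes_glue[OF p FL F0'] by blast
  obtain F where F: "realizes p ?G F (\<lambda>a b. ((Db a b + DR a b) / 2 + (DL a b + D0 (fst a) (fst b)) / 2) / 2)"
    using realizes_glue[OF p F1 F2] by blast
  then have F: "realizes p ?G F (\<lambda>a b. Dt a b / 4)"
    by (simp add: Dt_def add_divide_distrib add.assoc)
  have pos: "0 \<le> Db a b" "0 \<le> DR a b" "0 \<le> DL a b" "0 \<le> D0 (fst a) (fst b)" if "a \<in> ?G" "b \<in> ?G" for a b
    using realizes_Lp_norm(3)[OF p Fb that] realizes_Lp_norm(3)[OF p FR that]
      realizes_Lp_norm(3)[OF p FL that] realizes_Lp_norm(3)[OF p F0' that] by auto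
  define Q where "Q = 1 + \<bar>WR\<bar> + \<bar>WL\<bar> + 2 powr p"
  have shift: "Dt (f, x) (f, x + 1) \<le> Q" if f: "f \<in> config" for f x
    using shR[OF f, of x] shL[OF f, of x] la0[OF f, of 0 0] by (simp add: Dt_def Db_def Q_def)
  have Lip: "Lp_Lipschitz Z_wr_Z Z_wr_Z_gens p F"
  proof (rule Lp_Lipschitz_of_gens[OF p])
    show "F a \<in> Lp_fun p" if "a \<in> ?G" for a using realizes_Lp_norm(1)[OF p F that that] .
    fix a s assume a: "a \<in> ?G" and s: "s \<in> Z_wr_Z_gens"
    obtain f x where fx: "a = (f, x)" by fastforce
    have f: "f \<in> config" using a by (simp add: fx carrier_config)
    have as: "a \<otimes>\<^bsub>Z_wr_Z\<^esub> s \<in> ?G" by (rule Z_wr_Z_closed[OF a Z_wr_Z_gens_closed(1)[OF s]])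
    have "Dt a (a \<otimes>\<^bsub>Z_wr_Z\<^esub> s) \<le> Q"
      using Z_wr_Z_mult_gen[OF s, of f x]
    proof (elim disjE exE conjE)
      fix e :: int assume "\<bar>e\<bar> = 1" "(f, x) \<otimes>\<^bsub>Z_wr_Z\<^esub> s = (f(x := f x + e), x)"
      then show ?thesis using laR[OF f] laL[OF f] la0[OF f, of e x] p by (simp add: fx Dt_def Db_def Q_def)
    next
      assume "(f, x) \<otimes>\<^bsub>Z_wr_Z\<^esub> s = (f, x + 1)"
      then show ?thesis using shift[OF f, of x] by (simp add: fx)
    next
      assume eq: "(f, x) \<otimes>\<^bsub>Z_wr_Z\<^esub> s = (f, x - 1)"
      have "Dt (f, x) (f, x - 1) / 4 = Dt (f, x - 1) (f, x) / 4"
        by (rule realizes_sym[OF F]) (use f in \<open>simp_all add: carrier_config\<close>)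
      then show ?thesis using shift[OF f, of "x - 1"] eq by (simp add: fx)
    qed
    then have "Dt a (a \<otimes>\<^bsub>Z_wr_Z\<^esub> s) / 4 \<le> Q / 4" by simp
    then have "(Dt a (a \<otimes>\<^bsub>Z_wr_Z\<^esub> s) / 4) powr (1 / p) \<le> (Q / 4) powr (1 / p)"
      using p realizes_Lp_norm(3)[OF p F a as] by (intro powr_mono2) auto
    then show "Lp_norm p (\<lambda>t. F a t - F (a \<otimes>\<^bsub>Z_wr_Z\<^esub> s) t) \<le> (Q / 4) powr (1 / p)"
      using realizes_Lp_norm(2)[OF p F a as] by simp
  qed
  define c where "c = 1 / (25 * (8 * p) powr (1 / p))"
  have c: "0 < c" using p by (simp add: c_def)
  have lower: "c * real (wd a b) powr \<alpha> \<le> Lp_norm p (\<lambda>t. F a t - F b t)" if ab: "a \<in> ?G" "b \<in> ?G" for a b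
  proof (cases "a = b")
    case True
    then have "wd a b = 0"
      using ab group.l_inv[OF group_Z_wr_Z] group.word_length_one[OF group_Z_wr_Z] by (simp add: word_dist_def)
    then show ?thesis by (simp add: Lp_norm_nonneg)
  next
    case False
    obtain f x g y where fg: "a = (f, x)" "b = (g, y)" by fastforce
    have f: "f \<in> config" and g: "g \<in> config" using ab by (auto simp: fg carrier_config)
    note pos = pos[OF ab]
    define \<Delta> where "\<Delta> z = g (z + x) - f (z + x)" for z
    define A where "A = 1 / (1 - \<epsilon>)"
    \<comment> \<open>Normalized so that \<open>X\<close> is at least \<open>1\<close> and \<open>X powr p\<close> exceeds \<open>p\<close> times each component.\<close>
    define X where "X = (p * (Dt a b + 1)) powr (1 / p)"
    have A: "1 \<le> A" using \<epsilon> by (simp add: A_def field_simps)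
    have Dt0: "0 \<le> Dt a b" using pos by (simp add: Dt_def)
    have Xp: "X powr p = p * (Dt a b + 1)" using p Dt0 by (simp add: X_def powr_powr)
    have X1: "1 \<le> X" unfolding X_def using p Dt0 mult_mono[of 1 p 1 "Dt a b + 1"]
      by (intro ge_one_powr_ge_zero) auto
    have XA: "X \<le> X powr A" using powr_mono[of 1 A X] A X1 by simp
    have root: "u \<le> X powr (1 / q)" if "u powr (p * q) \<le> X powr p" "0 \<le> u" "0 < q" for u q
    proof -
      have "(u powr (p * q)) powr (1 / (p * q)) \<le> (X powr p) powr (1 / (p * q))"
        using that p by (intro powr_mono2) auto
      then show ?thesis using that p by (simp add: powr_powr)
    qed
    have pD: "d \<le> p * (Dt a b + 1)" "p * d \<le> p * (Dt a b + 1)" if "0 \<le> d" "d \<le> Dt a b" for d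
    proof -
      show "p * d \<le> p * (Dt a b + 1)" using that p by (intro mult_left_mono) auto
      moreover have "1 * d \<le> p * d" using that p by (intro mult_right_mono) auto
      ultimately show "d \<le> p * (Dt a b + 1)" by simp
    qed
    have "Db a b \<le> X powr p" unfolding Xp using pos by (intro pD) (auto simp: Dt_def)
    then have xy: "\<bar>real_of_int (x - y)\<bar> \<le> X"
      using root[of "\<bar>real_of_int (x - y)\<bar>" 1] X1 by (simp add: Db_def fg)
    have right: "real_of_int (w - max x y) \<le> X powr A" if w: "f w \<noteq> g w" "max x y < w" for w
    proof -
      have "p * DR a b \<le> X powr p" unfolding Xp using pos by (intro pD) (auto simp: Dt_def)
      then have "real_of_int (w - max x y) powr (p * (1 - \<epsilon>)) \<le> X powr p"
        using loR[OF f g w] by (simp add: fg)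
      then show ?thesis unfolding A_def using \<epsilon> w by (intro root) auto
    qed
    have left: "real_of_int (min x y - w) \<le> X powr A" if w: "f w \<noteq> g w" "w < min x y" for w
    proof -
      have "p * DL a b \<le> X powr p" unfolding Xp using pos by (intro pD) (auto simp: Dt_def)
      then have "real_of_int (min x y - w) powr (p * (1 - \<epsilon>)) \<le> X powr p"
        using loL[OF f g w] by (simp add: fg)
      then show ?thesis unfolding A_def using \<epsilon> w by (intro root) auto
    qed
    define R where "R = nat \<lceil>2 * X powr A\<rceil> + 1"
    have R: "2 * X powr A < real R" "real R \<le> 4 * X powr A" using X1 XA unfolding R_def by linarith+
    have supp: "{z. \<Delta> z \<noteq> 0} \<subseteq> {- int R..<int R}"
    proof
      fix z assume "z \<in> {z. \<Delta> z \<noteq> 0}"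
      then have ne: "f (z + x) \<noteq> g (z + x)" by (simp add: \<Delta>_def)
      have "\<bar>real_of_int z\<bar> \<le> 2 * X powr A"
        using right[OF ne] left[OF ne] xy XA by (cases "max x y < z + x"; cases "z + x < min x y") (auto simp: max_def min_def split: if_splits)
      then have "\<bar>real_of_int z\<bar> < real R" using R by linarith
      then show "z \<in> {- int R..<int R}" by auto
    qed
    define s where "s = (\<Sum>z\<in>{- int R..<int R}. \<bar>real_of_int (\<Delta> z)\<bar>)"
    have "real_of_int (int (wl (\<Delta>, y - x))) \<le> real_of_int (4 * int R + \<bar>y - x\<bar> + (\<Sum>z\<in>{- int R..<int R}. \<bar>\<Delta> z\<bar>))"
      using wl_le[OF supp, of "y - x"] by (simp only: of_int_le_iff)
    moreover have "wd a b = wl (\<Delta>, y - x)"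
      unfolding fg using f by (subst wd_eq) (auto simp: config_def \<Delta>_def[abs_def])
    ultimately have wd: "real (wd a b) \<le> 4 * real R + \<bar>real_of_int (x - y)\<bar> + s"
      by (simp add: s_def)
    have energy: "(\<Sum>z\<in>{- int R..<int R}. \<bar>real_of_int (\<Delta> z)\<bar> powr r) = lamp_energy r f g"
    proof -
      have "(\<Sum>z\<in>{- int R..<int R}. \<bar>real_of_int (\<Delta> z)\<bar> powr r) = (\<Sum>z | \<Delta> z \<noteq> 0. \<bar>real_of_int (\<Delta> z)\<bar> powr r)"
        using supp by (intro sum.mono_neutral_right) auto
      also have "\<dots> = lamp_energy r f g"
        unfolding lamp_energy_def
        by (rule sum.reindex_bij_witness[of _ "\<lambda>w. w - x" "\<lambda>z. z + x"]) (auto simp: \<Delta>_def abs_minus_commute)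
      finally show ?thesis .
    qed
    have "lamp_energy r f g powr (p / r) \<le> X powr p"
    proof -
      have "D0 f g \<le> X powr p" unfolding Xp using pos by (intro pD) (auto simp: Dt_def fg)
      then show ?thesis using lo0[OF f g] by simp
    qed
    moreover have e0: "0 \<le> lamp_energy r f g" unfolding lamp_energy_def by (intro sum_nonneg) auto
    ultimately have eX: "lamp_energy r f g \<le> X powr r" using root[of "lamp_energy r f g" "1 / r"] r by simp
    have s: "s \<le> 8 * X powr (A * (2 - 1 / r))"
    proof -
      define N where "N = 2 * real R"
      have N: "0 < N" using R X1 XA by (simp add: N_def)
      have NX: "N \<le> 8 * X powr A" using R by (simp add: N_def)
      have cardN: "real (card {- int R..<int R}) = N" by (simp add: N_def)
      have "(\<Sum>z\<in>{- int R..<int R}. 1 / N * \<bar>real_of_int (\<Delta> z)\<bar>) powr r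
        \<le> (\<Sum>z\<in>{- int R..<int R}. 1 / N * \<bar>real_of_int (\<Delta> z)\<bar> powr r)"
        using N r cardN by (intro powr_sum_le) auto
      then have "(s / N) powr r \<le> lamp_energy r f g / N"
        unfolding sum_distrib_left[symmetric] energy s_def[symmetric] by simp
      also have "\<dots> \<le> X powr r / N" using eX N by (intro divide_right_mono) auto
      finally have "((s / N) powr r) powr (1 / r) \<le> (X powr r / N) powr (1 / r)"
        using r by (intro powr_mono2) auto
      moreover have "0 \<le> s" unfolding s_def by (intro sum_nonneg) auto
      ultimately have "s / N \<le> X / N powr (1 / r)" using r N X1 by (simp add: powr_powr powr_divide)
      then have "s \<le> X * (N / N powr (1 / r))" using N by (simp add: field_simps)
      also have "N / N powr (1 / r) = N powr (1 - 1 / r)" using N by (simp add: powr_diff)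
      also have "\<dots> \<le> (8 * X powr A) powr (1 - 1 / r)" using N NX r by (intro powr_mono2) auto
      also have "\<dots> = 8 powr (1 - 1 / r) * X powr (A * (1 - 1 / r))" by (simp add: powr_mult powr_powr)
      also have "8 powr (1 - 1 / r) \<le> (8 :: real) powr 1" using r by (intro powr_mono) auto
      finally have "s \<le> X * (8 * X powr (A * (1 - 1 / r)))" using X1 by (simp add: mult_left_mono mult_right_mono)
      also have "\<dots> \<le> X powr A * (8 * X powr (A * (1 - 1 / r)))" using XA by (intro mult_right_mono) auto
      also have "\<dots> = 8 * X powr (A + A * (1 - 1 / r))" by (simp add: powr_add)
      also have "A + A * (1 - 1 / r) = A * (2 - 1 / r)" by (simp add: algebra_simps)
      finally show ?thesis .
    qed
    have "X powr A \<le> X powr (A * (2 - 1 / r))"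
      using X1 A r mult_left_mono[of 1 "2 - 1 / r" A] by (intro powr_mono) auto
    \<comment> \<open>The terms of \<open>wl_le\<close> contribute \<open>16\<close>, \<open>1\<close> and \<open>8\<close>.\<close>
    then have "real (wd a b) \<le> 25 * X powr (A * (2 - 1 / r))" using wd R xy XA s by linarith
    then have "real (wd a b) powr \<alpha> \<le> (25 * X powr (A * (2 - 1 / r))) powr \<alpha>"
      using \<alpha> by (intro powr_mono2) auto
    also have "\<dots> = 25 powr \<alpha> * X"
    proof -
      have "A * (2 - 1 / r) * \<alpha> = 1" using \<epsilon> r2 unfolding A_def \<alpha>_def by simp
      then show ?thesis using X1 by (simp add: powr_mult powr_powr)
    qed
    also have "\<dots> \<le> 25 * X"
    proof -
      have "25 powr \<alpha> \<le> (25 :: real) powr 1" using \<alpha> by (intro powr_mono) auto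
      then show ?thesis using X1 by (intro mult_right_mono) auto
    qed
    finally have up: "real (wd a b) powr \<alpha> \<le> 25 * X" .
    have "1 \<le> Dt a b"
    proof (cases "x = y")
      case True
      then have "f \<noteq> g" using False fg by simp
      then obtain z where z: "f z \<noteq> g z" by auto
      have "1 \<le> \<bar>real_of_int (f z - g z)\<bar>" using z by linarith
      then have "1 \<le> \<bar>real_of_int (f z - g z)\<bar> powr r" using r by (intro ge_one_powr_ge_zero) auto
      also have "\<dots> \<le> lamp_energy r f g"
        unfolding lamp_energy_def using z finite_config_diff[OF f g] by (intro member_le_sum) auto
      finally have "1 \<le> lamp_energy r f g powr (p / r)" using r p by (intro ge_one_powr_ge_zero) auto
      then have "1 \<le> D0 f g" using lo0[OF f g] by simp
      then show ?thesis using pos by (simp add: Dt_def fg)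
    next
      case c: False
      then have "1 \<le> \<bar>real_of_int (x - y)\<bar>" by linarith
      then have "1 \<le> Db a b" using p by (simp add: Db_def fg ge_one_powr_ge_zero)
      then show ?thesis using pos by (simp add: Dt_def)
    qed
    then have "p * (Dt a b + 1) \<le> p * (2 * Dt a b)" using p by (intro mult_left_mono) auto
    then have "X \<le> (8 * p * (Dt a b / 4)) powr (1 / p)"
      unfolding X_def using p Dt0 by (intro powr_mono2) auto
    also have "\<dots> = (8 * p) powr (1 / p) * (Dt a b / 4) powr (1 / p)" by (rule powr_mult)
    also have "\<dots> = (8 * p) powr (1 / p) * Lp_norm p (\<lambda>t. F a t - F b t)"
      using realizes_Lp_norm(2)[OF p F ab] by simp
    finally have "25 * X \<le> 25 * ((8 * p) powr (1 / p) * Lp_norm p (\<lambda>t. F a t - F b t))" by simp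
    then have "real (wd a b) powr \<alpha> \<le> 25 * (8 * p) powr (1 / p) * Lp_norm p (\<lambda>t. F a t - F b t)"
      using up by simp
    then have "c * real (wd a b) powr \<alpha> \<le> c * (25 * (8 * p) powr (1 / p) * Lp_norm p (\<lambda>t. F a t - F b t))"
      using c by (intro mult_left_mono) auto
    also have "\<dots> = Lp_norm p (\<lambda>t. F a t - F b t)" using p by (simp add: c_def)
    finally show ?thesis .
  qed
  show ?thesis using Lip c lower by blast
qed

theorem mainTheorem2:
  fixes p :: real and S :: "((int \<Rightarrow> int) \<times> int) set"
  assumes "1 \<le> p"
    and "sym_generating_set Z_wr_Z S"
  shows "Lp_compression_exponent p Z_wr_Z S = ereal (max (p / (2 * p - 1)) (2 / 3))"
proof -
  define r where "r = min p 2"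
  have r: "1 \<le> r" using assms by (simp add: r_def)
  have val: "max (p / (2 * p - 1)) (2 / 3) = r / (2 * r - 1)"
    using assms by (auto simp: r_def max_def min_def field_simps)
  have "Lp_compression_exponent p Z_wr_Z Z_wr_Z_gens = ereal (r / (2 * r - 1))"
    unfolding Lp_compression_exponent_def
  proof (rule antisym)
    show "Sup {ereal \<alpha> | \<alpha>. \<alpha> \<ge> 0 \<and>
       (\<exists>f c. Lp_Lipschitz Z_wr_Z Z_wr_Z_gens p f \<and> c > 0 \<and>
          (\<forall>x\<in>carrier Z_wr_Z. \<forall>y\<in>carrier Z_wr_Z. Lp_norm p (\<lambda>t. f x t - f y t) \<ge> c * real (wd x y) powr \<alpha>))}
       \<le> ereal (r / (2 * r - 1))" (is "Sup ?A \<le> _")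
    proof (rule Sup_least)
      fix e assume "e \<in> ?A"
      then obtain \<alpha> f c where "e = ereal \<alpha>" "\<alpha> \<ge> 0" "Lp_Lipschitz Z_wr_Z Z_wr_Z_gens p f" "c > 0"
        "\<forall>x\<in>carrier Z_wr_Z. \<forall>y\<in>carrier Z_wr_Z. Lp_norm p (\<lambda>t. f x t - f y t) \<ge> c * real (wd x y) powr \<alpha>"
        by blast
      then show "e \<le> ereal (r / (2 * r - 1))"
        using compression_upper[OF assms(1), of \<alpha> f c] by (simp add: r_def)
    qed
    show "ereal (r / (2 * r - 1)) \<le> Sup ?A"
    proof (rule ereal_le_epsilon2)
      fix \<delta> :: real assume \<delta>: "0 < \<delta>"
      define \<epsilon> where "\<epsilon> = min (1 / 2) \<delta>"
      have \<epsilon>: "0 < \<epsilon>" "\<epsilon> < 1" "\<epsilon> \<le> \<delta>" using \<delta> by (auto simp: \<epsilon>_def)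
      have r2: "1 \<le> 2 - 1 / r" using r by (simp add: field_simps)
      have v: "r / (2 * r - 1) = 1 / (2 - 1 / r)" using r by (simp add: field_simps)
      have "0 \<le> (1 - \<epsilon>) / (2 - 1 / r)" using \<epsilon> r2 by simp
      with compression_lower[OF assms(1) \<epsilon>(1,2)]
      have "ereal ((1 - \<epsilon>) / (2 - 1 / r)) \<in> ?A" unfolding r_def by blast
      then have 1: "ereal ((1 - \<epsilon>) / (2 - 1 / r)) \<le> Sup ?A" by (rule Sup_upper)
      have "\<epsilon> / (2 - 1 / r) \<le> \<epsilon> / 1" using \<epsilon> r2 by (intro divide_left_mono) auto
      then have "r / (2 * r - 1) \<le> (1 - \<epsilon>) / (2 - 1 / r) + \<delta>"
        unfolding v using \<epsilon> by (simp add: diff_divide_distrib)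
      then have "ereal (r / (2 * r - 1)) \<le> ereal ((1 - \<epsilon>) / (2 - 1 / r)) + ereal \<delta>" by simp
      also have "\<dots> \<le> Sup ?A + ereal \<delta>" using 1 by (rule add_right_mono)
      finally show "ereal (r / (2 * r - 1)) \<le> Sup ?A + ereal \<delta>" .
    qed
  qed
  then show ?thesis
    using Lp_compression_exponent_gen_indep[OF group_Z_wr_Z assms(2) sym_generating_set_Z_wr_Z_gens] val by simp
qed

end
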